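(* Let $X$ be a compact Riemann surface of genus $g$ and let $\omega_1,\omega_2,\omega_3$ be differential forms of the third kind on $X$ with pairwise disjoint sets of poles. Let $P_1,\dots,P_p$ be the poles of $\omega_1$, $Q_1,\dots,Q_q$ the poles of $\omega_2$, $R_1,\dots,R_r$ the poles of $\omega_3$, and let $P$ be a point of $X$ which is not a pole of any of the forms. With loops $\alpha_l,\beta_l$ ($l=1,\dots,g$) and paths $\gamma_{P_i},\gamma_{Q_j},\gamma_{R_k}$ chosen as described in the context, $$\begin{aligned}&\sum_{i=1}^p \mathrm{Res}_{P_i}\omega_1\int_{\gamma_{P_i}^{-1}}\omega_2\circ\omega_3+\sum_{j=1}^q \mathrm{Res}_{Q_j}\omega_2\int_{\gamma_{Q_j}^{-1}}\omega_1\int_{\gamma_{Q_j}}\omega_3+\sum_{k=1}^r \mathrm{Res}_{R_k}\omega_3\int_{\gamma_{R_k}}\omega_1\circ\omega_2\\&+\sum_{l=1}^g\Big(\int_{\alpha_l}\omega_1\circ\omega_2\int_{\beta_l}\omega_3-\int_{\beta_l}\omega_1\circ\omega_2\int_{\alpha_l}\omega_3+\int_{\alpha_l}\omega_3\circ\omega_2\int_{\beta_l}\omega_1-\int_{\beta_l}\omega_3\circ\omega_2\int_{\alpha_l}\omega_1\\&\qquad-\int_{\alpha_l}\omega_1\int_{\beta_l}\omega_2\int_{\alpha_l}\omega_3+\int_{\beta_l}\omega_1\int_{\alpha_l}\omega_2\int_{\beta_l}\omega_3\Big)=0.\end{aligned}$$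
   Context: Differential forms of the third kind are meromorphic $1$-forms with at most simple poles. For a piecewise smooth path $\gamma:[0,1]\to X$ avoiding the poles, $$\int_\gamma\omega_{1}\circ\cdots\circ\omega_{k}=\int_{0\le t_1\le\cdots\le t_k\le1}\gamma^*\omega_{1}(t_1)\wedge\cdots\wedge\gamma^*\omega_{k}(t_k);$$ for paths starting or ending at a pole of one of the forms, the same notation denotes the corresponding convergent integral. Paths are composed from left to right, $\gamma^{-1}$ is the reversed path, and $[\alpha,\beta]=\alpha\beta\alpha^{-1}\beta^{-1}$. Residue convention: $\mathrm{Res}_Q\omega$ denotes the integral of $\omega$ over a small counterclockwise circle around $Q$, i.e. $2\pi i$ times the usual residue. Choice of loops and paths: let $Y=X\setminus\{P_1,\dots,P_p,Q_1,\dots,Q_q,R_1,\dots,R_r\}$. For each pole $S$ among the $P_i,Q_j,R_k$, $\sigma_S$ is a simple loop in $Y$ based at $P$, bounding (counterclockwise) an open region $V_S$ homeomorphic to a punctured disk, whose closure is a disk containing $S$ and no other pole of the forms; these loops meet each other only at $P$. In counterclockwise order one starts with $\sigma_{P_1},\dots,\sigma_{P_p}$, followed by $\sigma_{Q_1},\dots,\sigma_{Q_q}$, followed by $\sigma_{R_1},\dots,\sigma_{R_r}$. The loops $\alpha_l,\beta_l$ ($l=1,\dots,g$) in $Y$ based at $P$ are such that all these loops generate $\pi_1(Y,P)$ with the only relation $$\sigma_{P_1}\cdots\sigma_{P_p}\,\sigma_{Q_1}\cdots\sigma_{Q_q}\,\sigma_{R_1}\cdots\sigma_{R_r}\,[\alpha_1,\beta_1]\cdots[\alpha_g,\beta_g]=1.$$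 For each pole $S$, $\gamma_S$ is a path from $P$ to $S$ lying inside the disk bounded by $\sigma_S$. *)

theory Defs
  imports "HOL-Complex_Analysis.Complex_Analysis" "HOL-Homology.Homology"
begin

text \<open>The surface is the whole Hausdorff type \<open>'a\<close>; a chart is a coordinate neighbourhood together
  with its coordinate function (whose values outside the neighbourhood are irrelevant).\<close>

type_synonym 'a chart = "'a set \<times> ('a \<Rightarrow> complex)"

definition is_chart :: "'a::topological_space chart \<Rightarrow> bool" where
  "is_chart c \<longleftrightarrow> open (fst c) \<and> open (snd c ` fst c) \<and>
     (\<exists>\<psi>. homeomorphism (fst c) (snd c ` fst c) (snd c) \<psi>)"

definition chart_inv :: "'a chart \<Rightarrow> complex \<Rightarrow> 'a" where
  "chart_inv c = inv_into (fst c) (snd c)"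

definition transition :: "'a chart \<Rightarrow> 'a chart \<Rightarrow> complex \<Rightarrow> complex" where
  "transition c d = snd d \<circ> chart_inv c"

definition riemann_surface :: "'a::t2_space chart set \<Rightarrow> bool" where
  "riemann_surface A \<longleftrightarrow>
     connected (UNIV :: 'a set) \<and>
     (\<forall>c\<in>A. is_chart c) \<and>
     (\<Union>c\<in>A. fst c) = UNIV \<and>
     (\<forall>c\<in>A. \<forall>d\<in>A. transition c d holomorphic_on snd c ` (fst c \<inter> fst d))"

definition compact_riemann_surface :: "'a::t2_space chart set \<Rightarrow> bool" where
  "compact_riemann_surface A \<longleftrightarrow> riemann_surface A \<and> compact (UNIV :: 'a set)"

text \<open>The genus of a compact Riemann surface is half the rank of its first integral homology.\<close>

definition has_genus :: "'a::t2_space chart set \<Rightarrow> nat \<Rightarrow> bool" where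
  "has_genus A g \<longleftrightarrow>
     homology_group 1 (euclidean :: 'a topology) \<cong> free_Abelian_group {..<2 * g}"

definition chart_at :: "'a chart set \<Rightarrow> 'a \<Rightarrow> 'a chart" where
  "chart_at A x = (SOME c. c \<in> A \<and> x \<in> fst c)"

text \<open>A meromorphic \<open>1\<close>-form assigns to a chart with coordinate \<open>z\<close> the coefficient \<open>f\<close> of
  \<open>f(z) dz\<close>. Since functions are total, coefficients are normalised to take the value \<open>0\<close> at poles
  (this is what \<^const>\<open>nicely_meromorphic_on\<close> says), so that the transformation law also makes
  sense, and holds, at poles.\<close>

type_synonym 'a form = "'a chart \<Rightarrow> complex \<Rightarrow> complex"

definition meromorphic_form :: "'a chart set \<Rightarrow> 'a form \<Rightarrow> bool" where
  "meromorphic_form A \<omega> \<longleftrightarrow>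
     (\<forall>c\<in>A. \<omega> c nicely_meromorphic_on snd c ` fst c) \<and>
     (\<forall>c\<in>A. \<forall>d\<in>A. \<forall>z \<in> snd c ` (fst c \<inter> fst d).
        \<omega> c z = \<omega> d (transition c d z) * deriv (transition c d) z)"

definition form_poles :: "'a chart set \<Rightarrow> 'a form \<Rightarrow> 'a set" where
  "form_poles A \<omega> = {x. \<exists>c\<in>A. x \<in> fst c \<and> is_pole (\<omega> c) (snd c x)}"

definition third_kind_form :: "'a chart set \<Rightarrow> 'a form \<Rightarrow> bool" where
  "third_kind_form A \<omega> \<longleftrightarrow> meromorphic_form A \<omega> \<and>
     (\<forall>c\<in>A. \<forall>x\<in>fst c. is_pole (\<omega> c) (snd c x) \<longrightarrow> zorder (\<omega> c) (snd c x) = -1)"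

text \<open>The convention includes the factor \<open>2\<pi>i\<close>: this is the integral of \<open>\<omega>\<close> over a small
  counterclockwise circle around \<open>x\<close>. It does not depend on the chart.\<close>

definition form_Res :: "'a chart set \<Rightarrow> 'a \<Rightarrow> 'a form \<Rightarrow> complex" where
  "form_Res A x \<omega> = 2 * of_real pi * \<i> * residue (\<omega> (chart_at A x)) (snd (chart_at A x) x)"

text \<open>Piecewise smooth means: continuous on \<open>[0,1]\<close>, and continuously differentiable in every chart
  on the closed pieces of a finite subdivision, with one-sided derivatives at the end points of the
  pieces. (\<^const>\<open>piecewise_C1_differentiable_on\<close> would be too weak here, as it does not control the
  derivative near the exceptional points.)\<close>

definition C1_on_segment ::
    "'a::topological_space chart set \<Rightarrow> (real \<Rightarrow> 'a) \<Rightarrow> real set \<Rightarrow> bool" where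
  "C1_on_segment A \<gamma> I \<longleftrightarrow>
     (\<forall>c\<in>A. \<exists>D. continuous_on (I \<inter> \<gamma> -` fst c) D \<and>
        (\<forall>t \<in> I \<inter> \<gamma> -` fst c. ((snd c \<circ> \<gamma>) has_vector_derivative D t) (at t within I)))"

definition piecewise_smooth_path ::
    "'a::topological_space chart set \<Rightarrow> (real \<Rightarrow> 'a) \<Rightarrow> bool" where
  "piecewise_smooth_path A \<gamma> \<longleftrightarrow> path \<gamma> \<and>
     (\<exists>(n::nat) s. s 0 = 0 \<and> s n = 1 \<and>
        (\<forall>i<n. s i < s (Suc i) \<and> C1_on_segment A \<gamma> {s i..s (Suc i)}))"

text \<open>The coefficient of \<open>dt\<close> in the pullback of \<open>\<omega>\<close> along \<open>\<gamma>\<close> at \<open>t\<close>. Where \<open>\<gamma>\<close> is differentiable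
  it does not depend on the chart.\<close>

definition pullback_coeff ::
    "'a chart set \<Rightarrow> (real \<Rightarrow> 'a) \<Rightarrow> 'a form \<Rightarrow> real \<Rightarrow> complex" where
  "pullback_coeff A \<gamma> \<omega> t =
     (let c = chart_at A (\<gamma> t)
      in \<omega> c (snd c (\<gamma> t)) * vector_derivative (snd c \<circ> \<gamma>) (at t within {0..1}))"

definition time_simplex :: "nat \<Rightarrow> (nat \<Rightarrow> real) set" where
  "time_simplex k = {t. (\<forall>i<k. 0 \<le> t i \<and> t i \<le> 1) \<and> (\<forall>i j. i \<le> j \<and> j < k \<longrightarrow> t i \<le> t j)}"

definition iter_integral ::
    "'a chart set \<Rightarrow> (real \<Rightarrow> 'a) \<Rightarrow> 'a form list \<Rightarrow> complex" where
  "iter_integral A \<gamma> \<omega>s =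
     (LINT t : time_simplex (length \<omega>s) | PiM {..<length \<omega>s} (\<lambda>_. lborel).
        (\<Prod>i<length \<omega>s. pullback_coeff A \<gamma> (\<omega>s ! i) (t i)))"

definition loop_in :: "'a::topological_space set \<Rightarrow> 'a \<Rightarrow> (real \<Rightarrow> 'a) \<Rightarrow> bool" where
  "loop_in Y b p \<longleftrightarrow> path p \<and> path_image p \<subseteq> Y \<and> pathstart p = b \<and> pathfinish p = b"

text \<open>Words in generators and their inverses; the letter \<open>(x, False)\<close> stands for the inverse of \<open>x\<close>.\<close>

type_synonym 'g word = "('g \<times> bool) list"

primrec word_path :: "'a::topological_space \<Rightarrow> ('g \<Rightarrow> real \<Rightarrow> 'a) \<Rightarrow> 'g word \<Rightarrow> real \<Rightarrow> 'a" where
  "word_path b loop [] = (\<lambda>_. b)"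
| "word_path b loop (l # w) =
     (if snd l then loop (fst l) else reversepath (loop (fst l))) +++ word_path b loop w"

text \<open>Equality of words in the group with the single defining relation \<open>r = 1\<close>.\<close>

inductive word_eq :: "'g word \<Rightarrow> 'g word \<Rightarrow> 'g word \<Rightarrow> bool" for r :: "'g word" where
  refl: "word_eq r w w"
| sym: "word_eq r v w \<Longrightarrow> word_eq r w v"
| trans: "word_eq r u v \<Longrightarrow> word_eq r v w \<Longrightarrow> word_eq r u w"
| cancel: "word_eq r (u @ [(x, e), (x, \<not> e)] @ v) (u @ v)"
| relator: "word_eq r (u @ r @ v) (u @ v)"

text \<open>The classes of the loops \<open>loop x\<close>, \<open>x \<in> G\<close>, generate the fundamental group of \<open>Y\<close> at \<open>b\<close>, and
  \<open>r = 1\<close> is the only relation between them.\<close>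

definition presents_fundamental_group ::
    "'a::topological_space set \<Rightarrow> 'a \<Rightarrow> 'g set \<Rightarrow> ('g \<Rightarrow> real \<Rightarrow> 'a) \<Rightarrow> 'g word \<Rightarrow> bool" where
  "presents_fundamental_group Y b G loop r \<longleftrightarrow>
     (\<forall>x\<in>G. loop_in Y b (loop x)) \<and>
     (\<forall>p. loop_in Y b p \<longrightarrow>
        (\<exists>w \<in> lists (G \<times> UNIV). homotopic_paths Y p (word_path b loop w))) \<and>
     (\<forall>w \<in> lists (G \<times> UNIV).
        homotopic_paths Y (word_path b loop w) (\<lambda>_. b) \<longleftrightarrow> word_eq r w [])"

definition commutator_word :: "'g \<Rightarrow> 'g \<Rightarrow> 'g word" where
  "commutator_word x y = [(x, True), (y, True), (x, False), (y, False)]"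

datatype 'a generator = Sigma_gen 'a | Alpha_gen nat | Beta_gen nat

primrec generator_loop ::
    "('a \<Rightarrow> real \<Rightarrow> 'a) \<Rightarrow> (nat \<Rightarrow> real \<Rightarrow> 'a) \<Rightarrow> (nat \<Rightarrow> real \<Rightarrow> 'a) \<Rightarrow> 'a generator \<Rightarrow> real \<Rightarrow> 'a" where
  "generator_loop \<sigma> \<alpha> \<beta> (Sigma_gen S) = \<sigma> S"
| "generator_loop \<sigma> \<alpha> \<beta> (Alpha_gen l) = \<alpha> l"
| "generator_loop \<sigma> \<alpha> \<beta> (Beta_gen l) = \<beta> l"

text \<open>The relator \<open>\<Prod>\<sigma>\<^sub>S \<Prod>[\<alpha>\<^sub>l,\<beta>\<^sub>l]\<close>, where \<open>S\<close> runs through the given list in order.\<close>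

definition surface_relator :: "'a list \<Rightarrow> nat \<Rightarrow> 'a generator word" where
  "surface_relator Ss g =
     map (\<lambda>S. (Sigma_gen S, True)) Ss @
     concat (map (\<lambda>l. commutator_word (Alpha_gen l) (Beta_gen l)) [1..<Suc g])"

text \<open>The simple loop \<open>\<sigma>\<close> bounds the open region \<open>V\<close>, homeomorphic to a disk punctured at \<open>S\<close>, whose
  closure is a disk with boundary \<open>\<sigma>\<close>. Counterclockwise means that, away from \<open>S\<close>, \<open>\<sigma>\<close> can be
  deformed inside this disk into a small circle around \<open>S\<close> that is counterclockwise in a chart.\<close>

definition bounds_punctured_disk ::
    "'a::topological_space chart set \<Rightarrow> (real \<Rightarrow> 'a) \<Rightarrow> 'a set \<Rightarrow> 'a \<Rightarrow> bool" where
  "bounds_punctured_disk A \<sigma> V S \<longleftrightarrow>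
     open V \<and>
     (\<exists>h h'. homeomorphism (cball (0::complex) 1) (closure V) h h' \<and>
        h 0 = S \<and> h ` (ball 0 1 - {0}) = V \<and> h ` sphere 0 1 = path_image \<sigma>) \<and>
     (\<exists>c\<in>A. \<exists>\<rho>>0. S \<in> fst c \<and> cball (snd c S) \<rho> \<subseteq> snd c ` (fst c \<inter> insert S V) \<and>
        homotopic_loops (closure V - {S}) \<sigma> (chart_inv c \<circ> circlepath (snd c S) \<rho>))"

text \<open>The loops in the given list leave their common base point \<open>b\<close> in counterclockwise (cyclic)
  order: in suitable topological coordinates at \<open>b\<close>, compatible with the orientation, they
  start along rays at angles \<open>\<theta>\<^sub>0 < \<theta>\<^sub>1 < \<dots> < \<theta>\<^sub>0 + 2\<pi>\<close>.\<close>

definition leave_counterclockwise ::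
    "'a::topological_space chart set \<Rightarrow> 'a \<Rightarrow> (real \<Rightarrow> 'a) list \<Rightarrow> bool" where
  "leave_counterclockwise A b \<sigma>s \<longleftrightarrow>
     (\<exists>(h :: complex \<Rightarrow> 'a) (\<theta> :: nat \<Rightarrow> real).
        continuous_on (cball 0 1) h \<and> inj_on h (cball 0 1) \<and> h 0 = b \<and>
        (\<exists>c\<in>A. h ` cball 0 1 \<subseteq> fst c \<and>
           winding_number (snd c \<circ> h \<circ> circlepath 0 1) (snd c b) = 1) \<and>
        (\<forall>i j. i < j \<and> j < length \<sigma>s \<longrightarrow> \<theta> i < \<theta> j \<and> \<theta> j < \<theta> i + 2 * pi) \<and>
        (\<forall>i<length \<sigma>s. \<exists>s\<in>{0<..1}. h ` closed_segment 0 (cis (\<theta> i)) = (\<sigma>s ! i) ` {0..s}))"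

end

theory Submission
  imports Defs
begin

text \<open>
  The iterated integrals of \<open>\<omega>\<^sub>1, \<omega>\<^sub>2, \<omega>\<^sub>3\<close> along a path form an upper unitriangular
  \<open>4 \<times> 4\<close> matrix: its entry \<open>(i, j)\<close> is \<open>\<integral> \<omega>\<^sub>i \<circ> \<dots> \<circ> \<omega>\<^sub>j\<^sub>-\<^sub>1\<close>. This matrix is the parallel transport
  of the equation \<open>dM = M \<Omega>\<close>, where \<open>\<Omega>\<close> carries the three forms on its superdiagonal. Holomorphic
  forms on a surface are closed and have vanishing wedge products, so the connection is flat: the
  transport is multiplicative in the path and depends only on its homotopy class away from the
  poles. The defining relation of the fundamental group thus becomes a matrix identity
  \<open>\<Prod> hol \<sigma>\<^sub>S \<cdot> \<Prod> [hol \<alpha>\<^sub>l, hol \<beta>\<^sub>l] = 1\<close>, and the theorem is its entry \<open>(1, 4)\<close>.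

  Three computations turn that entry into the stated sum.

  \<^item> The entries just above the diagonal are additive and vanish on commutators. Hence the relation
    forces the residues of each form to sum to \<open>0\<close>, and this kills all cross terms between the
    factors coming from the poles of \<open>\<omega>\<^sub>1\<close>, of \<open>\<omega>\<^sub>2\<close> and of \<open>\<omega>\<^sub>3\<close> (\<open>e14_surface_relation\<close>).

  \<^item> The entry \<open>(1, 4)\<close> of a commutator is a polynomial in the entries of the two matrices
    (\<open>e14_commutator\<close>). The integrals of \<open>\<omega>\<^sub>3 \<circ> \<omega>\<^sub>2\<close> enter through the shuffle relation
    \<open>\<integral> \<omega>\<^sub>3 \<circ> \<omega>\<^sub>2 = \<integral> \<omega>\<^sub>2 \<integral> \<omega>\<^sub>3 - \<integral> \<omega>\<^sub>2 \<circ> \<omega>\<^sub>3\<close>.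

  \<^item> Let \<open>S\<close> be a pole of \<open>\<omega>\<^sub>k\<close>. On the disk bounded by \<open>\<sigma>\<^sub>S\<close> the other two forms are holomorphic, so
    the connection in which \<open>\<omega>\<^sub>k\<close> is replaced by \<open>0\<close> has a single-valued solution \<open>B\<close> with
    \<open>B P\<^sub>0 = 1\<close>. Writing a solution of the full equation as \<open>M = G B\<close> gives \<open>dG = G \<omega>\<^sub>k N\<close> with
    \<open>N = B E\<^sub>k B\<inverse>\<close> and \<open>E\<^sub>k\<close> the elementary matrix at \<open>(k, k + 1)\<close>. All products \<open>N x N y\<close> vanish, so
    \<open>G\<close> is \<open>1\<close> plus an ordinary integral of the form \<open>\<omega>\<^sub>k N\<close>, whose only singularity is a simple pole
    at \<open>S\<close>. The residue theorem yields \<open>hol \<sigma>\<^sub>S = 1 + Res\<^sub>S \<omega>\<^sub>k \<cdot> N S\<close>, and \<open>B S\<close> is the transport along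
    \<open>\<gamma>\<^sub>S\<close> (\<open>holonomy_around_pole\<close>).

  The loops \<open>\<sigma>\<^sub>S\<close> are only continuous. Transport is therefore defined topologically, by gluing local
  solutions along a map; for piecewise smooth paths its entries are identified with Lebesgue
  integrals over time simplices in \<open>holonomy_entries\<close>.
\<close>

section \<open>Unitriangular matrices\<close>

text \<open>The entries above the diagonal of an upper unitriangular \<open>4 \<times> 4\<close> matrix. With six named
  entries the group operations become polynomial identities.\<close>
datatype uni =
  Uni (e12: complex) (e23: complex) (e34: complex) (e13: complex) (e24: complex) (e14: complex)

instantiation uni :: monoid_mult
begin

definition one_uni :: uni where
  "1 = Uni 0 0 0 0 0 0"

definition times_uni :: "uni \<Rightarrow> uni \<Rightarrow> uni" where
  "M * N = Uni (e12 M + e12 N) (e23 M + e23 N) (e34 M + e34 N)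
     (e13 M + e12 M * e23 N + e13 N) (e24 M + e23 M * e34 N + e24 N)
     (e14 M + e13 M * e34 N + e12 M * e24 N + e14 N)"

instance
  by standard (simp_all add: one_uni_def times_uni_def algebra_simps)

end

definition uinv :: "uni \<Rightarrow> uni" where
  "uinv M = Uni (- e12 M) (- e23 M) (- e34 M) (e12 M * e23 M - e13 M) (e23 M * e34 M - e24 M)
     (e12 M * e24 M + e13 M * e34 M - e12 M * e23 M * e34 M - e14 M)"

lemma uni_entries [simp]:
  "e12 (1::uni) = 0" "e23 (1::uni) = 0" "e34 (1::uni) = 0"
  "e13 (1::uni) = 0" "e24 (1::uni) = 0" "e14 (1::uni) = 0"
  "e12 (M * N) = e12 M + e12 N" "e23 (M * N) = e23 M + e23 N" "e34 (M * N) = e34 M + e34 N"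
  "e13 (M * N) = e13 M + e12 M * e23 N + e13 N"
  "e24 (M * N) = e24 M + e23 M * e34 N + e24 N"
  "e14 (M * N) = e14 M + e13 M * e34 N + e12 M * e24 N + e14 N"
  "e12 (uinv M) = - e12 M" "e23 (uinv M) = - e23 M" "e34 (uinv M) = - e34 M"
  "e13 (uinv M) = e12 M * e23 M - e13 M" "e24 (uinv M) = e23 M * e34 M - e24 M"
  "e14 (uinv M) = e12 M * e24 M + e13 M * e34 M - e12 M * e23 M * e34 M - e14 M"
  by (simp_all add: one_uni_def times_uni_def uinv_def)

lemma uinv_left [simp]: "uinv M * M = 1" and uinv_right [simp]: "M * uinv M = 1"
  by (simp_all add: uni.expand algebra_simps)

lemma uinv_left_assoc [simp]: "uinv M * (M * N) = N"
  and uinv_right_assoc [simp]: "M * (uinv M * N) = N"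
  by (simp_all flip: mult.assoc)

lemma uinv_mult: "uinv (M * N) = uinv N * uinv M"
  by (simp add: uni.expand algebra_simps)

lemma uinv_uinv [simp]: "uinv (uinv M) = M" and uinv_one [simp]: "uinv 1 = 1"
  by (simp_all add: uni.expand algebra_simps)

text \<open>The combination \<open>e34 M * e23 M - e24 M\<close> stands for the integral of the forms in reversed
  order, by the shuffle relation. The right-hand side is arranged to match the contribution of one
  handle of the surface, term by term.\<close>
lemma e14_commutator:
  "e14 (M * (N * (uinv M * uinv N))) =
     e13 M * e34 N - e13 N * e34 M
     + (e34 M * e23 M - e24 M) * e12 N - (e34 N * e23 N - e24 N) * e12 M
     - e12 M * e23 N * e34 M + e12 N * e23 M * e34 N"
  by (simp add: algebra_simps)

text \<open>Matrices with the zero pattern of a loop around a pole of the first form differ from \<open>1\<close> only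
  in the first row, so that their differences from \<open>1\<close> add up under multiplication. The two lemmas
  after this one treat the poles of the second and third form in the same way; the middle one also
  applies to commutators.\<close>
lemma prod_list_first_block:
  assumes "\<And>M. M \<in> set Ms \<Longrightarrow> e23 M = 0 \<and> e34 M = 0 \<and> e24 M = 0"
  shows "e23 (prod_list Ms) = 0 \<and> e34 (prod_list Ms) = 0 \<and> e24 (prod_list Ms) = 0 \<and>
    e12 (prod_list Ms) = sum_list (map e12 Ms) \<and> e14 (prod_list Ms) = sum_list (map e14 Ms)"
  using assms by (induction Ms) auto

lemma prod_list_middle_block:
  assumes "\<And>M. M \<in> set Ms \<Longrightarrow> e12 M = 0 \<and> e34 M = 0"
  shows "e12 (prod_list Ms) = 0 \<and> e34 (prod_list Ms) = 0 \<and>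
    e23 (prod_list Ms) = sum_list (map e23 Ms) \<and> e14 (prod_list Ms) = sum_list (map e14 Ms)"
  using assms by (induction Ms) auto

lemma prod_list_last_block:
  assumes "\<And>M. M \<in> set Ms \<Longrightarrow> e12 M = 0 \<and> e23 M = 0 \<and> e13 M = 0"
  shows "e12 (prod_list Ms) = 0 \<and> e23 (prod_list Ms) = 0 \<and> e13 (prod_list Ms) = 0 \<and>
    e34 (prod_list Ms) = sum_list (map e34 Ms) \<and> e14 (prod_list Ms) = sum_list (map e14 Ms)"
  using assms by (induction Ms) auto

text \<open>In the entry \<open>(1, 4)\<close> of the product, every cross term has a factor \<open>e12\<close> of the first block,
  \<open>e34\<close> of the third block, or an entry that vanishes by the zero patterns. The first two vanish as
  well, because they are the entries \<open>(1, 2)\<close> and \<open>(3, 4)\<close> of the whole product: this is the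
  residue theorem for the outer two forms.\<close>
lemma e14_surface_relation:
  assumes rel: "prod_list Ps * prod_list Qs * prod_list Rs * prod_list Ks = 1"
    and Ps: "\<And>M. M \<in> set Ps \<Longrightarrow> e23 M = 0 \<and> e34 M = 0 \<and> e24 M = 0"
    and Qs: "\<And>M. M \<in> set Qs \<Longrightarrow> e12 M = 0 \<and> e34 M = 0"
    and Rs: "\<And>M. M \<in> set Rs \<Longrightarrow> e12 M = 0 \<and> e23 M = 0 \<and> e13 M = 0"
    and Ks: "\<And>M. M \<in> set Ks \<Longrightarrow> e12 M = 0 \<and> e23 M = 0 \<and> e34 M = 0"
  shows "sum_list (map e14 Ps) + sum_list (map e14 Qs) + sum_list (map e14 Rs)
    + sum_list (map e14 Ks) = 0"
proof -
  have K23: "e23 (prod_list Ks) = 0"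
    using Ks by (induction Ks) auto
  note zero = prod_list_first_block[OF Ps] prod_list_middle_block[OF Qs]
    prod_list_last_block[OF Rs] prod_list_middle_block[of Ks] K23 Ks
  have "e12 (prod_list Ps) = 0" "e34 (prod_list Rs) = 0"
    using arg_cong[OF rel, of e12] arg_cong[OF rel, of e34] zero by auto
  then show ?thesis
    using arg_cong[OF rel, of e14] zero by auto
qed

section \<open>Differentials of functions on a Riemann surface\<close>

lemma has_vector_derivative_transform_local:
  assumes "(f has_vector_derivative v) (at t within T)" "open U" "t \<in> U" "t \<in> T"
    and "\<And>s. s \<in> T \<Longrightarrow> s \<in> U \<Longrightarrow> f s = g s"
  shows "(g has_vector_derivative v) (at t within T)"
proof -
  have "eventually (\<lambda>s. s \<in> T \<longrightarrow> f s = g s) (nhds t)"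
    using eventually_nhds_in_open[OF assms(2,3)] by eventually_elim (use assms in auto)
  then show ?thesis
    using has_vector_derivative_cong_ev assms by blast
qed

text \<open>\<open>\<eta>\<close> is a cotangent vector at \<open>x\<close>, given by its coefficients in all charts around \<open>x\<close>. With all
  charts quantified here, the calculus rules below need no transformation law.\<close>
definition has_differential ::
    "'a chart set \<Rightarrow> ('a \<Rightarrow> complex) \<Rightarrow> 'a \<Rightarrow> ('a chart \<Rightarrow> complex) \<Rightarrow> bool" where
  "has_differential A f x \<eta> \<longleftrightarrow>
     (\<forall>c\<in>A. x \<in> fst c \<longrightarrow> ((\<lambda>z. f (chart_inv c z)) has_field_derivative \<eta> c) (at (snd c x)))"

abbreviation form_at :: "'a form \<Rightarrow> 'a \<Rightarrow> 'a chart \<Rightarrow> complex" where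
  "form_at \<omega> x c \<equiv> \<omega> c (snd c x)"

lemma has_differential_const: "has_differential A (\<lambda>_. k) x (\<lambda>_. 0)"
  by (simp add: has_differential_def)

locale surface =
  fixes A :: "'a::t2_space chart set"
  assumes riemann: "riemann_surface A"
begin

lemma is_chart: "c \<in> A \<Longrightarrow> is_chart c"
  using riemann by (simp add: riemann_surface_def)

lemma ex_chart: "\<exists>c\<in>A. x \<in> fst c"
  using riemann by (auto simp: riemann_surface_def)

lemma chart_at: "chart_at A x \<in> A" "x \<in> fst (chart_at A x)"
  unfolding chart_at_def using someI_ex[of "\<lambda>c. c \<in> A \<and> x \<in> fst c"] ex_chart[of x] by blast+

lemma chart_homeomorphism:
  assumes "c \<in> A"
  shows "homeomorphism (fst c) (snd c ` fst c) (snd c) (chart_inv c)"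
proof -
  obtain \<psi> where \<psi>: "homeomorphism (fst c) (snd c ` fst c) (snd c) \<psi>"
    using is_chart[OF assms] by (auto simp: is_chart_def)
  then have "inj_on (snd c) (fst c)"
    using homeomorphism_apply1 by (intro inj_on_inverseI[of _ \<psi>]) blast
  then have "chart_inv c z = \<psi> z" if "z \<in> snd c ` fst c" for z
    using that \<psi> by (auto simp: chart_inv_def homeomorphism_apply1)
  then show ?thesis
    using homeomorphism_cong[OF \<psi>] by blast
qed

lemma open_chart_domain: "c \<in> A \<Longrightarrow> open (fst c)"
  and open_chart_image: "c \<in> A \<Longrightarrow> open (snd c ` fst c)"
  using is_chart by (auto simp: is_chart_def)

lemma chart_inv_coord [simp]: "c \<in> A \<Longrightarrow> x \<in> fst c \<Longrightarrow> chart_inv c (snd c x) = x"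
  using chart_homeomorphism homeomorphism_apply1 by blast

lemma coord_chart_inv [simp]: "c \<in> A \<Longrightarrow> z \<in> snd c ` fst c \<Longrightarrow> snd c (chart_inv c z) = z"
  using chart_homeomorphism homeomorphism_apply2 by blast

lemma chart_inv_in: "c \<in> A \<Longrightarrow> z \<in> snd c ` fst c \<Longrightarrow> chart_inv c z \<in> fst c"
  by auto

lemma continuous_on_coord: "c \<in> A \<Longrightarrow> continuous_on (fst c) (snd c)"
  and continuous_on_chart_inv: "c \<in> A \<Longrightarrow> continuous_on (snd c ` fst c) (chart_inv c)"
  using chart_homeomorphism by (auto simp: homeomorphism_def)

lemma open_coord_image:
  assumes "c \<in> A" "open U" "U \<subseteq> fst c"
  shows "open (snd c ` U)"
proof -
  have "openin (top_of_set (snd c ` fst c)) (snd c ` U)"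
    using homeomorphism_imp_open_map[OF chart_homeomorphism[OF assms(1)]] assms open_chart_domain
    by (auto simp: openin_open_eq)
  then show ?thesis
    using open_chart_image[OF assms(1)] openin_open_eq by blast
qed

lemma open_chart_inv_image:
  assumes "c \<in> A" "open W" "W \<subseteq> snd c ` fst c"
  shows "open (chart_inv c ` W)"
proof -
  have "openin (top_of_set (fst c)) (chart_inv c ` W)"
    using homeomorphism_imp_open_map[OF homeomorphism_symD[OF chart_homeomorphism[OF assms(1)]]]
      assms open_chart_image
    by (auto simp: openin_open_eq)
  then show ?thesis
    using open_chart_domain[OF assms(1)] openin_open_eq by blast
qed

lemma ex_coordinate_ball:
  assumes "c \<in> A" "x \<in> fst c" "open N" "x \<in> N"
  obtains r where "r > 0" "ball (snd c x) r \<subseteq> snd c ` (N \<inter> fst c)"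
    "open (chart_inv c ` ball (snd c x) r)" "x \<in> chart_inv c ` ball (snd c x) r"
    "chart_inv c ` ball (snd c x) r \<subseteq> N \<inter> fst c"
proof -
  have "open (snd c ` (N \<inter> fst c))"
    using assms by (intro open_coord_image open_Int open_chart_domain) auto
  then obtain r where r: "r > 0" "ball (snd c x) r \<subseteq> snd c ` (N \<inter> fst c)"
    using assms by (metis Int_iff image_eqI open_contains_ball)
  then have "open (chart_inv c ` ball (snd c x) r)"
    using assms by (intro open_chart_inv_image) auto
  moreover have "x \<in> chart_inv c ` ball (snd c x) r"
    using r assms by (intro image_eqI[of _ _ "snd c x"]) auto
  moreover have "chart_inv c ` ball (snd c x) r \<subseteq> N \<inter> fst c"
    using r(2) assms by force
  ultimately show thesis
    using that r by blast
qed

lemma transition_has_derivative: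
  assumes "c \<in> A" "d \<in> A" "x \<in> fst c" "x \<in> fst d"
  shows "(transition d c has_field_derivative deriv (transition d c) (snd d x)) (at (snd d x))"
proof -
  have "transition d c holomorphic_on snd d ` (fst d \<inter> fst c)"
    using riemann assms by (auto simp: riemann_surface_def)
  moreover have "open (snd d ` (fst d \<inter> fst c))"
    using assms by (intro open_coord_image open_Int open_chart_domain) auto
  ultimately show ?thesis
    using assms by (auto intro: holomorphic_derivI)
qed

lemma transition_coord [simp]: "d \<in> A \<Longrightarrow> x \<in> fst d \<Longrightarrow> transition d c (snd d x) = snd c x"
  by (simp add: transition_def)

text \<open>The chain rule for the transition map; together with the transformation law of forms it allows
  differentials to be checked in a single chart.\<close>
lemma differential_change_chart:
  assumes "c \<in> A" "d \<in> A" "x \<in> fst c" "x \<in> fst d"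
    and "((\<lambda>z. f (chart_inv c z)) has_field_derivative D) (at (snd c x))"
  shows "((\<lambda>z. f (chart_inv d z)) has_field_derivative D * deriv (transition d c) (snd d x))
    (at (snd d x))"
proof (rule has_field_derivative_transform_within_open)
  show "((\<lambda>z. f (chart_inv c (transition d c z)))
      has_field_derivative D * deriv (transition d c) (snd d x)) (at (snd d x))"
    using DERIV_chain2[OF _ transition_has_derivative[OF assms(1-4)],
        of "\<lambda>z. f (chart_inv c z)" D] assms by simp
  show "open (snd d ` (fst d \<inter> fst c))"
    using assms by (intro open_coord_image open_Int open_chart_domain) auto
qed (use assms in \<open>auto simp: transition_def\<close>)

lemma has_differential_form_multiple:
  assumes "meromorphic_form A \<omega>" "c \<in> A" "x \<in> fst c"
    and "((\<lambda>z. f (chart_inv c z)) has_field_derivative v * form_at \<omega> x c) (at (snd c x))"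
  shows "has_differential A f x (\<lambda>d. v * form_at \<omega> x d)"
  unfolding has_differential_def
proof (intro ballI impI)
  fix d assume d: "d \<in> A" "x \<in> fst d"
  have "snd d x \<in> snd d ` (fst d \<inter> fst c)"
    using d assms by auto
  from assms(1)[unfolded meromorphic_form_def, THEN conjunct2, rule_format, OF d(1) assms(2) this]
  have "form_at \<omega> x d = form_at \<omega> x c * deriv (transition d c) (snd d x)"
    using d by simp
  then show "((\<lambda>z. f (chart_inv d z)) has_field_derivative v * form_at \<omega> x d) (at (snd d x))"
    using differential_change_chart[OF assms(2) d(1) assms(3) d(2) assms(4)] by (simp add: mult.assoc)
qed

lemma has_differential_add:
  "has_differential A f x \<eta> \<Longrightarrow> has_differential A g x \<theta> \<Longrightarrow>
     has_differential A (\<lambda>y. f y + g y) x (\<lambda>c. \<eta> c + \<theta> c)"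
  by (auto simp: has_differential_def intro: derivative_intros)

lemma has_differential_minus:
  "has_differential A f x \<eta> \<Longrightarrow> has_differential A (\<lambda>y. - f y) x (\<lambda>c. - \<eta> c)"
  by (auto simp: has_differential_def intro: derivative_intros)

lemma has_differential_diff:
  "has_differential A f x \<eta> \<Longrightarrow> has_differential A g x \<theta> \<Longrightarrow>
     has_differential A (\<lambda>y. f y - g y) x (\<lambda>c. \<eta> c - \<theta> c)"
  by (auto simp: has_differential_def intro: derivative_intros)

lemma has_differential_mult:
  "has_differential A f x \<eta> \<Longrightarrow> has_differential A g x \<theta> \<Longrightarrow>
     has_differential A (\<lambda>y. f y * g y) x (\<lambda>c. \<eta> c * g x + f x * \<theta> c)"
  unfolding has_differential_def
proof (intro ballI impI)
  fix c assume *: "\<forall>c\<in>A. x \<in> fst c \<longrightarrow> ((\<lambda>z. f (chart_inv c z)) has_field_derivative \<eta> c) (at (snd c x))"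
    "\<forall>c\<in>A. x \<in> fst c \<longrightarrow> ((\<lambda>z. g (chart_inv c z)) has_field_derivative \<theta> c) (at (snd c x))"
    "c \<in> A" "x \<in> fst c"
  then show "((\<lambda>z. f (chart_inv c z) * g (chart_inv c z)) has_field_derivative
      \<eta> c * g x + f x * \<theta> c) (at (snd c x))"
    using DERIV_mult'[of "\<lambda>z. f (chart_inv c z)" "\<eta> c" "snd c x" UNIV "\<lambda>z. g (chart_inv c z)" "\<theta> c"]
    by (simp add: add.commute)
qed

lemmas has_differential_intros =
  has_differential_add has_differential_minus has_differential_diff has_differential_mult
  has_differential_const

lemma has_differential_eq:
  assumes "has_differential A f x \<eta>" "\<And>c. \<eta> c = \<theta> c"
  shows "has_differential A f x \<theta>"
proof -
  have "\<eta> = \<theta>"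
    using assms(2) by (rule ext)
  with assms(1) show ?thesis
    by simp
qed

text \<open>This is the source of all uniqueness statements below: solutions of the connection will be
  compared by showing that their quotient has differential \<open>0\<close>.\<close>
lemma zero_differential_locally_constant:
  assumes "open N" "x \<in> N" "\<And>y. y \<in> N \<Longrightarrow> has_differential A f y (\<lambda>_. 0)"
  obtains N' where "open N'" "x \<in> N'" "N' \<subseteq> N" "\<And>y. y \<in> N' \<Longrightarrow> f y = f x"
proof -
  obtain c where c: "c \<in> A" "x \<in> fst c"
    using ex_chart by blast
  from ex_coordinate_ball[OF c assms(1,2)] obtain r where
    r: "r > 0" "ball (snd c x) r \<subseteq> snd c ` (N \<inter> fst c)"
    "open (chart_inv c ` ball (snd c x) r)" "x \<in> chart_inv c ` ball (snd c x) r"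
    "chart_inv c ` ball (snd c x) r \<subseteq> N \<inter> fst c"
    by blast
  have "((\<lambda>z. f (chart_inv c z)) has_field_derivative 0) (at z within ball (snd c x) r)"
    if "z \<in> ball (snd c x) r" for z
  proof -
    obtain y where y: "y \<in> N" "y \<in> fst c" "z = snd c y"
      using \<open>z \<in> _\<close> r(2) by auto
    then show ?thesis
      using assms(3)[OF y(1)] c by (auto simp: has_differential_def intro: has_field_derivative_at_within)
  qed
  then obtain k where "\<And>z. z \<in> ball (snd c x) r \<Longrightarrow> f (chart_inv c z) = k"
    using has_field_derivative_zero_constant[OF convex_ball] by metis
  then have "f y = f x" if "y \<in> chart_inv c ` ball (snd c x) r" for y
    using that r(4) by auto
  with r show thesis
    using that[of "chart_inv c ` ball (snd c x) r"] by blast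
qed

lemma analytic_off_poles:
  assumes "meromorphic_form A \<omega>" "x \<notin> form_poles A \<omega>" "c \<in> A" "x \<in> fst c"
  shows "\<omega> c analytic_on {snd c x}"
proof -
  have "\<not> is_pole (\<omega> c) (snd c x)"
    using assms by (auto simp: form_poles_def)
  moreover have "\<omega> c nicely_meromorphic_on snd c ` fst c"
    using assms(1,3) unfolding meromorphic_form_def by blast
  ultimately show ?thesis
    using nicely_meromorphic_on_imp_analytic_at assms(4) by blast
qed

lemma has_differential_along:
  assumes "has_differential A f (\<gamma> t) \<eta>" "c \<in> A" "\<gamma> t \<in> fst c" "t \<in> T" "continuous_on T \<gamma>"
    and "((snd c \<circ> \<gamma>) has_vector_derivative v) (at t within T)"
  shows "((\<lambda>t. f (\<gamma> t)) has_vector_derivative \<eta> c * v) (at t within T)"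
proof -
  have "((\<lambda>z. f (chart_inv c z)) has_field_derivative \<eta> c) (at ((snd c \<circ> \<gamma>) t) within (snd c \<circ> \<gamma>) ` T)"
    using assms by (auto simp: has_differential_def intro: has_field_derivative_at_within)
  from field_vector_diff_chain_within[OF assms(6) this]
  have D: "((\<lambda>t. f (chart_inv c (snd c (\<gamma> t)))) has_vector_derivative \<eta> c * v) (at t within T)"
    by (simp add: o_def mult.commute)
  obtain U where U: "open U" "U \<inter> T = \<gamma> -` fst c \<inter> T"
    using assms(2,5) open_chart_domain by (metis continuous_on_open_invariant)
  have "t \<in> U"
    using U assms by auto
  show ?thesis
  proof (rule has_vector_derivative_transform_local[OF D U(1) \<open>t \<in> U\<close> assms(4)])
    fix s assume "s \<in> T" "s \<in> U"
    then have "\<gamma> s \<in> fst c"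
      using U(2) by blast
    then show "f (chart_inv c (snd c (\<gamma> s))) = f (\<gamma> s)"
      using assms(2) by simp
  qed
qed

end

section \<open>A flat connection built from three forms\<close>

text \<open>The forms are indexed by \<open>1, 2, 3\<close>, so that replacing one of them by \<open>0\<close> is a function
  update.\<close>
locale flat_connection = surface A
  for A :: "'a::t2_space chart set" +
  fixes w :: "nat \<Rightarrow> 'a form"
  assumes meromorphic: "i \<in> {1,2,3} \<Longrightarrow> meromorphic_form A (w i)"
begin

text \<open>The equation \<open>dM = M \<Omega>\<close> on \<open>N\<close>, entry by entry.\<close>
definition solves :: "'a set \<Rightarrow> ('a \<Rightarrow> uni) \<Rightarrow> bool" where
  "solves N M \<longleftrightarrow> open N \<and> (\<forall>x\<in>N.
     has_differential A (\<lambda>y. e12 (M y)) x (\<lambda>c. form_at (w 1) x c) \<and>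
     has_differential A (\<lambda>y. e23 (M y)) x (\<lambda>c. form_at (w 2) x c) \<and>
     has_differential A (\<lambda>y. e34 (M y)) x (\<lambda>c. form_at (w 3) x c) \<and>
     has_differential A (\<lambda>y. e13 (M y)) x (\<lambda>c. e12 (M x) * form_at (w 2) x c) \<and>
     has_differential A (\<lambda>y. e24 (M y)) x (\<lambda>c. e23 (M x) * form_at (w 3) x c) \<and>
     has_differential A (\<lambda>y. e14 (M y)) x (\<lambda>c. e13 (M x) * form_at (w 3) x c))"

definition regular :: "'a set" where
  "regular = {x. \<forall>i\<in>{1,2,3}. x \<notin> form_poles A (w i)}"

lemma solves_open: "solves N M \<Longrightarrow> open N"
  by (simp add: solves_def)

lemma solves_D:
  assumes "solves N M" "x \<in> N"
  shows
    "has_differential A (\<lambda>y. e12 (M y)) x (\<lambda>c. form_at (w 1) x c)"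
    "has_differential A (\<lambda>y. e23 (M y)) x (\<lambda>c. form_at (w 2) x c)"
    "has_differential A (\<lambda>y. e34 (M y)) x (\<lambda>c. form_at (w 3) x c)"
    "has_differential A (\<lambda>y. e13 (M y)) x (\<lambda>c. e12 (M x) * form_at (w 2) x c)"
    "has_differential A (\<lambda>y. e24 (M y)) x (\<lambda>c. e23 (M x) * form_at (w 3) x c)"
    "has_differential A (\<lambda>y. e14 (M y)) x (\<lambda>c. e13 (M x) * form_at (w 3) x c)"
  using assms by (simp_all add: solves_def)

lemma solves_mult_left:
  assumes "solves N M"
  shows "solves N (\<lambda>x. C * M x)"
  unfolding solves_def
  by (intro conjI ballI solves_open[OF assms];
      simp only: uni_entries,
      (rule has_differential_eq, (rule has_differential_intros solves_D[OF assms] | assumption)+,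
       simp add: algebra_simps)[1])

lemma solves_mono: "solves N M \<Longrightarrow> open N' \<Longrightarrow> N' \<subseteq> N \<Longrightarrow> solves N' M"
  by (auto simp: solves_def)

text \<open>All entries of the quotient of two solutions have differential \<open>0\<close>. The neighbourhood has to
  be shrunk because \<open>N \<inter> N'\<close> need not be connected.\<close>
lemma solves_unique:
  assumes M: "solves N M" and M': "solves N' M'" and x: "x \<in> N" "x \<in> N'"
  obtains U C where "open U" "x \<in> U" "U \<subseteq> N \<inter> N'" "\<And>y. y \<in> U \<Longrightarrow> M' y = C * M y"
proof -
  let ?Q = "\<lambda>y. M' y * uinv (M y)"
  have zero: "has_differential A (\<lambda>y. e (?Q y)) y (\<lambda>_. 0)"
    if "y \<in> N \<inter> N'" "e \<in> {e12, e23, e34, e13, e24, e14}" for e y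
  proof -
    have y: "y \<in> N" "y \<in> N'"
      using that by auto
    note D = solves_D[OF M y(1)] solves_D[OF M' y(2)]
    have "e = e12 \<or> e = e23 \<or> e = e34 \<or> e = e13 \<or> e = e24 \<or> e = e14"
      using that by auto
    then show ?thesis
      by (elim disjE; hypsubst; simp only: uni_entries)
        ((rule has_differential_eq, (rule has_differential_intros D)+, simp add: algebra_simps)[1])+
  qed
  let ?E = "{e12, e23, e34, e13, e24, e14}"
  have "\<exists>U. open U \<and> x \<in> U \<and> U \<subseteq> N \<inter> N' \<and> (\<forall>y\<in>U. e (?Q y) = e (?Q x))" if e: "e \<in> ?E" for e
  proof -
    have "open (N \<inter> N')" "x \<in> N \<inter> N'"
      using x solves_open[OF M] solves_open[OF M'] by auto
    then obtain U where "open U" "x \<in> U" "U \<subseteq> N \<inter> N'" "\<And>y. y \<in> U \<Longrightarrow> e (?Q y) = e (?Q x)"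
      using zero_differential_locally_constant[OF _ _ zero[OF _ e]] by blast
    then show ?thesis
      by blast
  qed
  then have "\<forall>e\<in>?E. \<exists>U. open U \<and> x \<in> U \<and> U \<subseteq> N \<inter> N' \<and> (\<forall>y\<in>U. e (?Q y) = e (?Q x))"
    by (rule ballI)
  from bchoice[OF this] obtain U where
    U: "\<forall>e\<in>?E. open (U e) \<and> x \<in> U e \<and> U e \<subseteq> N \<inter> N' \<and> (\<forall>y\<in>U e. e (?Q y) = e (?Q x))"
    by (rule exE)
  have U': "open (U e)" "x \<in> U e" "U e \<subseteq> N \<inter> N'" "y \<in> U e \<Longrightarrow> e (?Q y) = e (?Q x)"
    if "e \<in> ?E" for e y
    using bspec[OF U that] by blast+
  define V where "V = (\<Inter>e\<in>?E. U e)"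
  have "open V"
    unfolding V_def by (rule open_INT) (simp, rule ballI, rule U'(1))
  moreover have "x \<in> V"
    unfolding V_def by (rule INT_I, rule U'(2))
  moreover have "V \<subseteq> N \<inter> N'"
    using U'(3)[of e12] unfolding V_def by blast
  moreover have "M' y = ?Q x * M y" if "y \<in> V" for y
  proof -
    have eq: "e (?Q y) = e (?Q x)" if "e \<in> ?E" for e
      using U'(4)[OF that INT_D[OF \<open>y \<in> V\<close>[unfolded V_def] that]] .
    have "?Q y = ?Q x"
      using eq[of e12] eq[of e23] eq[of e34] eq[of e13] eq[of e24] eq[of e14]
      by (intro uni.expand) (simp_all del: uni_entries)
    then show ?thesis
      by (metis mult.assoc mult_1_right uinv_left)
  qed
  ultimately show thesis
    using that by blast
qed

lemma analytic_at_regular: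
  assumes "x \<in> regular" "i \<in> {1,2,3}" "c \<in> A" "x \<in> fst c"
  shows "w i c analytic_on {snd c x}"
  using analytic_off_poles[OF meromorphic[OF assms(2)] _ assms(3,4)] assms(1,2)
  unfolding regular_def by blast

text \<open>In a coordinate ball every holomorphic function has a primitive, so the entries can be found
  one after the other, starting next to the diagonal.\<close>
lemma ex_solves:
  assumes "x \<in> regular"
  obtains N M where "solves N M" "x \<in> N"
proof -
  obtain c where c: "c \<in> A" "x \<in> fst c"
    using ex_chart by blast
  have "\<exists>r>0. w i c holomorphic_on ball (snd c x) r" if "i \<in> {1,2,3}" for i
    using analytic_at_regular[OF assms that c] by (simp add: analytic_on_def)
  then obtain r' where r': "r' i > 0" "w i c holomorphic_on ball (snd c x) (r' i)"
    if "i \<in> {1,2,3}" for i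
    by metis
  obtain r0 where r0: "r0 > 0" "ball (snd c x) r0 \<subseteq> snd c ` (UNIV \<inter> fst c)"
    by (rule ex_coordinate_ball[OF c open_UNIV UNIV_I])
  define r where "r = min (min (r' 1) (r' 2)) (min (r' 3) r0)"
  define B where "B = ball (snd c x) r"
  have "r > 0"
    unfolding r_def using r0(1) r'(1)[of 1] r'(1)[of 2] r'(1)[of 3] by simp
  moreover have "r \<le> r0" "r \<le> r' 1" "r \<le> r' 2" "r \<le> r' 3"
    unfolding r_def by linarith+
  ultimately have r: "r > 0" "r \<le> r0" "\<And>i. i \<in> {1,2,3} \<Longrightarrow> r \<le> r' i"
    by blast+
  have hol: "w i c holomorphic_on B" if "i \<in> {1,2,3}" for i
    using holomorphic_on_subset[OF r'(2)[OF that] subset_ball[OF r(3)[OF that]]] by (simp add: B_def)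
  have B: "open B" "convex B" "B \<subseteq> snd c ` fst c" "snd c x \<in> B"
    using r0 r subset_ball[OF r(2), of "snd c x"] by (auto simp: B_def)
  have prim: "\<exists>F. (\<forall>z\<in>B. (F has_field_derivative f z) (at z))" if "f holomorphic_on B" for f
    using holomorphic_convex_primitive'[OF B(2,1) that] B(1)
    by (metis at_within_open)
  have hol': "F holomorphic_on B" if "\<And>z. z \<in> B \<Longrightarrow> (F has_field_derivative f z) (at z)"
    for F f :: "complex \<Rightarrow> complex"
    using B(1) that by (auto simp: holomorphic_on_open)
  obtain F1 where F1: "\<And>z. z \<in> B \<Longrightarrow> (F1 has_field_derivative w 1 c z) (at z)"
    using prim[OF hol[of 1]] by auto
  obtain F2 where F2: "\<And>z. z \<in> B \<Longrightarrow> (F2 has_field_derivative w 2 c z) (at z)"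
    using prim[OF hol[of 2]] by auto
  obtain F3 where F3: "\<And>z. z \<in> B \<Longrightarrow> (F3 has_field_derivative w 3 c z) (at z)"
    using prim[OF hol[of 3]] by auto
  obtain F12 where F12: "\<And>z. z \<in> B \<Longrightarrow> (F12 has_field_derivative F1 z * w 2 c z) (at z)"
    using prim[OF holomorphic_on_mult[OF hol'[OF F1] hol[of 2]]] by auto
  obtain F23 where F23: "\<And>z. z \<in> B \<Longrightarrow> (F23 has_field_derivative F2 z * w 3 c z) (at z)"
    using prim[OF holomorphic_on_mult[OF hol'[OF F2] hol[of 3]]] by auto
  obtain F123 where F123: "\<And>z. z \<in> B \<Longrightarrow> (F123 has_field_derivative F12 z * w 3 c z) (at z)"
    using prim[OF holomorphic_on_mult[OF hol'[OF F12] hol[of 3]]] by auto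
  define N where "N = chart_inv c ` B"
  have N: "open N" "x \<in> N"
    using B c open_chart_inv_image[of c B] by (auto simp: N_def intro!: image_eqI[of _ _ "snd c x"])
  have NB: "y \<in> fst c" "snd c y \<in> B" if "y \<in> N" for y
    using that B(3) c by (auto simp: N_def)
  have diff: "has_differential A (\<lambda>y. F (snd c y)) y (\<lambda>d. v (snd c y) * form_at (w i) y d)"
    if "y \<in> N" "i \<in> {1,2,3}" "\<And>z. z \<in> B \<Longrightarrow> (F has_field_derivative v z * w i c z) (at z)"
    for F v y i
  proof (rule has_differential_form_multiple[OF meromorphic[OF that(2)] c(1) NB(1)[OF that(1)]])
    show "((\<lambda>z. F (snd c (chart_inv c z))) has_field_derivative
        v (snd c y) * form_at (w i) y c) (at (snd c y))"
      using has_field_derivative_transform_within_open[OF that(3)[OF NB(2)[OF that(1)]] B(1)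
        NB(2)[OF that(1)], of "\<lambda>z. F (snd c (chart_inv c z))"] B(3) c by force
  qed
  note diff1 = diff[where v = "\<lambda>_. 1", simplified]
  define M where "M y = Uni (F1 (snd c y)) (F2 (snd c y)) (F3 (snd c y))
    (F12 (snd c y)) (F23 (snd c y)) (F123 (snd c y))" for y
  have "solves N M"
    unfolding solves_def M_def uni.sel
    using N(1) diff1[OF _ _ F1] diff1[OF _ _ F2] diff1[OF _ _ F3]
      diff[OF _ _ F12] diff[OF _ _ F23] diff[OF _ _ F123] by simp
  with N(2) show thesis
    using that by blast
qed

end

section \<open>Parallel transport along continuous maps\<close>

context flat_connection
begin

text \<open>A lift of \<open>u\<close> to the local system of solutions: near each parameter, \<open>h\<close> is a solution composed
  with \<open>u\<close>. This needs no differentiability of \<open>u\<close>. The parameter space is kept general because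
  intervals, squares, disks in the plane and subsets of the surface itself all occur below.\<close>
definition transports :: "'t::topological_space set \<Rightarrow> ('t \<Rightarrow> 'a) \<Rightarrow> ('t \<Rightarrow> uni) \<Rightarrow> bool" where
  "transports T u h \<longleftrightarrow> (\<forall>t\<in>T. \<exists>U N M. open U \<and> t \<in> U \<and> solves N M \<and> u ` (T \<inter> U) \<subseteq> N \<and>
     (\<forall>s\<in>T \<inter> U. h s = M (u s)))"

lemma transportsE:
  assumes "transports T u h" "t \<in> T"
  obtains U N M where "open U" "t \<in> U" "solves N M" "\<And>s. s \<in> T \<Longrightarrow> s \<in> U \<Longrightarrow> u s \<in> N"
    "\<And>s. s \<in> T \<Longrightarrow> s \<in> U \<Longrightarrow> h s = M (u s)"
proof -
  obtain U N M where *: "open U" "t \<in> U" "solves N M" "u ` (T \<inter> U) \<subseteq> N" "\<forall>s\<in>T \<inter> U. h s = M (u s)"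
    using assms unfolding transports_def by meson
  show thesis
    by (rule that[OF *(1-3)]) (use *(4,5) in blast)+
qed

lemma transportsI:
  assumes "\<And>t. t \<in> T \<Longrightarrow> \<exists>U N M. open U \<and> t \<in> U \<and> solves N M \<and>
    (\<forall>s\<in>T \<inter> U. u s \<in> N \<and> h s = M (u s))"
  shows "transports T u h"
  unfolding transports_def
proof
  fix t assume "t \<in> T"
  then obtain U N M where *: "open U" "t \<in> U" "solves N M" "\<forall>s\<in>T \<inter> U. u s \<in> N \<and> h s = M (u s)"
    using assms by meson
  then show "\<exists>U N M. open U \<and> t \<in> U \<and> solves N M \<and> u ` (T \<inter> U) \<subseteq> N \<and> (\<forall>s\<in>T \<inter> U. h s = M (u s))"
    by (intro exI[of _ U] exI[of _ N] exI[of _ M]) blast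
qed

lemma transports_compose:
  assumes "transports T u h" "continuous_on T' f" "f ` T' \<subseteq> T"
    and "\<And>t. t \<in> T' \<Longrightarrow> u' t = u (f t)" "\<And>t. t \<in> T' \<Longrightarrow> h' t = h (f t)"
  shows "transports T' u' h'"
proof (rule transportsI)
  fix t assume t: "t \<in> T'"
  then have "f t \<in> T"
    using assms(3) by blast
  then obtain U N M where *: "open U" "f t \<in> U" "solves N M" "\<And>s. s \<in> T \<Longrightarrow> s \<in> U \<Longrightarrow> u s \<in> N"
    "\<And>s. s \<in> T \<Longrightarrow> s \<in> U \<Longrightarrow> h s = M (u s)"
    by (rule transportsE[OF assms(1)]) blast
  obtain U' where U': "open U'" "U' \<inter> T' = f -` U \<inter> T'"
    using assms(2) *(1) by (metis continuous_on_open_invariant)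
  have "t \<in> U'"
    using U'(2) t *(2) by blast
  moreover have "u' s \<in> N \<and> h' s = M (u' s)" if "s \<in> T' \<inter> U'" for s
  proof -
    have "f s \<in> U" "f s \<in> T" "s \<in> T'"
      using that U'(2) assms(3) by blast+
    then show ?thesis
      using *(4,5) assms(4,5) by simp
  qed
  ultimately show "\<exists>U N M. open U \<and> t \<in> U \<and> solves N M \<and> (\<forall>s\<in>T' \<inter> U. u' s \<in> N \<and> h' s = M (u' s))"
    using U'(1) *(3) by blast
qed

lemma transports_mult_left:
  assumes "transports T u h"
  shows "transports T u (\<lambda>t. C * h t)"
proof (rule transportsI)
  fix t assume t: "t \<in> T"
  obtain U N M where *: "open U" "t \<in> U" "solves N M" "\<And>s. s \<in> T \<Longrightarrow> s \<in> U \<Longrightarrow> u s \<in> N"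
    "\<And>s. s \<in> T \<Longrightarrow> s \<in> U \<Longrightarrow> h s = M (u s)"
    by (rule transportsE[OF assms t]) blast
  from *(3) have "solves N (\<lambda>x. C * M x)"
    by (rule solves_mult_left)
  then show "\<exists>U N M. open U \<and> t \<in> U \<and> solves N M \<and> (\<forall>s\<in>T \<inter> U. u s \<in> N \<and> C * h s = M (u s))"
    using * by (intro exI[of _ U] exI[of _ N] exI[of _ "\<lambda>x. C * M x"]) simp
qed

lemma transports_locally_unique:
  assumes h: "transports T u h" and h': "transports T' u' h'"
    and u: "continuous_on T u" and u': "continuous_on T' u'" and t: "t \<in> T" "t' \<in> T'" "u t = u' t'"
  obtains U U' N M C where "open U" "t \<in> U" "open U'" "t' \<in> U'" "solves N M"
    "\<And>s. s \<in> T \<Longrightarrow> s \<in> U \<Longrightarrow> u s \<in> N \<and> h s = M (u s)"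
    "\<And>s. s \<in> T' \<Longrightarrow> s \<in> U' \<Longrightarrow> u' s \<in> N \<and> h' s = C * M (u' s)"
proof -
  obtain U N M where 1: "open U" "t \<in> U" "solves N M" "\<And>s. s \<in> T \<Longrightarrow> s \<in> U \<Longrightarrow> u s \<in> N"
    "\<And>s. s \<in> T \<Longrightarrow> s \<in> U \<Longrightarrow> h s = M (u s)"
    by (rule transportsE[OF h t(1)]) blast
  obtain U' N' M' where 2: "open U'" "t' \<in> U'" "solves N' M'" "\<And>s. s \<in> T' \<Longrightarrow> s \<in> U' \<Longrightarrow> u' s \<in> N'"
    "\<And>s. s \<in> T' \<Longrightarrow> s \<in> U' \<Longrightarrow> h' s = M' (u' s)"
    by (rule transportsE[OF h' t(2)]) blast
  have "u t \<in> N" "u t \<in> N'"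
    using 1(4)[OF t(1) 1(2)] 2(4)[OF t(2) 2(2)] t(3) by auto
  then obtain V C where V: "open V" "u t \<in> V" "V \<subseteq> N \<inter> N'" "\<And>y. y \<in> V \<Longrightarrow> M' y = C * M y"
    using solves_unique[OF 1(3) 2(3)] by blast
  obtain W where W: "open W" "W \<inter> T = u -` V \<inter> T"
    using u V(1) by (metis continuous_on_open_invariant)
  obtain W' where W': "open W'" "W' \<inter> T' = u' -` V \<inter> T'"
    using u' V(1) by (metis continuous_on_open_invariant)
  have "solves V M"
    using solves_mono[OF 1(3) V(1)] V(3) by blast
  moreover have "open (U \<inter> W)" "open (U' \<inter> W')"
    using 1(1) 2(1) W(1) W'(1) by auto
  moreover have "t \<in> U \<inter> W" "t' \<in> U' \<inter> W'"
    using 1(2) 2(2) W(2) W'(2) V(2) t by auto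
  moreover have "u s \<in> V \<and> h s = M (u s)" if "s \<in> T" "s \<in> U \<inter> W" for s
    using that 1(5) W(2) by blast
  moreover have "u' s \<in> V \<and> h' s = C * M (u' s)" if "s \<in> T'" "s \<in> U' \<inter> W'" for s
  proof -
    have "u' s \<in> V"
      using that W'(2) by blast
    then show ?thesis
      using that 2(5)[of s] V(4) by simp
  qed
  ultimately show thesis
    using that by blast
qed

text \<open>By \<open>solves_unique\<close> the quotient is locally constant.\<close>
lemma transports_ratio_const:
  assumes "transports T u h" "transports T u h'" "connected T" "continuous_on T u" "s \<in> T" "t \<in> T"
  shows "h' s * uinv (h s) = h' t * uinv (h t)"
proof (rule connected_local_const[OF assms(3,5,6)], rule ballI)
  fix a assume a: "a \<in> T"
  obtain U U' N M C where *: "open U" "a \<in> U" "open U'" "a \<in> U'" "solves N M"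
    "\<And>s. s \<in> T \<Longrightarrow> s \<in> U \<Longrightarrow> u s \<in> N \<and> h s = M (u s)"
    "\<And>s. s \<in> T \<Longrightarrow> s \<in> U' \<Longrightarrow> u s \<in> N \<and> h' s = C * M (u s)"
    by (rule transports_locally_unique[OF assms(1,2,4,4) a a HOL.refl]) blast
  have C: "h' b * uinv (h b) = C" if "b \<in> T" "b \<in> U \<inter> U'" for b
    using that *(6,7)[of b] by (simp add: mult.assoc)
  have "eventually (\<lambda>b. b \<in> U \<inter> U') (nhds a)"
    using * by (intro eventually_nhds_in_open) auto
  then show "eventually (\<lambda>b. h' a * uinv (h a) = h' b * uinv (h b)) (at a within T)"
    unfolding eventually_at_filter
    by eventually_elim (use C[of a] C a * in auto)
qed

lemma transports_agree:
  assumes "transports T u h" "transports T u h'" "connected T" "continuous_on T u"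
    and "s \<in> T" "h' s = h s" "t \<in> T"
  shows "h' t = h t"
proof -
  have "h' t * uinv (h t) = 1"
    using transports_ratio_const[OF assms(1-5,7)] assms(6) by simp
  then show ?thesis
    by (metis mult.assoc mult_1_left mult_1_right uinv_left)
qed

lemma transports_locally_exists:
  assumes "continuous_on T u" "t \<in> T" "u t \<in> regular"
  obtains U h where "open U" "t \<in> U" "transports (T \<inter> U) u h"
proof -
  obtain N M where N: "solves N M" "u t \<in> N"
    using ex_solves[OF assms(3)] by blast
  obtain U where U: "open U" "U \<inter> T = u -` N \<inter> T"
    using assms(1) solves_open[OF N(1)] by (metis continuous_on_open_invariant)
  have "transports (T \<inter> U) u (\<lambda>s. M (u s))"
  proof (rule transportsI)
    fix s assume "s \<in> T \<inter> U"
    then show "\<exists>V N M'. open V \<and> s \<in> V \<and> solves N M' \<and> (\<forall>s\<in>T \<inter> U \<inter> V. u s \<in> N \<and> M (u s) = M' (u s))"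
      using U N by (intro exI[of _ U] exI[of _ N] exI[of _ M]) blast
  qed
  moreover have "t \<in> U"
    using U(2) N(2) assms(2) by blast
  ultimately show thesis
    using that U(1) by blast
qed

text \<open>On the connected overlap the two transports differ by a constant left factor. At a common
  point, local solutions from the two sides differ by a left factor too, and evaluation there shows
  that this factor is \<open>1\<close>.\<close>
lemma transports_glue:
  assumes h: "transports S u h" and h': "transports S' u h'"
    and closed: "closed S" "closed S'" and conn: "connected (S \<inter> S')"
    and u: "continuous_on (S \<union> S') u"
  obtains k where "transports (S \<union> S') u k"
proof -
  have uS: "continuous_on S u" "continuous_on S' u"
    using u continuous_on_subset by blast+
  obtain C where C: "\<And>t. t \<in> S \<inter> S' \<Longrightarrow> C * h' t = h t"
  proof (cases "S \<inter> S' = {}")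
    case True
    then show ?thesis
      using that by blast
  next
    case False
    then obtain t0 where t0: "t0 \<in> S \<inter> S'"
      by blast
    have "transports (S \<inter> S') u h" "transports (S \<inter> S') u h'"
      using transports_compose[OF h, of "S \<inter> S'" "\<lambda>t. t" u h]
        transports_compose[OF h', of "S \<inter> S'" "\<lambda>t. t" u h'] by auto
    from transports_ratio_const[OF this(2,1) conn _ t0]
    have "h t0 * uinv (h' t0) = h t * uinv (h' t)" if "t \<in> S \<inter> S'" for t
      using that uS continuous_on_subset by blast
    then show ?thesis
      using that[of "h t0 * uinv (h' t0)"] by (simp add: mult.assoc)
  qed
  have Ch': "transports S' u (\<lambda>t. C * h' t)"
    by (rule transports_mult_left[OF h'])
  define k where "k t = (if t \<in> S then h t else C * h' t)" for t
  have k: "k t = h t" if "t \<in> S" for t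
    using that by (simp add: k_def)
  have k': "k t = C * h' t" if "t \<in> S'" for t
    using that C by (simp add: k_def)
  have one_side: "\<exists>U N M. open U \<and> t \<in> U \<and> solves N M \<and> (\<forall>s\<in>(S \<union> S') \<inter> U. u s \<in> N \<and> k s = M (u s))"
    if X: "transports X u k" "closed Z" "t \<in> X" "t \<notin> Z" "S \<union> S' = X \<union> Z" for X Z t
  proof -
    obtain U N M where *: "open U" "t \<in> U" "solves N M" "\<And>s. s \<in> X \<Longrightarrow> s \<in> U \<Longrightarrow> u s \<in> N"
      "\<And>s. s \<in> X \<Longrightarrow> s \<in> U \<Longrightarrow> k s = M (u s)"
      by (rule transportsE[OF X(1,3)]) blast
    have "open (U - Z)" "t \<in> U - Z"
      using * X by auto
    moreover have "u s \<in> N \<and> k s = M (u s)" if "s \<in> (S \<union> S') \<inter> (U - Z)" for s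
      using that * X(5) by blast
    ultimately show ?thesis
      using *(3) by blast
  qed
  have kS: "transports S u k"
    by (rule transports_compose[OF h, of _ "\<lambda>t. t"]) (auto simp: k)
  have kS': "transports S' u k"
    by (rule transports_compose[OF Ch', of _ "\<lambda>t. t"]) (auto simp: k')
  have "transports (S \<union> S') u k"
  proof (rule transportsI)
    fix t assume t: "t \<in> S \<union> S'"
    consider "t \<in> S" "t \<notin> S'" | "t \<in> S'" "t \<notin> S" | "t \<in> S" "t \<in> S'"
      using t by blast
    then show "\<exists>U N M. open U \<and> t \<in> U \<and> solves N M \<and> (\<forall>s\<in>(S \<union> S') \<inter> U. u s \<in> N \<and> k s = M (u s))"
    proof cases
      case 1
      then show ?thesis
        using one_side[OF kS closed(2)] by blast
    next
      case 2
      then show ?thesis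
        using one_side[OF kS' closed(1)] by blast
    next
      case 3
      obtain U U' N M D where *: "open U" "t \<in> U" "open U'" "t \<in> U'" "solves N M"
        "\<And>s. s \<in> S \<Longrightarrow> s \<in> U \<Longrightarrow> u s \<in> N \<and> k s = M (u s)"
        "\<And>s. s \<in> S' \<Longrightarrow> s \<in> U' \<Longrightarrow> u s \<in> N \<and> k s = D * M (u s)"
        by (rule transports_locally_unique[OF kS kS' uS 3 HOL.refl]) blast
      have "M (u t) = D * M (u t)"
        using *(2,4,6,7) 3 by metis
      then have "D = 1"
        by (metis mult.assoc mult_1_right uinv_right)
      then have "u s \<in> N \<and> k s = M (u s)" if "s \<in> (S \<union> S') \<inter> (U \<inter> U')" for s
        using that *(6,7)[of s] by auto
      moreover have "open (U \<inter> U')" "t \<in> U \<inter> U'"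
        using * by auto
      ultimately show ?thesis
        using *(5) by blast
    qed
  qed
  then show thesis
    using that by blast
qed

lemma transports_subset:
  assumes "transports T u h" "T' \<subseteq> T"
  shows "transports T' u h"
  using transports_compose[OF assms(1), of T' "\<lambda>t. t" u h] assms(2) by auto

text \<open>A first bisection glues transports over small boxes along a vertical line into one over a thin
  vertical strip; a second bisection glues the strips.\<close>
lemma transports_exists_square:
  fixes K :: "real \<times> real \<Rightarrow> 'a"
  assumes K: "continuous_on ({0..1} \<times> {0..1}) K" and reg: "K ` ({0..1} \<times> {0..1}) \<subseteq> regular"
  obtains h where "transports ({0..1} \<times> {0..1}) K h"
proof -
  \<comment> \<open>Clipping to the unit square is needed because the bisection principle also tests intervals
    that stick out of \<open>{0..1}\<close>.\<close>
  define R where "R a b c d = ({a..b} \<inter> {0..1}) \<times> ({c..d} \<inter> {0..1})" for a b c d :: real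
  have R: "closed (R a b c d)" "connected (R a b c d)" "R a b c d \<subseteq> {0..1} \<times> {0..1}" for a b c d
    unfolding R_def
    by (auto intro!: closed_Times closed_Int convex_connected convex_Times convex_Int)
  have R_mono: "R a b c d \<subseteq> R a' b' c' d'" if "a' \<le> a" "b \<le> b'" "c' \<le> c" "d \<le> d'" for a b c d a' b' c' d'
    using that unfolding R_def by auto
  have glue: "\<exists>h. transports (R a b c d \<union> R a' b' c' d') K h"
    if "transports (R a b c d) K h1" "transports (R a' b' c' d') K h2" for h1 h2 a b c d a' b' c' d'
  proof -
    have "R a b c d \<inter> R a' b' c' d' = R (max a a') (min b b') (max c c') (min d d')"
      unfolding R_def by auto
    then have "connected (R a b c d \<inter> R a' b' c' d')"
      using R(2) by metis
    moreover have "continuous_on (R a b c d \<union> R a' b' c' d') K"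
      using continuous_on_subset[OF K] R(3) by (meson Un_least)
    ultimately show ?thesis
      using transports_glue[OF that R(1) R(1)] by meson
  qed
  have strip: "\<exists>\<delta>>0. \<exists>h. transports (R (s - \<delta>) (s + \<delta>) 0 1) K h" if s: "s \<in> {0..1}" for s
  proof (rule Bolzano[of 0 1 "\<lambda>c d. \<exists>\<delta>>0. \<exists>h. transports (R (s - \<delta>) (s + \<delta>) c d) K h"])
    fix c d e :: real
    assume 1: "\<exists>\<delta>>0. \<exists>h. transports (R (s - \<delta>) (s + \<delta>) c d) K h"
      and 2: "\<exists>\<delta>>0. \<exists>h. transports (R (s - \<delta>) (s + \<delta>) d e) K h" and le: "c \<le> d" "d \<le> e"
    obtain \<delta>1 h1 where 1: "\<delta>1 > 0" "transports (R (s - \<delta>1) (s + \<delta>1) c d) K h1"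
      using 1 by blast
    obtain \<delta>2 h2 where 2: "\<delta>2 > 0" "transports (R (s - \<delta>2) (s + \<delta>2) d e) K h2"
      using 2 by blast
    define \<delta> where "\<delta> = min \<delta>1 \<delta>2"
    have "transports (R (s - \<delta>) (s + \<delta>) c d) K h1" "transports (R (s - \<delta>) (s + \<delta>) d e) K h2"
      by (rule transports_subset[OF 1(2)], rule R_mono; simp add: \<delta>_def)
         (rule transports_subset[OF 2(2)], rule R_mono; simp add: \<delta>_def)
    then obtain h where "transports (R (s - \<delta>) (s + \<delta>) c d \<union> R (s - \<delta>) (s + \<delta>) d e) K h"
      using glue by blast
    then have "transports (R (s - \<delta>) (s + \<delta>) c e) K h"
      by (rule transports_subset) (use le in \<open>auto simp: R_def\<close>)
    moreover have "\<delta> > 0"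
      using 1(1) 2(1) by (simp add: \<delta>_def)
    ultimately show "\<exists>\<delta>>0. \<exists>h. transports (R (s - \<delta>) (s + \<delta>) c e) K h"
      by blast
  next
    fix t :: real
    assume t: "0 \<le> t" "t \<le> 1"
    have st: "(s, t) \<in> {0..1} \<times> {0..1}"
      using s t by simp
    then have "K (s, t) \<in> regular"
      using reg by (meson image_subset_iff)
    then obtain U h where U: "open U" "(s, t) \<in> U" "transports (({0..1} \<times> {0..1}) \<inter> U) K h"
      using transports_locally_exists[OF K st] by metis
    obtain S T where ST: "open S" "open T" "s \<in> S" "t \<in> T" "S \<times> T \<subseteq> U"
      using open_prod_elim[OF U(1,2)] by (metis mem_Sigma_iff)
    obtain \<delta> where \<delta>: "\<delta> > 0" "cball s \<delta> \<subseteq> S"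
      using ST(1,3) open_contains_cball by blast
    obtain d where d: "d > 0" "cball t d \<subseteq> T"
      using ST(2,4) open_contains_cball by blast
    have "transports (R (s - \<delta>) (s + \<delta>) a b) K h" if "a \<le> t" "t \<le> b" "b - a < d" for a b
    proof (rule transports_subset[OF U(3)])
      have "{s - \<delta>..s + \<delta>} \<subseteq> S" "{a..b} \<subseteq> T"
        using \<delta>(2) d(2) that by (auto simp: cball_eq_atLeastAtMost)
      then show "R (s - \<delta>) (s + \<delta>) a b \<subseteq> ({0..1} \<times> {0..1}) \<inter> U"
        using ST(5) unfolding R_def by blast
    qed
    then show "\<exists>d>0. \<forall>a b. a \<le> t \<and> t \<le> b \<and> b - a < d \<longrightarrow>
        (\<exists>\<delta>>0. \<exists>h. transports (R (s - \<delta>) (s + \<delta>) a b) K h)"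
      using \<delta>(1) d(1) by blast
  qed simp
  have "\<exists>h. transports (R 0 1 0 1) K h"
  proof (rule Bolzano[of 0 1 "\<lambda>a b. \<exists>h. transports (R a b 0 1) K h"])
    fix a b c :: real
    assume "\<exists>h. transports (R a b 0 1) K h" "\<exists>h. transports (R b c 0 1) K h" and le: "a \<le> b" "b \<le> c"
    then obtain h where "transports (R a b 0 1 \<union> R b c 0 1) K h"
      using glue by blast
    then have "transports (R a c 0 1) K h"
      by (rule transports_subset) (use le in \<open>auto simp: R_def\<close>)
    then show "\<exists>h. transports (R a c 0 1) K h"
      by blast
  next
    fix s :: real
    assume "0 \<le> s" "s \<le> 1"
    then obtain \<delta> h where \<delta>: "\<delta> > 0" "transports (R (s - \<delta>) (s + \<delta>) 0 1) K h"
      using strip[of s] by auto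
    have "transports (R a b 0 1) K h" if "a \<le> s" "s \<le> b" "b - a < \<delta>" for a b
      by (rule transports_subset[OF \<delta>(2)], rule R_mono) (use that in auto)
    then show "\<exists>d>0. \<forall>a b. a \<le> s \<and> s \<le> b \<and> b - a < d \<longrightarrow> (\<exists>h. transports (R a b 0 1) K h)"
      using \<delta>(1) by blast
  qed simp
  then show thesis
    using that by (auto simp: R_def)
qed

lemma transports_exists_path:
  assumes "path p" "path_image p \<subseteq> regular"
  obtains h where "transports {0..1} p h"
proof -
  have "continuous_on ({0..1} \<times> {0..1}) (\<lambda>z. p (snd z))"
    by (rule continuous_on_compose2[OF assms(1)[unfolded path_def]])
      (auto intro!: continuous_on_snd continuous_on_id)
  moreover have "(\<lambda>z. p (snd z)) ` ({0..1} \<times> {0..1}) \<subseteq> regular"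
    using assms(2) by (auto simp: path_image_def)
  ultimately obtain h where h: "transports ({0..1::real} \<times> {0..1}) (\<lambda>z. p (snd z)) h"
    using transports_exists_square by blast
  have "transports {0..1} p (\<lambda>t. h (0, t))"
    by (rule transports_compose[OF h, of _ "\<lambda>t. (0, t)"]) (auto intro!: continuous_intros)
  then show thesis
    using that by blast
qed

end

section \<open>Holonomy of paths\<close>

context flat_connection
begin

text \<open>The quotient of the two end values is the same for all transports along \<open>p\<close>; see
  \<open>holonomy_eq\<close>.\<close>
definition holonomy :: "(real \<Rightarrow> 'a) \<Rightarrow> uni" where
  "holonomy p = (let h = SOME h. transports {0..1} p h in uinv (h 0) * h 1)"

lemma holonomy_eq:
  assumes "path p" "transports {0..1} p h"
  shows "holonomy p = uinv (h 0) * h 1"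
proof -
  define k where "k = (SOME h. transports {0..1} p h)"
  have "transports {0..1} p k"
    unfolding k_def by (rule someI[of "transports {0..1} p", OF assms(2)])
  then have "h 0 * uinv (k 0) = h 1 * uinv (k 1)"
    using assms transports_ratio_const[of "{0..1}" p k h 0 1] by (auto simp: path_def)
  then have "uinv (h 0) * (h 0 * uinv (k 0)) * k 1 = uinv (h 0) * (h 1 * uinv (k 1)) * k 1"
    by (simp only:)
  then have "uinv (k 0) * k 1 = uinv (h 0) * h 1"
    by (simp add: mult.assoc)
  then show ?thesis
    by (simp add: holonomy_def k_def[symmetric] Let_def)
qed

lemma transports_const:
  assumes "b \<in> regular"
  shows "transports T (\<lambda>_. b) (\<lambda>_. C)"
proof (rule transportsI)
  fix t assume "t \<in> T"
  obtain N M where N: "solves N M" "b \<in> N"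
    using ex_solves[OF assms] by blast
  have "solves N (\<lambda>x. (C * uinv (M b)) * M x)"
    by (rule solves_mult_left[OF N(1)])
  with N(2) show "\<exists>U N M. open U \<and> t \<in> U \<and> solves N M \<and> (\<forall>s\<in>T \<inter> U. b \<in> N \<and> C = M b)"
    by (intro exI[of _ UNIV] exI[of _ N] exI[of _ "\<lambda>x. (C * uinv (M b)) * M x"]) (simp add: mult.assoc)
qed

lemma holonomy_const: "b \<in> regular \<Longrightarrow> holonomy (\<lambda>_. b) = 1"
  using holonomy_eq[OF _ transports_const, of b 1] by (simp add: path_def)

lemma holonomy_join:
  assumes "path p" "path q" "pathfinish p = pathstart q" "path_image p \<subseteq> regular" "path_image q \<subseteq> regular"
  shows "holonomy (p +++ q) = holonomy p * holonomy q"
proof -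
  have pq: "path (p +++ q)" "path_image (p +++ q) \<subseteq> regular"
    using assms by (auto simp: path_image_join)
  then obtain h where h: "transports {0..1} (p +++ q) h"
    using transports_exists_path by blast
  have "transports {0..1} p (\<lambda>t. h (t / 2))"
    by (rule transports_compose[OF h, of _ "\<lambda>t. t / 2"])
      (auto intro!: continuous_intros simp: joinpaths_def)
  moreover have "transports {0..1} q (\<lambda>t. h ((t + 1) / 2))"
    by (rule transports_compose[OF h, of _ "\<lambda>t. (t + 1) / 2"])
      (use assms(3) in \<open>auto intro!: continuous_intros
        simp: joinpaths_def pathfinish_def pathstart_def add_divide_distrib\<close>)
  ultimately show ?thesis
    using holonomy_eq[OF assms(1)] holonomy_eq[OF assms(2)] holonomy_eq[OF pq(1) h]
    by (simp add: mult.assoc)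
qed

lemma holonomy_reversepath:
  assumes "path p" "path_image p \<subseteq> regular"
  shows "holonomy (reversepath p) = uinv (holonomy p)"
proof -
  obtain h where h: "transports {0..1} p h"
    using transports_exists_path assms by blast
  have "transports {0..1} (reversepath p) (\<lambda>t. h (1 - t))"
    by (rule transports_compose[OF h, of _ "\<lambda>t. 1 - t"])
      (auto intro!: continuous_intros simp: reversepath_def)
  then show ?thesis
    using holonomy_eq[OF assms(1) h] holonomy_eq[of "reversepath p"] assms(1)
    by (simp add: uinv_mult)
qed

text \<open>Take a transport over the whole homotopy. The end points do not move, so it is constant on the
  two sides of the square on which the path parameter is \<open>0\<close> or \<open>1\<close>.\<close>
lemma holonomy_homotopic:
  assumes "homotopic_paths Y p q" "Y \<subseteq> regular"
  shows "holonomy p = holonomy q"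
proof -
  obtain K :: "real \<times> real \<Rightarrow> 'a" where K: "continuous_on ({0..1} \<times> {0..1}) K" "K \<in> ({0..1} \<times> {0..1}) \<rightarrow> Y"
    and K': "\<forall>t\<in>{0..1}. K (0, t) = p t" "\<forall>t\<in>{0..1}. K (1, t) = q t"
      "\<forall>s\<in>{0..1}. pathstart (K \<circ> Pair s) = pathstart p \<and> pathfinish (K \<circ> Pair s) = pathfinish p"
    using assms(1) unfolding homotopic_paths by blast
  note edge = K'(1)[rule_format] K'(2)[rule_format] and ends = K'(3)[rule_format]
  have "K ` ({0..1} \<times> {0..1}) \<subseteq> regular"
    using K(2) assms(2) by blast
  then obtain h where h: "transports ({0..1} \<times> {0..1}) K h"
    using transports_exists_square[OF K(1)] by blast
  have pq: "path p" "path q" "path_image p \<subseteq> Y"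
    using assms(1) homotopic_paths_imp_path homotopic_paths_imp_subset by blast+
  have "transports {0..1} p (\<lambda>t. h (0, t))" "transports {0..1} q (\<lambda>t. h (1, t))"
    by (rule transports_compose[OF h, of _ "\<lambda>t. (0, t)"];
        auto intro!: continuous_intros simp: edge)
      (rule transports_compose[OF h, of _ "\<lambda>t. (1, t)"];
        auto intro!: continuous_intros simp: edge)
  then have hol: "holonomy p = uinv (h (0,0)) * h (0,1)" "holonomy q = uinv (h (1,0)) * h (1,1)"
    using holonomy_eq pq by auto
  have const: "h (1, t) = h (0, t)" if "t = 0 \<or> t = 1" for t
  proof -
    have t: "t \<in> {0..1}"
      using that by auto
    define b where "b = (if t = 0 then pathstart p else pathfinish p)"
    have "K (s, t) = b" if "s \<in> {0..1}" for s
      using ends[OF that] \<open>t = 0 \<or> t = 1\<close> by (auto simp: b_def pathstart_def pathfinish_def)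
    then have along: "transports {0..1} (\<lambda>_. b) (\<lambda>s. h (s, t))"
      using t by (intro transports_compose[OF h, of _ "\<lambda>s. (s, t)"]) (auto intro!: continuous_intros)
    have "b \<in> regular"
      using pq(3) assms(2) pathstart_in_path_image[of p] pathfinish_in_path_image[of p]
      by (auto simp: b_def)
    from transports_agree[OF transports_const[OF this] along, of 0 "h (0, t)" 1]
    show ?thesis
      by simp
  qed
  show ?thesis
    using hol const[of 0] const[of 1] by simp
qed

text \<open>For a homotopy of loops, the two sides of the square on which the path parameter is \<open>0\<close> or \<open>1\<close>
  are transports along the same path of base points. Their quotient, the left monodromy, therefore
  does not change during the homotopy, in contrast to \<^const>\<open>holonomy\<close>, which is conjugated.\<close>
lemma free_homotopy_monodromy:
  fixes K :: "real \<times> real \<Rightarrow> 'a"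
  assumes K: "continuous_on ({0..1} \<times> {0..1}) K"
    and loops: "\<And>s. s \<in> {0..1} \<Longrightarrow> K (s, 1) = K (s, 0)"
    and h: "transports ({0..1} \<times> {0..1}) K h" and s: "s \<in> {0..1::real}" "s' \<in> {0..1}"
  shows "h (s, 1) * uinv (h (s, 0)) = h (s', 1) * uinv (h (s', 0))"
proof -
  have "transports {0..1} (\<lambda>s. K (s, 0)) (\<lambda>s. h (s, 1))" "transports {0..1} (\<lambda>s. K (s, 0)) (\<lambda>s. h (s, 0))"
    by (rule transports_compose[OF h, of _ "\<lambda>s. (s, 1)"];
        auto intro!: continuous_intros simp: loops)
      (rule transports_compose[OF h, of _ "\<lambda>s. (s, 0)"];
        auto intro!: continuous_intros)
  note edges = this
  have "continuous_on {0..1} (\<lambda>s. K (s, 0))"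
    by (rule continuous_on_compose2[OF K]) (auto intro!: continuous_intros)
  from transports_ratio_const[OF edges(2,1) _ this s] show ?thesis
    by simp
qed

end

section \<open>Iterated integrals as entries of the holonomy\<close>

text \<open>The finite set contains the break points of a piecewise smooth path, where \<open>a\<close> may take
  arbitrary values.\<close>
lemma integral_of_derivative_off_finite:
  fixes f :: "real \<Rightarrow> complex"
  assumes cont: "continuous_on {0..1} f" and K: "finite K"
    and deriv: "\<And>t. t \<in> {0<..<1} - K \<Longrightarrow> (f has_vector_derivative a t) (at t)"
    and int: "set_integrable lborel {0..1} a" and t: "t \<in> {0..1}"
  shows "(LINT s:{0..t}|lborel. a s) = f t - f 0"
proof -
  have "(a has_integral f t - f 0) {0..t}"
    by (rule fundamental_theorem_of_calculus_interior_strong[OF K])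
      (use t deriv continuous_on_subset[OF cont, of "{0..t}"] in auto)
  moreover have "set_integrable lborel {0..t} a"
    by (rule set_integrable_subset[OF int]) (use t in auto)
  ultimately show ?thesis
    using set_borel_integral_eq_integral(2) integral_unique by metis
qed

lemma time_simplex_integral_1:
  assumes "set_integrable lborel {0..1} a"
  shows "(LINT t:time_simplex 1|PiM {..<1} (\<lambda>_. lborel). a (t 0)) = (LINT s:{0..1}|lborel. (a s :: complex))"
proof -
  interpret product_sigma_finite "\<lambda>_::nat. lborel :: real measure"
    by standard
  have "indicator (time_simplex 1) t = (indicator {0..1} (t 0) :: real)" for t
    by (auto simp: time_simplex_def indicator_def)
  moreover have "{..<1::nat} = {0}"
    by auto
  ultimately show ?thesis
    using product_integral_singleton[of "\<lambda>s. indicator {0..1} s *\<^sub>R a s" 0] assms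
    by (simp add: set_lebesgue_integral_def set_integrable_def)
qed

text \<open>Fubini's theorem. Integrability on the square, the condition for it, follows from the
  integrability of the two factors.\<close>
lemma time_simplex_integral_2:
  fixes a b :: "real \<Rightarrow> complex"
  assumes a: "set_integrable lborel {0..1} a" and b: "set_integrable lborel {0..1} b"
  shows "(LINT t:time_simplex 2|PiM {..<2} (\<lambda>_. lborel). a (t 0) * b (t 1)) =
    (LINT s:{0..1}|lborel. (LINT r:{0..s}|lborel. a r) * b s)"
proof -
  interpret product_sigma_finite "\<lambda>_::nat. lborel :: real measure"
    by standard
  define a' where "a' r = indicator {0..1} r *\<^sub>R a r" for r :: real
  define b' where "b' r = indicator {0..1} r *\<^sub>R b r" for r :: real
  have a': "integrable lborel a'" and b': "integrable lborel b'"
    using a b unfolding set_integrable_def a'_def[abs_def] b'_def[abs_def] by auto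
  have two: "{..<2::nat} = insert 0 {1}"
    by auto
  let ?F = "\<lambda>t::nat \<Rightarrow> real. indicator {t. t 0 \<le> t 1} t *\<^sub>R (a' (t 0) * b' (t 1))"
  have "integrable (PiM {..<2::nat} (\<lambda>_. lborel)) (\<lambda>t. \<Prod>i\<in>{..<2}. (if i = 0 then a' else b') (t i))"
    using a' b' by (intro product_integrable_prod) auto
  then have int: "integrable (PiM (insert 0 {1}) (\<lambda>_. lborel)) (\<lambda>t. a' (t 0) * b' (t (1::nat)))"
    unfolding two by simp
  have "{t \<in> space (PiM (insert (0::nat) {1}) (\<lambda>_. lborel::real measure)). t 0 \<le> t 1} \<in>
      sets (PiM (insert (0::nat) {1}) (\<lambda>_. lborel))"
    by measurable
  then have "integrable (PiM (insert 0 {1}) (\<lambda>_. lborel))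
     (\<lambda>t. indicator {t \<in> space (PiM (insert (0::nat) {1}) (\<lambda>_. lborel::real measure)). t 0 \<le> t 1} t *\<^sub>R (a' (t 0) * b' (t (1::nat))))"
    using int by (rule integrable_mult_indicator)
  then have F: "integrable (PiM (insert 0 {1}) (\<lambda>_. lborel)) ?F"
    by (rule Bochner_Integration.integrable_cong[THEN iffD1, OF HOL.refl, rotated])
      (simp add: indicator_def)
  have inner: "(LINT r|lborel. ?F ((t::nat \<Rightarrow> real)(0 := r))) = (LINT r:{0..t 1}|lborel. a r) * b' (t 1)" for t
  proof -
    have "(LINT r|lborel. ?F (t(0 := r))) = (LINT r|lborel. (indicator {0..t 1} r *\<^sub>R a r) * b' (t 1))"
      by (rule Bochner_Integration.integral_cong) (auto simp: a'_def b'_def indicator_def)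
    also have "\<dots> = (LINT r:{0..t 1}|lborel. a r) * b' (t 1)"
      unfolding set_lebesgue_integral_def by (rule integral_mult_left_zero)
    finally show ?thesis .
  qed
  have "(LINT t:time_simplex 2|PiM {..<2} (\<lambda>_. lborel). a (t 0) * b (t 1)) =
      (LINT t|PiM (insert 0 {1}) (\<lambda>_. lborel). ?F t)"
    unfolding set_lebesgue_integral_def two
  proof (rule Bochner_Integration.integral_cong[OF HOL.refl])
    fix t :: "nat \<Rightarrow> real"
    have "t \<in> time_simplex 2 \<longleftrightarrow> t 0 \<in> {0..1} \<and> t 1 \<in> {0..1} \<and> t 0 \<le> t 1"
      unfolding time_simplex_def by (auto simp: less_2_cases_iff le_Suc_eq)
    then show "indicator (time_simplex 2) t *\<^sub>R (a (t 0) * b (t 1)) = ?F t"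
      by (auto simp: a'_def b'_def indicator_def)
  qed
  also have "\<dots> = (LINT t|PiM {1} (\<lambda>_. lborel). LINT r|lborel. ?F (t(0 := r)))"
    by (rule product_integral_insert[OF _ _ F]) auto
  also have "\<dots> = (LINT t|PiM {1::nat} (\<lambda>_. lborel). (LINT r:{0..t 1}|lborel. a r) * b' (t 1))"
    by (simp only: inner)
  also have "\<dots> = (LINT s|lborel. (LINT r:{0..s}|lborel. a r) * b' s)"
  proof (rule product_integral_singleton)
    have "(\<lambda>s. (LINT r|lborel. indicator {0..s} r *\<^sub>R a' r) * b' s) \<in> borel_measurable lborel"
    proof (intro borel_measurable_times lborel.borel_measurable_lebesgue_integral)
      have [measurable]: "a' \<in> borel_measurable borel"
        using a' by simp
      have "(\<lambda>(s, r). (if 0 \<le> r \<and> r \<le> s then 1 else 0::real) *\<^sub>R a' r) \<in> borel_measurable (borel \<Otimes>\<^sub>M borel)"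
        by measurable
      then show "(\<lambda>(s, r). indicator {0..s} r *\<^sub>R a' r) \<in> borel_measurable (lborel \<Otimes>\<^sub>M lborel)"
        by (simp add: indicator_def of_bool_def cong: measurable_cong_sets)
    qed (use b' in auto)
    also have "(\<lambda>s. (LINT r|lborel. indicator {0..s} r *\<^sub>R a' r) * b' s) =
        (\<lambda>s. (LINT r:{0..s}|lborel. a r) * b' s)"
    proof
      fix s :: real
      have "(LINT r|lborel. indicator {0..s} r *\<^sub>R a' r) = (LINT r:{0..s}|lborel. a r)" if "s \<le> 1"
        unfolding set_lebesgue_integral_def using that
        by (intro Bochner_Integration.integral_cong) (auto simp: a'_def indicator_def)
      moreover have "b' s = 0" if "s > 1"
        using that by (simp add: b'_def)
      ultimately show "(LINT r|lborel. indicator {0..s} r *\<^sub>R a' r) * b' s = (LINT r:{0..s}|lborel. a r) * b' s"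
        by (cases "s \<le> 1") auto
    qed
    finally show "(\<lambda>s. (LINT r:{0..s}|lborel. a r) * b' s) \<in> borel_measurable lborel" .
  qed
  also have "\<dots> = (LINT s:{0..1}|lborel. (LINT r:{0..s}|lborel. a r) * b s)"
    unfolding set_lebesgue_integral_def
    by (intro Bochner_Integration.integral_cong) (auto simp: b'_def indicator_def)
  finally show ?thesis .
qed

lemma iterated_integral_primitives:
  fixes f F a b :: "real \<Rightarrow> complex"
  assumes K: "finite K" and f: "continuous_on {0..1} f" and F: "continuous_on {0..1} F" and "f 0 = 0" "F 0 = 0"
    and df: "\<And>t. t \<in> {0<..<1} - K \<Longrightarrow> (f has_vector_derivative a t) (at t)"
    and dF: "\<And>t. t \<in> {0<..<1} - K \<Longrightarrow> (F has_vector_derivative f t * b t) (at t)"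
    and a: "set_integrable lborel {0..1} a" and b: "set_integrable lborel {0..1} b"
  shows "(LINT t:time_simplex 2|PiM {..<2} (\<lambda>_. lborel). a (t 0) * b (t 1)) = F 1"
proof -
  have "(LINT t:time_simplex 2|PiM {..<2} (\<lambda>_. lborel). a (t 0) * b (t 1)) =
      (LINT s:{0..1}|lborel. (LINT r:{0..s}|lborel. a r) * b s)"
    by (rule time_simplex_integral_2[OF a b])
  also have "\<dots> = (LINT s:{0..1}|lborel. f s * b s)"
    using integral_of_derivative_off_finite[OF f K df a] \<open>f 0 = 0\<close>
    by (intro set_lebesgue_integral_cong) auto
  also have "\<dots> = F 1"
  proof -
    obtain B where B: "\<And>s. s \<in> {0..1} \<Longrightarrow> norm (f s) \<le> B"
      using compact_imp_bounded[OF compact_continuous_image[OF f compact_Icc]]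
      by (force simp: bounded_iff)
    have f': "set_borel_measurable lborel {0..1} f"
      using borel_integrable_atLeastAtMost'[OF f]
      unfolding set_integrable_def set_borel_measurable_def by auto
    have "set_integrable lborel {0..1} (\<lambda>s. f s * b s)"
      unfolding set_integrable_def
    proof (rule Bochner_Integration.integrable_bound)
      show "integrable lborel (\<lambda>s. B *\<^sub>R norm (indicator {0..1} s *\<^sub>R b s))"
        using b unfolding set_integrable_def
        by (intro integrable_scaleR_right integrable_norm)
      have "(\<lambda>s. indicator {0..1} s *\<^sub>R f s) \<in> borel_measurable lborel"
        "(\<lambda>s. indicator {0..1} s *\<^sub>R b s) \<in> borel_measurable lborel"
        using f' b unfolding set_borel_measurable_def set_integrable_def by auto
      from borel_measurable_times[OF this]
      show "(\<lambda>s. indicator {0..1} s *\<^sub>R (f s * b s)) \<in> borel_measurable lborel"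
        by (rule measurable_cong[THEN iffD1, rotated]) (auto simp: indicator_def)
      show "AE s in lborel. norm (indicator {0..1} s *\<^sub>R (f s * b s)) \<le>
          norm (B *\<^sub>R norm (indicator {0..1} s *\<^sub>R b s))"
      proof (rule AE_I2)
        fix s :: real
        show "norm (indicator {0..1} s *\<^sub>R (f s * b s)) \<le> norm (B *\<^sub>R norm (indicator {0..1} s *\<^sub>R b s))"
        proof (cases "s \<in> {0..1}")
          case True
          have "norm (f s) * norm (b s) \<le> B * norm (b s)"
            by (rule mult_right_mono[OF B[OF True]]) simp
          with True show ?thesis
            by (simp add: norm_mult)
        qed simp
      qed
    qed
    from integral_of_derivative_off_finite[OF F K dF this, of 1] show ?thesis
      using \<open>F 0 = 0\<close> by simp
  qed
  finally show ?thesis .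
qed

lemma continuous_on_locally:
  assumes "\<And>t. t \<in> S \<Longrightarrow> \<exists>U. open U \<and> t \<in> U \<and> continuous_on (S \<inter> U) g"
  shows "continuous_on S g"
  unfolding continuous_on_topological
proof (intro ballI allI impI)
  fix x B assume x: "x \<in> S" "open B" "g x \<in> B"
  obtain U where U: "open U" "x \<in> U" "continuous_on (S \<inter> U) g"
    using assms[OF x(1)] by blast
  then obtain V where V: "open V" "x \<in> V" "\<forall>y\<in>S \<inter> U. y \<in> V \<longrightarrow> g y \<in> B"
    using x unfolding continuous_on_topological by (metis IntI)
  then show "\<exists>A. open A \<and> x \<in> A \<and> (\<forall>y\<in>S. y \<in> A \<longrightarrow> g y \<in> B)"
    using U by (intro exI[of _ "U \<inter> V"]) auto
qed

lemma set_integrable_singleton: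
  fixes f :: "real \<Rightarrow> complex"
  shows "set_integrable lborel {x} f"
proof -
  have "(\<lambda>y. indicator {x} y *\<^sub>R f y) = (\<lambda>y. indicator {x} y *\<^sub>R f x)"
    by (auto simp: indicator_def)
  then show ?thesis
    unfolding set_integrable_def by simp
qed

lemma set_integrable_closed_segment:
  fixes f g :: "real \<Rightarrow> complex"
  assumes "continuous_on {a..b} g" "\<And>t. t \<in> {a<..<b} \<Longrightarrow> f t = g t" "a \<le> b"
  shows "set_integrable lborel {a..b} f"
proof -
  have "set_integrable lborel {a<..<b} g"
    by (rule set_integrable_subset[OF borel_integrable_atLeastAtMost'[OF assms(1)]]) auto
  then have "set_integrable lborel {a<..<b} f"
    by (subst set_integrable_cong[OF HOL.refl HOL.refl assms(2)]) auto
  then have "set_integrable lborel ({a<..<b} \<union> {a} \<union> {b}) f"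
    by (intro set_integrable_Un set_integrable_singleton) auto
  moreover have "{a<..<b} \<union> {a} \<union> {b} = {a..b}"
    using assms(3) by auto
  ultimately show ?thesis
    by simp
qed

context surface
begin

lemma coordinate_differential:
  assumes "d \<in> A" "x \<in> fst d"
  shows "has_differential A (snd d) x (\<lambda>c. deriv (transition c d) (snd c x))"
  unfolding has_differential_def
proof (intro ballI impI)
  fix c assume "c \<in> A" "x \<in> fst c"
  from transition_has_derivative[OF assms(1) this(1) assms(2) this(2)]
  show "((\<lambda>z. snd d (chart_inv c z)) has_field_derivative deriv (transition c d) (snd c x)) (at (snd c x))"
    by (simp add: transition_def o_def)
qed

text \<open>The value of a form on the velocity of a path does not depend on the chart.\<close>
lemma velocity_pairing:
  assumes \<omega>: "meromorphic_form A \<omega>" and c: "c \<in> A" "\<gamma> t \<in> fst c" and d: "d \<in> A" "\<gamma> t \<in> fst d"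
    and t: "t \<in> T" and cont: "continuous_on T \<gamma>"
    and v: "((snd c \<circ> \<gamma>) has_vector_derivative v) (at t within T)"
  obtains v' where "((snd d \<circ> \<gamma>) has_vector_derivative v') (at t within T)"
    "form_at \<omega> (\<gamma> t) d * v' = form_at \<omega> (\<gamma> t) c * v"
proof -
  have "((\<lambda>t. snd d (\<gamma> t)) has_vector_derivative deriv (transition c d) (snd c (\<gamma> t)) * v) (at t within T)"
    by (rule has_differential_along[OF coordinate_differential[OF d] c t cont v])
  moreover have "snd c (\<gamma> t) \<in> snd c ` (fst c \<inter> fst d)"
    using c d by blast
  from \<omega>[unfolded meromorphic_form_def, THEN conjunct2, rule_format, OF c(1) d(1) this]
  have "form_at \<omega> (\<gamma> t) c = form_at \<omega> (\<gamma> t) d * deriv (transition c d) (snd c (\<gamma> t))"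
    using c by simp
  ultimately show thesis
    using that by (simp add: o_def mult.assoc)
qed

text \<open>The chart used by \<^const>\<open>pullback_coeff\<close> jumps arbitrarily along the path. Since the value does
  not depend on it, the coefficient still agrees in the interior of a smooth segment with a function
  that is continuous on the closed segment, hence integrable.\<close>
lemma pullback_on_segment:
  assumes \<omega>: "meromorphic_form A \<omega>" and \<gamma>: "continuous_on {0..1} \<gamma>" "\<gamma> ` {0..1} \<inter> form_poles A \<omega> = {}"
    and ab: "a < b" "{a..b} \<subseteq> {0..1}" and C1: "C1_on_segment A \<gamma> {a..b}"
  shows "set_integrable lborel {a..b} (pullback_coeff A \<gamma> \<omega>)" (is ?integrable)
    and "\<And>t c. t \<in> {a<..<b} \<Longrightarrow> c \<in> A \<Longrightarrow> \<gamma> t \<in> fst c \<Longrightarrow>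
      \<exists>v. ((snd c \<circ> \<gamma>) has_vector_derivative v) (at t) \<and> pullback_coeff A \<gamma> \<omega> t = form_at \<omega> (\<gamma> t) c * v"
proof -
  have cont: "continuous_on {a..b} \<gamma>"
    using continuous_on_subset[OF \<gamma>(1) ab(2)] .
  have "\<forall>c\<in>A. \<exists>D. continuous_on ({a..b} \<inter> \<gamma> -` fst c) D \<and>
      (\<forall>t \<in> {a..b} \<inter> \<gamma> -` fst c. ((snd c \<circ> \<gamma>) has_vector_derivative D t) (at t within {a..b}))"
    using C1 unfolding C1_on_segment_def .
  from bchoice[OF this] obtain D where
    D0: "\<forall>c\<in>A. continuous_on ({a..b} \<inter> \<gamma> -` fst c) (D c) \<and>
      (\<forall>t \<in> {a..b} \<inter> \<gamma> -` fst c. ((snd c \<circ> \<gamma>) has_vector_derivative D c t) (at t within {a..b}))"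
    by (rule exE)
  have D: "continuous_on ({a..b} \<inter> \<gamma> -` fst c) (D c)"
    "t \<in> {a..b} \<Longrightarrow> \<gamma> t \<in> fst c \<Longrightarrow> ((snd c \<circ> \<gamma>) has_vector_derivative D c t) (at t within {a..b})"
    if "c \<in> A" for c t
    using bspec[OF D0 that] by simp_all
  define g where "g t = form_at \<omega> (\<gamma> t) (chart_at A (\<gamma> t)) * D (chart_at A (\<gamma> t)) t" for t
  have g: "g t = form_at \<omega> (\<gamma> t) c * D c t" if c: "c \<in> A" "t \<in> {a..b}" "\<gamma> t \<in> fst c" for c t
  proof -
    let ?d = "chart_at A (\<gamma> t)"
    obtain v' where v': "((snd c \<circ> \<gamma>) has_vector_derivative v') (at t within {a..b})"
      "form_at \<omega> (\<gamma> t) c * v' = form_at \<omega> (\<gamma> t) ?d * D ?d t"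
      by (rule velocity_pairing[OF \<omega> chart_at c(1,3,2) cont D(2)[OF chart_at(1) c(2) chart_at(2)]])
    have "v' = D c t"
      using vector_derivative_within_closed_interval[OF ab(1) c(2)] v'(1) D(2)[OF c] by metis
    with v'(2) show ?thesis
      by (simp add: g_def)
  qed
  have "continuous_on {a..b} g"
  proof (rule continuous_on_locally)
    fix t assume t: "t \<in> {a..b}"
    obtain c where c: "c \<in> A" "\<gamma> t \<in> fst c"
      using ex_chart by blast
    obtain U where U: "open U" "U \<inter> {a..b} = \<gamma> -` fst c \<inter> {a..b}"
      using cont open_chart_domain[OF c(1)] by (metis continuous_on_open_invariant)
    have S: "{a..b} \<inter> U = {a..b} \<inter> \<gamma> -` fst c"
      using U(2) by blast
    have "continuous_on ({a..b} \<inter> U) (\<lambda>t. form_at \<omega> (\<gamma> t) c * D c t)"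
    proof (rule continuous_on_mult)
      show "continuous_on ({a..b} \<inter> U) (D c)"
        using D(1)[OF c(1)] S by simp
      have "\<omega> c analytic_on {snd c (\<gamma> s)}" if "s \<in> {a..b} \<inter> U" for s
        using that S \<gamma>(2) ab(2) by (intro analytic_off_poles[OF \<omega> _ c(1)]) blast+
      then have "isCont (\<omega> c) z" if "z \<in> (\<lambda>s. snd c (\<gamma> s)) ` ({a..b} \<inter> U)" for z
        using that analytic_at_imp_isCont by blast
      then have "continuous_on ((\<lambda>s. snd c (\<gamma> s)) ` ({a..b} \<inter> U)) (\<omega> c)"
        by (intro continuous_at_imp_continuous_on) blast
      moreover have "continuous_on ({a..b} \<inter> U) (\<lambda>s. snd c (\<gamma> s))"
        by (rule continuous_on_compose2[OF continuous_on_coord[OF c(1)]])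
          (use S cont continuous_on_subset in \<open>blast+\<close>)
      ultimately show "continuous_on ({a..b} \<inter> U) (\<lambda>t. form_at \<omega> (\<gamma> t) c)"
        by (rule continuous_on_compose2) simp
    qed
    then have "continuous_on ({a..b} \<inter> U) g"
      by (rule continuous_on_eq) (use S g[OF c(1)] in auto)
    then show "\<exists>U. open U \<and> t \<in> U \<and> continuous_on ({a..b} \<inter> U) g"
      using U(1) S t c(2) by blast
  qed
  moreover have inner: "((snd c \<circ> \<gamma>) has_vector_derivative D c t) (at t) \<and>
      pullback_coeff A \<gamma> \<omega> t = g t" if "t \<in> {a<..<b}" "c \<in> A" "\<gamma> t \<in> fst c" for t c
  proof -
    have at: "at t within {a..b} = at t"
      using that(1) by (intro at_within_interior) auto
    have t: "t \<in> {a..b}"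
      using that(1) by auto
    let ?d = "chart_at A (\<gamma> t)"
    have "((snd ?d \<circ> \<gamma>) has_vector_derivative D ?d t) (at t)"
      using D(2)[OF chart_at(1) t chart_at(2)] at by simp
    then have "vector_derivative (snd ?d \<circ> \<gamma>) (at t within {0..1}) = D ?d t"
      using t ab by (intro vector_derivative_at_within_ivl) auto
    then have "pullback_coeff A \<gamma> \<omega> t = g t"
      by (simp add: pullback_coeff_def g_def Let_def)
    then show ?thesis
      using D(2)[OF that(2) t that(3)] at by simp
  qed
  ultimately show ?integrable
    using ab(1) inner[OF _ chart_at] by (intro set_integrable_closed_segment[of a b g]) auto
  show "\<exists>v. ((snd c \<circ> \<gamma>) has_vector_derivative v) (at t) \<and> pullback_coeff A \<gamma> \<omega> t = form_at \<omega> (\<gamma> t) c * v"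
    if "t \<in> {a<..<b}" "c \<in> A" "\<gamma> t \<in> fst c" for t c
    using inner[OF that] g[OF that(2) _ that(3)] that(1) by auto
qed

text \<open>One finite set of break points serves all forms at once.\<close>
lemma piecewise_smooth_pullback:
  assumes \<gamma>: "piecewise_smooth_path A \<gamma>"
  shows "\<exists>K. finite K \<and> (\<forall>\<omega>. meromorphic_form A \<omega> \<longrightarrow> path_image \<gamma> \<inter> form_poles A \<omega> = {} \<longrightarrow>
    set_integrable lborel {0..1} (pullback_coeff A \<gamma> \<omega>) \<and>
    (\<forall>t \<in> {0<..<1} - K. \<forall>c\<in>A. \<gamma> t \<in> fst c \<longrightarrow>
      (\<exists>v. ((snd c \<circ> \<gamma>) has_vector_derivative v) (at t) \<and>
        pullback_coeff A \<gamma> \<omega> t = form_at \<omega> (\<gamma> t) c * v)))"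
proof -
  obtain n :: nat and s where s: "s 0 = (0::real)" "s n = 1"
    "\<And>i. i < n \<Longrightarrow> s i < s (Suc i)" "\<And>i. i < n \<Longrightarrow> C1_on_segment A \<gamma> {s i..s (Suc i)}"
    using \<gamma> unfolding piecewise_smooth_path_def by blast
  have cont: "continuous_on {0..1} \<gamma>"
    using \<gamma> by (simp add: piecewise_smooth_path_def path_def)
  have mono: "s i \<le> s j" if "i \<le> j" "j \<le> n" for i j
    using that
  proof (induction j)
    case (Suc j)
    then show ?case
      using s(3)[of j] by (cases "i = Suc j") force+
  qed simp
  have seg: "{s i..s (Suc i)} \<subseteq> {0..1}" if "i < n" for i
    using mono[of 0 i] mono[of "Suc i" n] s that by auto
  have integrable: "set_integrable lborel {0..s i} (pullback_coeff A \<gamma> \<omega>)"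
    if \<omega>: "meromorphic_form A \<omega>" "path_image \<gamma> \<inter> form_poles A \<omega> = {}" and "i \<le> n" for \<omega> i
    using \<open>i \<le> n\<close>
  proof (induction i)
    case 0
    then show ?case
      using s(1) set_integrable_singleton by simp
  next
    case (Suc i)
    then have "set_integrable lborel ({0..s i} \<union> {s i..s (Suc i)}) (pullback_coeff A \<gamma> \<omega>)"
      using pullback_on_segment(1)[OF \<omega>(1) cont \<omega>(2)[unfolded path_image_def] s(3) seg s(4)]
      by (intro set_integrable_Un) auto
    moreover have "{0..s i} \<union> {s i..s (Suc i)} = {0..s (Suc i)}"
      using mono[of 0 i] mono[of i "Suc i"] Suc.prems s(1) by auto
    ultimately show ?case
      by simp
  qed
  have cover: "\<exists>j<i. t \<in> {s j<..<s (Suc j)}" if "t \<in> {0<..<s i} - s ` {..n}" "i \<le> n" for t i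
    using that
  proof (induction i)
    case 0
    then show ?case
      using s(1) by simp
  next
    case (Suc i)
    show ?case
    proof (cases "t < s i")
      case True
      then show ?thesis
        using Suc by (metis DiffD2 DiffI Suc_leD greaterThanLessThan_iff less_Suc_eq DiffD1)
    next
      case False
      then have "t > s i"
        using Suc.prems by force
      then show ?thesis
        using Suc.prems by auto
    qed
  qed
  show ?thesis
  proof (intro exI[of _ "s ` {..n}"] conjI allI impI ballI)
    show "set_integrable lborel {0..1} (pullback_coeff A \<gamma> \<omega>)"
      if "meromorphic_form A \<omega>" "path_image \<gamma> \<inter> form_poles A \<omega> = {}" for \<omega>
      using integrable[OF that order_refl] s(2) by simp
    fix \<omega> t c
    assume \<omega>: "meromorphic_form A \<omega>" "path_image \<gamma> \<inter> form_poles A \<omega> = {}"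
      and t: "t \<in> {0<..<1} - s ` {..n}" and c: "c \<in> A" "\<gamma> t \<in> fst c"
    obtain j where j: "j < n" "t \<in> {s j<..<s (Suc j)}"
      using cover[of t n] t s(2) by auto
    from pullback_on_segment(2)[OF \<omega>(1) cont \<omega>(2)[unfolded path_image_def] s(3)[OF j(1)] seg[OF j(1)] s(4)[OF j(1)] j(2) c]
    show "\<exists>v. ((snd c \<circ> \<gamma>) has_vector_derivative v) (at t) \<and> pullback_coeff A \<gamma> \<omega> t = form_at \<omega> (\<gamma> t) c * v" .
  qed simp
qed

lemma piecewise_smooth_reversepath:
  assumes "piecewise_smooth_path A \<gamma>"
  shows "piecewise_smooth_path A (reversepath \<gamma>)"
proof -
  obtain n :: nat and s where s: "s 0 = (0::real)" "s n = 1"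
    "\<And>i. i < n \<Longrightarrow> s i < s (Suc i)" "\<And>i. i < n \<Longrightarrow> C1_on_segment A \<gamma> {s i..s (Suc i)}"
    using assms unfolding piecewise_smooth_path_def by blast
  have rev: "C1_on_segment A (reversepath \<gamma>) {1 - b..1 - a}" if C1: "C1_on_segment A \<gamma> {a..b}" for a b
    unfolding C1_on_segment_def
  proof
    fix c assume "c \<in> A"
    then obtain D where D: "continuous_on ({a..b} \<inter> \<gamma> -` fst c) D"
      "\<And>t. t \<in> {a..b} \<inter> \<gamma> -` fst c \<Longrightarrow> ((snd c \<circ> \<gamma>) has_vector_derivative D t) (at t within {a..b})"
      using bspec[OF C1[unfolded C1_on_segment_def]] by blast
    have im: "(\<lambda>t. 1 - t) ` {1 - b..1 - a} = {a..b}"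
      by (auto intro!: image_eqI[of _ _ "1 - _"])
    show "\<exists>D. continuous_on ({1 - b..1 - a} \<inter> reversepath \<gamma> -` fst c) D \<and>
       (\<forall>t\<in>{1 - b..1 - a} \<inter> reversepath \<gamma> -` fst c.
          ((snd c \<circ> reversepath \<gamma>) has_vector_derivative D t) (at t within {1 - b..1 - a}))"
    proof (intro exI[of _ "\<lambda>t. - D (1 - t)"] conjI ballI)
      show "continuous_on ({1 - b..1 - a} \<inter> reversepath \<gamma> -` fst c) (\<lambda>t. - D (1 - t))"
        by (intro continuous_on_minus continuous_on_compose2[OF D(1)] continuous_intros)
          (auto simp: reversepath_def)
      fix t assume t: "t \<in> {1 - b..1 - a} \<inter> reversepath \<gamma> -` fst c"
      have "((\<lambda>t. 1 - t) has_vector_derivative -1) (at t within {1 - b..1 - a})"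
        by (auto intro!: derivative_eq_intros)
      moreover have "((snd c \<circ> \<gamma>) has_vector_derivative D (1 - t)) (at (1 - t) within (\<lambda>t. 1 - t) ` {1 - b..1 - a})"
        unfolding im using t by (intro D(2)) (auto simp: reversepath_def)
      ultimately show "((snd c \<circ> reversepath \<gamma>) has_vector_derivative - D (1 - t)) (at t within {1 - b..1 - a})"
        using vector_diff_chain_within[of "\<lambda>t. 1 - t" "-1"] by (fastforce simp: reversepath_def o_def)
    qed
  qed
  define s' where "s' i = 1 - s (n - i)" for i
  have "s' i < s' (Suc i) \<and> C1_on_segment A (reversepath \<gamma>) {s' i..s' (Suc i)}" if "i < n" for i
  proof -
    have "n - i = Suc (n - Suc i)" "n - Suc i < n"
      using that by auto
    then show ?thesis
      using s(3)[of "n - Suc i"] rev[OF s(4)[of "n - Suc i"]] by (simp add: s'_def)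
  qed
  moreover have "s' 0 = 0" "s' n = 1"
    using s by (simp_all add: s'_def)
  ultimately show ?thesis
    using assms unfolding piecewise_smooth_path_def
    by (intro conjI exI[of _ n] exI[of _ s']) auto
qed

end

lemma (in surface) has_differential_imp_isCont:
  assumes "has_differential A f x \<eta>"
  shows "isCont f x"
proof -
  obtain c where c: "c \<in> A" "x \<in> fst c"
    using ex_chart by blast
  have "isCont (snd c) x"
    using continuous_on_eq_continuous_at[OF open_chart_domain[OF c(1)]] continuous_on_coord[OF c(1)] c(2)
    by blast
  moreover have "isCont (\<lambda>z. f (chart_inv c z)) (snd c x)"
    by (rule DERIV_isCont[OF assms[unfolded has_differential_def, rule_format, OF c]])
  ultimately have cont: "isCont (\<lambda>y. f (chart_inv c (snd c y))) x"
    by (rule isCont_o2)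
  have "eventually (\<lambda>y. f (chart_inv c (snd c y)) = f y) (at x)"
    using eventually_at_in_open'[OF open_chart_domain[OF c(1)] c(2)]
    by eventually_elim (use c(1) in simp)
  from tendsto_cong[OF this, of "f x"] show ?thesis
    using cont c by (simp add: isCont_def)
qed

context flat_connection
begin

lemma transports_continuous:
  assumes h: "transports T u h" and u: "continuous_on T u" and e: "e \<in> {e12, e23, e34, e13, e24, e14}"
  shows "continuous_on T (\<lambda>t. e (h t))"
proof (rule continuous_on_locally)
  fix t assume t: "t \<in> T"
  obtain U N M where *: "open U" "t \<in> U" "solves N M" "\<And>s. s \<in> T \<Longrightarrow> s \<in> U \<Longrightarrow> u s \<in> N"
    "\<And>s. s \<in> T \<Longrightarrow> s \<in> U \<Longrightarrow> h s = M (u s)"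
    by (rule transportsE[OF h t]) blast
  have "isCont (\<lambda>x. e (M x)) x" if "x \<in> N" for x
  proof -
    note D = solves_D[OF *(3) that, THEN has_differential_imp_isCont]
    from e have "e = e12 \<or> e = e23 \<or> e = e34 \<or> e = e13 \<or> e = e24 \<or> e = e14"
      by simp
    then show ?thesis
      by (elim disjE; hypsubst; intro D)
  qed
  then have "continuous_on N (\<lambda>x. e (M x))"
    by (intro continuous_at_imp_continuous_on) blast
  moreover have "continuous_on (T \<inter> U) u"
    using u by (rule continuous_on_subset) blast
  ultimately have "continuous_on (T \<inter> U) (\<lambda>t. e (M (u t)))"
    by (rule continuous_on_compose2) (use *(4) in blast)
  then have "continuous_on (T \<inter> U) (\<lambda>t. e (h t))"
    by (rule continuous_on_eq) (use *(5) in simp)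
  with *(1,2) show "\<exists>U. open U \<and> t \<in> U \<and> continuous_on (T \<inter> U) (\<lambda>t. e (h t))"
    by blast
qed

lemma transports_has_derivative:
  assumes h: "transports T \<gamma> h" and \<gamma>: "continuous_on T \<gamma>" and t: "t \<in> T" and c: "c \<in> A" "\<gamma> t \<in> fst c"
    and v: "((snd c \<circ> \<gamma>) has_vector_derivative v) (at t within T)"
  shows
    "((\<lambda>t. e12 (h t)) has_vector_derivative form_at (w 1) (\<gamma> t) c * v) (at t within T)"
    "((\<lambda>t. e23 (h t)) has_vector_derivative form_at (w 2) (\<gamma> t) c * v) (at t within T)"
    "((\<lambda>t. e34 (h t)) has_vector_derivative form_at (w 3) (\<gamma> t) c * v) (at t within T)"
    "((\<lambda>t. e13 (h t)) has_vector_derivative e12 (h t) * form_at (w 2) (\<gamma> t) c * v) (at t within T)"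
    "((\<lambda>t. e24 (h t)) has_vector_derivative e23 (h t) * form_at (w 3) (\<gamma> t) c * v) (at t within T)"
    "((\<lambda>t. e14 (h t)) has_vector_derivative e13 (h t) * form_at (w 3) (\<gamma> t) c * v) (at t within T)"
proof -
  obtain U N M where *: "open U" "t \<in> U" "solves N M" "\<And>s. s \<in> T \<Longrightarrow> s \<in> U \<Longrightarrow> \<gamma> s \<in> N"
    "\<And>s. s \<in> T \<Longrightarrow> s \<in> U \<Longrightarrow> h s = M (\<gamma> s)"
    by (rule transportsE[OF h t]) blast
  have "\<gamma> t \<in> N" and ht: "M (\<gamma> t) = h t"
    using *(2,4,5) t by simp_all
  note D = solves_D[OF *(3) \<open>\<gamma> t \<in> N\<close>, THEN has_differential_along[OF _ c t \<gamma> v], unfolded ht]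
  note transform = has_vector_derivative_transform_local[OF _ *(1,2) t]
  show "((\<lambda>t. e12 (h t)) has_vector_derivative form_at (w 1) (\<gamma> t) c * v) (at t within T)"
    "((\<lambda>t. e23 (h t)) has_vector_derivative form_at (w 2) (\<gamma> t) c * v) (at t within T)"
    "((\<lambda>t. e34 (h t)) has_vector_derivative form_at (w 3) (\<gamma> t) c * v) (at t within T)"
    "((\<lambda>t. e13 (h t)) has_vector_derivative e12 (h t) * form_at (w 2) (\<gamma> t) c * v) (at t within T)"
    "((\<lambda>t. e24 (h t)) has_vector_derivative e23 (h t) * form_at (w 3) (\<gamma> t) c * v) (at t within T)"
    "((\<lambda>t. e14 (h t)) has_vector_derivative e13 (h t) * form_at (w 3) (\<gamma> t) c * v) (at t within T)"
    by (rule transform[OF D(1)] transform[OF D(2)] transform[OF D(3)] transform[OF D(4)]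
        transform[OF D(5)] transform[OF D(6)]; simp add: *(5))+
qed

lemma transports_exists_normalized:
  assumes "path p" "path_image p \<subseteq> regular"
  obtains h where "transports {0..1} p h" "h 0 = 1" "holonomy p = h 1"
proof -
  obtain k where k: "transports {0..1} p k"
    using transports_exists_path[OF assms] by blast
  have "transports {0..1} p (\<lambda>t. uinv (k 0) * k t)"
    by (rule transports_mult_left[OF k])
  with holonomy_eq[OF assms(1) k] show thesis
    using that by simp
qed

text \<open>Each entry of the transport that starts at \<open>1\<close> is, off the break points, a primitive of the
  preceding entry times a pullback coefficient. For the last formula, \<open>e34 * e23 - e24\<close> has
  derivative \<open>e34\<close> times the coefficient of the second form.\<close>
lemma holonomy_entries:
  assumes \<gamma>: "piecewise_smooth_path A \<gamma>" and reg: "path_image \<gamma> \<subseteq> regular"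
  shows "e12 (holonomy \<gamma>) = iter_integral A \<gamma> [w 1]"
    "e23 (holonomy \<gamma>) = iter_integral A \<gamma> [w 2]"
    "e34 (holonomy \<gamma>) = iter_integral A \<gamma> [w 3]"
    "e13 (holonomy \<gamma>) = iter_integral A \<gamma> [w 1, w 2]"
    "e24 (holonomy \<gamma>) = iter_integral A \<gamma> [w 2, w 3]"
    "e34 (holonomy \<gamma>) * e23 (holonomy \<gamma>) - e24 (holonomy \<gamma>) = iter_integral A \<gamma> [w 3, w 2]"
proof -
  have path: "path \<gamma>" and cont: "continuous_on {0..1} \<gamma>"
    using \<gamma> by (simp_all add: piecewise_smooth_path_def path_def)
  have disj: "path_image \<gamma> \<inter> form_poles A (w i) = {}" if "i \<in> {1,2,3}" for i
    using reg that unfolding regular_def by blast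
  from piecewise_smooth_pullback[OF \<gamma>] obtain K where K: "finite K"
    "\<forall>\<omega>. meromorphic_form A \<omega> \<longrightarrow> path_image \<gamma> \<inter> form_poles A \<omega> = {} \<longrightarrow>
      set_integrable lborel {0..1} (pullback_coeff A \<gamma> \<omega>) \<and>
      (\<forall>t \<in> {0<..<1} - K. \<forall>c\<in>A. \<gamma> t \<in> fst c \<longrightarrow>
        (\<exists>v. ((snd c \<circ> \<gamma>) has_vector_derivative v) (at t) \<and>
          pullback_coeff A \<gamma> \<omega> t = form_at \<omega> (\<gamma> t) c * v))"
    by (elim exE conjE)
  note pullback = K(2)[rule_format, OF meromorphic disj]
  obtain h where h: "transports {0..1} \<gamma> h" "h 0 = 1" "holonomy \<gamma> = h 1"
    using transports_exists_normalized[OF path reg] by blast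
  define a where "a i = pullback_coeff A \<gamma> (w i)" for i
  have int: "set_integrable lborel {0..1} (a i)" if "i \<in> {1,2,3}" for i
    unfolding a_def by (rule pullback[OF that that, THEN conjunct1])
  note ch = transports_continuous[OF h(1) cont]
  have deriv: "((\<lambda>t. e12 (h t)) has_vector_derivative a 1 t) (at t) \<and>
    ((\<lambda>t. e23 (h t)) has_vector_derivative a 2 t) (at t) \<and>
    ((\<lambda>t. e34 (h t)) has_vector_derivative a 3 t) (at t) \<and>
    ((\<lambda>t. e13 (h t)) has_vector_derivative e12 (h t) * a 2 t) (at t) \<and>
    ((\<lambda>t. e24 (h t)) has_vector_derivative e23 (h t) * a 3 t) (at t)"
    if t: "t \<in> {0<..<1} - K" for t
  proof -
    let ?c = "chart_at A (\<gamma> t)"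
    have "\<exists>v. ((snd ?c \<circ> \<gamma>) has_vector_derivative v) (at t) \<and> a i t = form_at (w i) (\<gamma> t) ?c * v"
      if "i \<in> {1,2,3}" for i
      unfolding a_def by (rule pullback[OF that that, THEN conjunct2, rule_format, OF t chart_at])
    moreover define v where "v = vector_derivative (snd ?c \<circ> \<gamma>) (at t)"
    ultimately have v: "((snd ?c \<circ> \<gamma>) has_vector_derivative v) (at t)"
      and a: "\<And>i. i \<in> {1,2,3} \<Longrightarrow> a i t = form_at (w i) (\<gamma> t) ?c * v"
      using vector_derivative_at by (blast, blast)
    have at: "at t within {0..1} = at t"
      using t by (intro at_within_interior) auto
    have "t \<in> {0..1}"
      using t by auto
    from transports_has_derivative[OF h(1) cont this chart_at, unfolded at, OF v] show ?thesis
      by (simp add: a mult.assoc)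
  qed
  have one: "iter_integral A \<gamma> [w i] = f 1"
    if "i \<in> {1,2,3}" "continuous_on {0..1} f" "f 0 = 0"
      "\<And>t. t \<in> {0<..<1} - K \<Longrightarrow> (f has_vector_derivative a i t) (at t)" for i f
  proof -
    have "iter_integral A \<gamma> [w i] = (LINT t:time_simplex 1|PiM {..<1} (\<lambda>_. lborel). a i (t 0))"
      by (simp add: iter_integral_def a_def)
    also have "\<dots> = (LINT s:{0..1}|lborel. a i s)"
      by (rule time_simplex_integral_1[OF int[OF that(1)]])
    also have "\<dots> = f 1"
      using integral_of_derivative_off_finite[OF that(2) K(1) that(4) int[OF that(1)], of 1] that(3)
      by simp
    finally show ?thesis .
  qed
  have two: "iter_integral A \<gamma> [w i, w j] = F 1"
    if "i \<in> {1,2,3}" "j \<in> {1,2,3}" "continuous_on {0..1} f" "continuous_on {0..1} F" "f 0 = 0" "F 0 = 0"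
      "\<And>t. t \<in> {0<..<1} - K \<Longrightarrow> (f has_vector_derivative a i t) (at t)"
      "\<And>t. t \<in> {0<..<1} - K \<Longrightarrow> (F has_vector_derivative f t * a j t) (at t)" for i j f F
  proof -
    have "{..<2::nat} = {0, 1}"
      by auto
    then have "iter_integral A \<gamma> [w i, w j] =
        (LINT t:time_simplex 2|PiM {..<2} (\<lambda>_. lborel). a i (t 0) * a j (t 1))"
      by (simp add: iter_integral_def a_def numeral_2_eq_2)
    also have "\<dots> = F 1"
      by (rule iterated_integral_primitives[OF K(1) that(3-8) int[OF that(1)] int[OF that(2)]])
    finally show ?thesis .
  qed
  show "e12 (holonomy \<gamma>) = iter_integral A \<gamma> [w 1]"
    using one[of 1 "\<lambda>t. e12 (h t)"] ch[of e12] deriv h by simp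
  show "e23 (holonomy \<gamma>) = iter_integral A \<gamma> [w 2]"
    using one[of 2 "\<lambda>t. e23 (h t)"] ch[of e23] deriv h by simp
  show "e34 (holonomy \<gamma>) = iter_integral A \<gamma> [w 3]"
    using one[of 3 "\<lambda>t. e34 (h t)"] ch[of e34] deriv h by simp
  show "e13 (holonomy \<gamma>) = iter_integral A \<gamma> [w 1, w 2]"
    using two[of 1 2 "\<lambda>t. e12 (h t)" "\<lambda>t. e13 (h t)"] ch[of e12] ch[of e13] deriv h by simp
  show "e24 (holonomy \<gamma>) = iter_integral A \<gamma> [w 2, w 3]"
    using two[of 2 3 "\<lambda>t. e23 (h t)" "\<lambda>t. e24 (h t)"] ch[of e23] ch[of e24] deriv h by simp
  have "((\<lambda>t. e34 (h t) * e23 (h t) - e24 (h t)) has_vector_derivative e34 (h t) * a 2 t) (at t)"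
    if "t \<in> {0<..<1} - K" for t
    using deriv[OF that] by (auto intro!: derivative_eq_intros simp: algebra_simps)
  moreover have "continuous_on {0..1} (\<lambda>t. e34 (h t) * e23 (h t) - e24 (h t))"
    by (intro continuous_intros ch) auto
  ultimately show "e34 (holonomy \<gamma>) * e23 (holonomy \<gamma>) - e24 (holonomy \<gamma>) = iter_integral A \<gamma> [w 3, w 2]"
    using two[of 3 2 "\<lambda>t. e34 (h t)" "\<lambda>t. e34 (h t) * e23 (h t) - e24 (h t)"] ch[of e34] deriv h
    by simp
qed

end

section \<open>Residues of forms of the third kind\<close>

lemma simple_pole_limit:
  assumes f: "f meromorphic_on {z}" and pole: "is_pole f z" "zorder f z = -1"
  shows "((\<lambda>w. f w * (w - z)) \<longlongrightarrow> residue f z) (at z)"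
proof -
  have iso: "isolated_singularity_at f z" and ness: "not_essential f z"
    using f meromorphic_on_isolated_singularity meromorphic_on_not_essential by blast+
  have "eventually (\<lambda>w. f w \<noteq> 0) (at z)"
    using non_zero_neighbour_pole[OF pole(1)] .
  then have "frequently (\<lambda>w. f w \<noteq> 0) (at z)"
    by (intro eventually_frequently) auto
  from zorder_exist[OF iso ness this] obtain r where r: "r > 0" "zor_poly f z holomorphic_on cball z r"
    "\<And>w. w \<in> cball z r - {z} \<Longrightarrow> f w = zor_poly f z w * (w - z) powi (-1)"
    unfolding pole(2) by blast
  have "isCont (zor_poly f z) z"
    using holomorphic_on_imp_continuous_on[OF r(2)] r(1) continuous_on_interior
    by (metis centre_in_ball interior_cball)
  then have lim: "(zor_poly f z \<longlongrightarrow> residue f z) (at z)"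
    using residue_simple_pole[OF iso pole] by (simp add: isCont_def)
  have "eventually (\<lambda>w. w \<in> ball z r - {z}) (at z)"
    using eventually_at_ball'[OF r(1), of z UNIV] by eventually_elim auto
  then have "eventually (\<lambda>w. zor_poly f z w = f w * (w - z)) (at z)"
    by eventually_elim (use r(3) in \<open>auto simp: power_int_minus divide_simps\<close>)
  with lim show ?thesis
    by (rule Lim_transform_eventually)
qed

text \<open>Cauchy's integral formula for \<open>(\<lambda>w. f w * (w - z) * n w)\<close>, whose singularity at \<open>z\<close> is
  removable. On the boundary circle, continuity of \<open>n\<close> suffices.\<close>
lemma simple_pole_circle_integral:
  assumes f: "f meromorphic_on {z}" "is_pole f z" "zorder f z = -1"
    and an: "\<And>w. w \<in> cball z \<rho> - {z} \<Longrightarrow> f analytic_on {w}" and "\<rho> > 0"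
    and n: "continuous_on (cball z \<rho>) n" "n holomorphic_on ball z \<rho>"
  shows "((\<lambda>w. f w * n w) has_contour_integral 2 * of_real pi * \<i> * (residue f z * n z)) (circlepath z \<rho>)"
proof -
  define g where "g w = (if w = z then residue f z else f w * (w - z))" for w
  have g_off: "isCont g w" "w \<noteq> z \<Longrightarrow> g field_differentiable at w" if "w \<in> cball z \<rho>" for w
  proof -
    have *: "g field_differentiable at w" if "w \<noteq> z"
    proof -
      have "f field_differentiable at w"
        using an[of w] \<open>w \<in> cball z \<rho>\<close> \<open>w \<noteq> z\<close> analytic_on_imp_differentiable_at by blast
      then have "(\<lambda>w. f w * (w - z)) field_differentiable at w"
        by (intro derivative_intros)
      then obtain D where D: "((\<lambda>w. f w * (w - z)) has_field_derivative D) (at w)"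
        unfolding field_differentiable_def by blast
      have "(g has_field_derivative D) (at w)"
        by (rule has_field_derivative_transform_within_open[OF D, of "- {z}"])
          (use \<open>w \<noteq> z\<close> in \<open>auto simp: g_def\<close>)
      then show ?thesis
        unfolding field_differentiable_def by blast
    qed
    show "w \<noteq> z \<Longrightarrow> g field_differentiable at w"
      by (rule *)
    show "isCont g w"
    proof (cases "w = z")
      case True
      have "eventually (\<lambda>w. f w * (w - z) = g w) (at z)"
        by (auto simp: g_def eventually_at_filter)
      from Lim_transform_eventually[OF simple_pole_limit[OF f] this]
      have "(g \<longlongrightarrow> g z) (at z)"
        by (simp add: g_def[of z])
      then show ?thesis
        using True by (simp add: isCont_def)
    next
      case False
      then show ?thesis
        using * field_differentiable_imp_continuous_at by blast
    qed
  qed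
  have "continuous_on (cball z \<rho>) g"
    using g_off(1) by (intro continuous_at_imp_continuous_on) blast
  moreover have "g holomorphic_on ball z \<rho>"
  proof (rule no_isolated_singularity[of _ _ "{z}"])
    show "continuous_on (ball z \<rho>) g"
      using calculation continuous_on_subset ball_subset_cball by blast
    show "g holomorphic_on ball z \<rho> - {z}"
      unfolding holomorphic_on_def
    proof
      fix w assume "w \<in> ball z \<rho> - {z}"
      then show "g field_differentiable at w within ball z \<rho> - {z}"
        using field_differentiable_at_within[OF g_off(2)[of w]] by simp
    qed
  qed auto
  ultimately have "((\<lambda>w. g w * n w / (w - z)) has_contour_integral 2 * of_real pi * \<i> * (g z * n z)) (circlepath z \<rho>)"
    using n \<open>\<rho> > 0\<close> by (intro Cauchy_integral_circlepath continuous_intros holomorphic_intros) auto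
  then have "((\<lambda>w. f w * n w) has_contour_integral 2 * of_real pi * \<i> * (g z * n z)) (circlepath z \<rho>)"
    by (rule has_contour_integral_eq) (use \<open>\<rho> > 0\<close> in \<open>auto simp: g_def path_image_circlepath\<close>)
  then show ?thesis
    by (simp add: g_def)
qed

context surface
begin

lemma transition_facts:
  assumes "c \<in> A" "d \<in> A" "x \<in> fst c" "x \<in> fst d"
  defines "W \<equiv> snd c ` (fst c \<inter> fst d)" and "T \<equiv> transition c d"
  shows "open W" "snd c x \<in> W" "T holomorphic_on W" "inj_on T W" "deriv T (snd c x) \<noteq> 0"
    "isCont T (snd c x)" "T (snd c x) = snd d x" "isCont (deriv T) (snd c x)"
proof -
  show W: "open W" "snd c x \<in> W"
    unfolding W_def using assms by (auto intro!: open_coord_image open_Int open_chart_domain)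
  show T: "T holomorphic_on W"
    using riemann assms(1,2) unfolding riemann_surface_def W_def T_def by blast
  show "T (snd c x) = snd d x"
    using assms by (simp add: T_def)
  show inj: "inj_on T W"
  proof (rule inj_onI)
    fix z z' assume "z \<in> W" "z' \<in> W" and eq: "T z = T z'"
    then obtain y y' where y: "y \<in> fst c" "y \<in> fst d" "z = snd c y" "y' \<in> fst c" "y' \<in> fst d" "z' = snd c y'"
      unfolding W_def by blast
    then have "chart_inv d (snd d y) = chart_inv d (snd d y')"
      using eq assms(1) by (simp add: T_def)
    then show "z = z'"
      using y assms(2) by simp
  qed
  show "deriv T (snd c x) \<noteq> 0"
    by (rule holomorphic_injective_imp_regular[OF T W(1) inj W(2)])
  show "isCont T (snd c x)"
    using T W holomorphic_on_imp_continuous_on continuous_on_eq_continuous_at by blast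
  show "isCont (deriv T) (snd c x)"
    using holomorphic_deriv[OF T W(1)] W holomorphic_on_imp_continuous_on continuous_on_eq_continuous_at
    by blast
qed

lemma form_change_chart:
  assumes "meromorphic_form A \<omega>" "c \<in> A" "d \<in> A" "z \<in> snd c ` (fst c \<inter> fst d)"
  shows "\<omega> c z = \<omega> d (transition c d z) * deriv (transition c d) z"
  using assms(1)[unfolded meromorphic_form_def, THEN conjunct2, rule_format, OF assms(2-4)] .

lemma form_meromorphic_at:
  assumes "meromorphic_form A \<omega>" "c \<in> A" "x \<in> fst c"
  shows "\<omega> c meromorphic_on {snd c x}"
proof -
  have "\<omega> c nicely_meromorphic_on snd c ` fst c"
    using assms(1,2) unfolding meromorphic_form_def by blast
  then have "\<omega> c meromorphic_on snd c ` fst c"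
    by (simp add: nicely_meromorphic_on_def)
  then show ?thesis
    by (rule meromorphic_on_subset) (use assms(3) in blast)
qed

lemma pole_in_every_chart:
  assumes \<omega>: "meromorphic_form A \<omega>" and x: "x \<in> form_poles A \<omega>" and d: "d \<in> A" "x \<in> fst d"
  shows "is_pole (\<omega> d) (snd d x)"
proof (rule ccontr)
  assume no: "\<not> is_pole (\<omega> d) (snd d x)"
  obtain c where c: "c \<in> A" "x \<in> fst c" "is_pole (\<omega> c) (snd c x)"
    using x unfolding form_poles_def by blast
  note T = transition_facts[OF c(1) d(1) c(2) d(2)]
  have "\<omega> d nicely_meromorphic_on snd d ` fst d"
    using \<omega> d(1) unfolding meromorphic_form_def by blast
  then have "\<omega> d analytic_on {snd d x}"
    using nicely_meromorphic_on_imp_analytic_at no d(2) by blast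
  then have "isCont (\<omega> d) (transition c d (snd c x))"
    using T(7) analytic_at_imp_isCont by simp
  then have "isCont (\<lambda>z. \<omega> d (transition c d z)) (snd c x)"
    using T(6) isCont_o2 by blast
  with T(8) have "isCont (\<lambda>z. \<omega> d (transition c d z) * deriv (transition c d) z) (snd c x)"
    by (intro continuous_intros)
  then have lim: "((\<lambda>z. \<omega> d (transition c d z) * deriv (transition c d) z) \<longlongrightarrow>
      \<omega> d (transition c d (snd c x)) * deriv (transition c d) (snd c x)) (at (snd c x))"
    by (simp add: isCont_def)
  have "eventually (\<lambda>z. z \<in> snd c ` (fst c \<inter> fst d)) (at (snd c x))"
    using T(1,2) by (rule eventually_at_in_open')
  then have "eventually (\<lambda>z. \<omega> d (transition c d z) * deriv (transition c d) z = \<omega> c z) (at (snd c x))"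
    by eventually_elim (use form_change_chart[OF \<omega> c(1) d(1)] in simp)
  from Lim_transform_eventually[OF lim this] show False
    using c(3) not_tendsto_and_filterlim_at_infinity unfolding is_pole_def by (metis at_neq_bot)
qed

text \<open>For a simple pole the residue is the limit of \<open>\<omega> c w * (w - z)\<close>. Under a change of chart the
  difference quotient of the transition map and its derivative cancel in the limit.\<close>
lemma residue_change_chart:
  assumes \<omega>: "third_kind_form A \<omega>" and x: "x \<in> form_poles A \<omega>"
    and c: "c \<in> A" "x \<in> fst c" and d: "d \<in> A" "x \<in> fst d"
  shows "residue (\<omega> d) (snd d x) = residue (\<omega> c) (snd c x)"
proof -
  have mero: "meromorphic_form A \<omega>"
    using \<omega> by (simp add: third_kind_form_def)
  have pole: "is_pole (\<omega> c) (snd c x)" "is_pole (\<omega> d) (snd d x)"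
    using pole_in_every_chart[OF mero x] c d by blast+
  have ord: "zorder (\<omega> c) (snd c x) = -1" "zorder (\<omega> d) (snd d x) = -1"
    using \<omega>[unfolded third_kind_form_def, THEN conjunct2, rule_format] c d pole by blast+
  define T where "T = transition c d"
  note facts = transition_facts[OF c(1) d(1) c(2) d(2), folded T_def]
  let ?z = "snd c x"
  have W: "eventually (\<lambda>w. w \<in> snd c ` (fst c \<inter> fst d)) (at ?z)"
    using facts(1,2) by (rule eventually_at_in_open')
  have ne: "eventually (\<lambda>w. w \<noteq> ?z) (at ?z)"
    by (simp add: eventually_at_filter)
  have Tne: "eventually (\<lambda>w. T w \<noteq> snd d x) (at ?z)"
    using W ne by eventually_elim (use facts(2,4,7) in \<open>metis inj_onD\<close>)
  have T': "(T has_field_derivative deriv T ?z) (at ?z)"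
    using facts(1-3) holomorphic_derivI by blast
  have lim1: "((\<lambda>w. (T w - snd d x) / (w - ?z)) \<longlongrightarrow> deriv T ?z) (at ?z)"
    using T' facts(7) by (simp add: has_field_derivative_iff)
  have lim2: "(deriv T \<longlongrightarrow> deriv T ?z) (at ?z)"
    using facts(8) by (simp add: isCont_def)
  \<comment> \<open>By the transformation law of the form, this product is \<open>\<omega> d (T w) * (T w - snd d x)\<close>.\<close>
  have "((\<lambda>w. \<omega> c w * (w - ?z) * ((T w - snd d x) / (w - ?z)) / deriv T w) \<longlongrightarrow>
      residue (\<omega> c) ?z * deriv T ?z / deriv T ?z) (at ?z)"
    using simple_pole_limit[OF form_meromorphic_at[OF mero c] pole(1) ord(1)] lim1 lim2 facts(5)
    by (intro tendsto_intros) auto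
  moreover have "eventually (\<lambda>w. deriv T w \<noteq> 0) (at ?z)"
    using tendsto_imp_eventually_ne[OF lim2 facts(5)] .
  then have "eventually (\<lambda>w. \<omega> c w * (w - ?z) * ((T w - snd d x) / (w - ?z)) / deriv T w =
      \<omega> d (T w) * (T w - snd d x)) (at ?z)"
    using W ne
    by eventually_elim (use form_change_chart[OF mero c(1) d(1)] in \<open>simp add: T_def field_simps\<close>)
  ultimately have lim: "((\<lambda>w. \<omega> d (T w) * (T w - snd d x)) \<longlongrightarrow> residue (\<omega> c) ?z) (at ?z)"
    using facts(5) by (auto dest: Lim_transform_eventually)
  have "filterlim T (at (snd d x)) (at ?z)"
    using facts(6,7) Tne by (auto simp: filterlim_at isCont_def)
  from residue_simple_pole_limit[OF meromorphic_on_isolated_singularity[OF form_meromorphic_at[OF mero d]]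
      pole(2) ord(2) lim this at_neq_bot]
  show ?thesis .
qed

text \<open>\<open>X\<close> is a primitive of \<open>n \<omega>\<close> along the circle. It will be a polynomial in the entries of a
  transport, which is known only through its derivative.\<close>
lemma integral_along_small_circle:
  assumes \<omega>: "third_kind_form A \<omega>" and S: "S \<in> form_poles A \<omega>" and c: "c \<in> A" "S \<in> fst c" and \<rho>: "\<rho> > 0"
    and disk: "cball (snd c S) \<rho> \<subseteq> snd c ` fst c"
    and off: "\<And>z. z \<in> cball (snd c S) \<rho> - {snd c S} \<Longrightarrow> chart_inv c z \<notin> form_poles A \<omega>"
    and n: "continuous_on (cball (snd c S) \<rho>) n" "n holomorphic_on ball (snd c S) \<rho>"
    and X: "\<And>t. t \<in> {0..1} \<Longrightarrow> (X has_vector_derivative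
      \<omega> c (circlepath (snd c S) \<rho> t) * n (circlepath (snd c S) \<rho> t) *
      vector_derivative (circlepath (snd c S) \<rho>) (at t within {0..1})) (at t within {0..1})"
  shows "X 1 - X 0 = form_Res A S \<omega> * n (snd c S)"
proof -
  have mero: "meromorphic_form A \<omega>"
    using \<omega> by (simp add: third_kind_form_def)
  have pole: "is_pole (\<omega> c) (snd c S)"
    using pole_in_every_chart[OF mero S c] .
  have ord: "zorder (\<omega> c) (snd c S) = -1"
    using \<omega>[unfolded third_kind_form_def, THEN conjunct2, rule_format] c pole by blast
  have an: "\<omega> c analytic_on {w}" if "w \<in> cball (snd c S) \<rho> - {snd c S}" for w
    using analytic_off_poles[OF mero off[OF that] c(1)] that disk c(1) by auto
  have "((\<lambda>w. \<omega> c w * n w) has_contour_integral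
      2 * of_real pi * \<i> * (residue (\<omega> c) (snd c S) * n (snd c S))) (circlepath (snd c S) \<rho>)"
    by (rule simple_pole_circle_integral[OF form_meromorphic_at[OF mero c] pole ord an \<rho> n])
  moreover have "((\<lambda>w. \<omega> c w * n w) has_contour_integral X 1 - X 0) (circlepath (snd c S) \<rho>)"
    unfolding has_contour_integral_def
    by (rule fundamental_theorem_of_calculus) (use X in auto)
  ultimately have "X 1 - X 0 = 2 * of_real pi * \<i> * (residue (\<omega> c) (snd c S) * n (snd c S))"
    by (rule has_contour_integral_unique[THEN HOL.sym])
  moreover have "residue (\<omega> (chart_at A S)) (snd (chart_at A S) S) = residue (\<omega> c) (snd c S)"
    by (rule residue_change_chart[OF \<omega> S c chart_at])
  ultimately show ?thesis
    by (simp add: form_Res_def)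
qed

end

section \<open>Loops around a pole\<close>

text \<open>The block diagonal part of a matrix, with blocks \<open>{1..k}\<close> and \<open>{k+1..4}\<close>: it keeps exactly the
  iterated integrals that do not involve the \<open>k\<close>-th form. This is a homomorphism from solutions for
  all three forms to solutions for the forms with the \<open>k\<close>-th one replaced by \<open>0\<close>.\<close>
definition erase :: "nat \<Rightarrow> uni \<Rightarrow> uni" where
  "erase k M = Uni (if k = 1 then 0 else e12 M) (if k = 2 then 0 else e23 M) (if k = 3 then 0 else e34 M)
     (if k = 1 \<or> k = 2 then 0 else e13 M) (if k = 2 \<or> k = 3 then 0 else e24 M) 0"

lemma erase_one: "erase k 1 = 1"
  by (simp add: erase_def uni.expand)

lemma (in surface) zero_form: "meromorphic_form A (\<lambda>_ _. 0)"
  unfolding meromorphic_form_def by (auto intro!: analytic_on_imp_nicely_meromorphic_on)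

lemma zero_form_poles: "form_poles A (\<lambda>_ _. 0) = {}"
proof -
  have "\<not> is_pole (\<lambda>_::complex. 0::complex) z" for z
    unfolding is_pole_def using not_tendsto_and_filterlim_at_infinity[of "at z"] by auto
  then show ?thesis
    by (auto simp: form_poles_def)
qed

context flat_connection
begin

text \<open>A disk is a retract of a square by the nearest point map, so a transport over the square
  restricts to the disk. The result is a solution that is a function of the point of the surface.\<close>
lemma transports_exists_disk:
  assumes hom: "homeomorphism (cball (0::complex) 1) D h h'" and reg: "D \<subseteq> regular" and b: "b \<in> D"
  obtains B where "transports D (\<lambda>x. x) B" "B b = 1"
proof -
  define K where "K z = h (closest_point (cball 0 1) (Complex (2 * fst z - 1) (2 * snd z - 1)))"
    for z :: "real \<times> real"
  have h: "continuous_on (cball 0 1) h" "h ` cball 0 1 = D" "continuous_on D h'" "h' ` D = cball 0 1"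
    "\<And>x. x \<in> D \<Longrightarrow> h (h' x) = x"
    using hom by (auto simp: homeomorphism_def)
  have closest: "closest_point (cball 0 1) z \<in> cball 0 1" for z :: complex
    by (rule closest_point_in_set) auto
  have "continuous_on ({0..1} \<times> {0..1}) (\<lambda>z. closest_point (cball 0 1) (Complex (2 * fst z - 1) (2 * snd z - 1)))"
    by (intro continuous_on_compose2[OF continuous_on_closest_point[of "cball (0::complex) 1" UNIV]])
      (auto simp: Complex_eq intro!: continuous_intros)
  then have "continuous_on ({0..1} \<times> {0..1}) K"
    unfolding K_def by (rule continuous_on_compose2[OF h(1)]) (use closest in blast)
  moreover have "K ` ({0..1} \<times> {0..1}) \<subseteq> regular"
    unfolding K_def using reg h(2) closest by blast
  ultimately obtain k where k: "transports ({0..1} \<times> {0..1}) K k"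
    using transports_exists_square by blast
  \<comment> \<open>The coordinates of the disk, rescaled from \<open>[-1, 1]\<close> to the unit interval.\<close>
  define \<phi> where "\<phi> x = ((Re (h' x) + 1) / 2, (Im (h' x) + 1) / 2)" for x
  have in_disk: "norm (h' x) \<le> 1" if "x \<in> D" for x
    using h(4) that by (metis dist_0_norm image_eqI mem_cball)
  have "transports D (\<lambda>x. x) (\<lambda>x. k (\<phi> x))"
  proof (rule transports_compose[OF k])
    show "continuous_on D \<phi>"
      unfolding \<phi>_def by (intro continuous_intros h(3)) auto
    show "\<phi> ` D \<subseteq> {0..1} \<times> {0..1}"
    proof
      fix y assume "y \<in> \<phi> ` D"
      then obtain x where x: "x \<in> D" "y = \<phi> x"
        by blast
      have "\<bar>Re (h' x)\<bar> \<le> 1" "\<bar>Im (h' x)\<bar> \<le> 1"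
        using in_disk[OF x(1)] abs_Re_le_cmod[of "h' x"] abs_Im_le_cmod[of "h' x"] by linarith+
      then show "y \<in> {0..1} \<times> {0..1}"
        unfolding x(2) \<phi>_def by (auto simp: abs_le_iff)
    qed
    show "x = K (\<phi> x)" if "x \<in> D" for x
    proof -
      have "Complex (2 * fst (\<phi> x) - 1) (2 * snd (\<phi> x) - 1) = h' x"
        by (simp add: \<phi>_def complex_eq_iff add_divide_distrib)
      moreover have "closest_point (cball 0 1) (h' x) = h' x"
        using in_disk[OF that] by (intro closest_point_self) simp
      ultimately show ?thesis
        unfolding K_def using h(5)[OF that] by simp
    qed
  qed simp
  from transports_mult_left[OF this, of "uinv (k (\<phi> b))"] show thesis
    using that by simp
qed

lemma transports_holomorphic:
  assumes h: "transports W (chart_inv c) h" and c: "c \<in> A" and W: "open W" "W \<subseteq> snd c ` fst c"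
    and e: "e \<in> {e12, e23, e34, e13, e24, e14}"
  shows "(\<lambda>z. e (h z)) holomorphic_on W"
  unfolding holomorphic_on_open[OF W(1)]
proof
  fix z assume z: "z \<in> W"
  obtain U N M where *: "open U" "z \<in> U" "solves N M" "\<And>s. s \<in> W \<Longrightarrow> s \<in> U \<Longrightarrow> chart_inv c s \<in> N"
    "\<And>s. s \<in> W \<Longrightarrow> s \<in> U \<Longrightarrow> h s = M (chart_inv c s)"
    by (rule transportsE[OF h z]) blast
  have x: "chart_inv c z \<in> N" "chart_inv c z \<in> fst c" "snd c (chart_inv c z) = z"
    using *(2,4) z W(2) c chart_inv_in coord_chart_inv by blast+
  note D = solves_D[OF *(3) x(1), unfolded has_differential_def, rule_format, OF c x(2), unfolded x(3)]
  from e have "e = e12 \<or> e = e23 \<or> e = e34 \<or> e = e13 \<or> e = e24 \<or> e = e14"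
    by simp
  then have "\<exists>f'. ((\<lambda>z. e (M (chart_inv c z))) has_field_derivative f') (at z)"
    by (elim disjE; hypsubst) (rule exI, rule D)+
  then obtain f' where f': "((\<lambda>z. e (M (chart_inv c z))) has_field_derivative f') (at z)"
    by (rule exE)
  have "((\<lambda>z. e (h z)) has_field_derivative f') (at z)"
    by (rule has_field_derivative_transform_within_open[OF f', of "W \<inter> U"]) (use *(1,2,5) W z in auto)
  then show "\<exists>f'. ((\<lambda>z. e (h z)) has_field_derivative f') (at z)"
    by (rule exI)
qed

lemma flat_connection_erase:
  assumes "k \<in> {1,2,3}"
  shows "flat_connection A (w(k := \<lambda>_ _. 0))"
  by unfold_locales (use meromorphic zero_form in \<open>auto simp: fun_upd_def\<close>)

lemma transports_erase:
  assumes h: "transports T u h" and k: "k \<in> {1,2,3}"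
  shows "flat_connection.transports A (w(k := \<lambda>_ _. 0)) T u (\<lambda>t. erase k (h t))"
proof -
  interpret erased: flat_connection A "w(k := \<lambda>_ _. 0)"
    by (rule flat_connection_erase[OF k])
  have solves: "erased.solves N (\<lambda>x. erase k (M x))" if "solves N M" for N M
    unfolding erased.solves_def
  proof (intro conjI ballI)
    show "open N"
      by (rule solves_open[OF that])
    fix x assume x: "x \<in> N"
    note D = solves_D[OF that x] has_differential_const[of A 0 x]
    have "k = 1 \<or> k = 2 \<or> k = 3"
      using k by simp
    then show
      "has_differential A (\<lambda>y. e12 (erase k (M y))) x (form_at ((w(k := \<lambda>_ _. 0)) 1) x)"
      "has_differential A (\<lambda>y. e23 (erase k (M y))) x (form_at ((w(k := \<lambda>_ _. 0)) 2) x)"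
      "has_differential A (\<lambda>y. e34 (erase k (M y))) x (form_at ((w(k := \<lambda>_ _. 0)) 3) x)"
      "has_differential A (\<lambda>y. e13 (erase k (M y))) x (\<lambda>c. e12 (erase k (M x)) * form_at ((w(k := \<lambda>_ _. 0)) 2) x c)"
      "has_differential A (\<lambda>y. e24 (erase k (M y))) x (\<lambda>c. e23 (erase k (M x)) * form_at ((w(k := \<lambda>_ _. 0)) 3) x c)"
      "has_differential A (\<lambda>y. e14 (erase k (M y))) x (\<lambda>c. e13 (erase k (M x)) * form_at ((w(k := \<lambda>_ _. 0)) 3) x c)"
      by (elim disjE; hypsubst; simp add: erase_def D[simplified])+
  qed
  show ?thesis
  proof (rule erased.transportsI)
    fix t assume t: "t \<in> T"
    obtain U N M where *: "open U" "t \<in> U" "solves N M" "\<And>s. s \<in> T \<Longrightarrow> s \<in> U \<Longrightarrow> u s \<in> N"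
      "\<And>s. s \<in> T \<Longrightarrow> s \<in> U \<Longrightarrow> h s = M (u s)"
      by (rule transportsE[OF h t]) blast
    then show "\<exists>U N M. open U \<and> t \<in> U \<and> erased.solves N M \<and> (\<forall>s\<in>T \<inter> U. u s \<in> N \<and> erase k (h s) = M (u s))"
      using solves[OF *(3)]
      by (intro exI[of _ U] exI[of _ N] exI[of _ "\<lambda>x. erase k (M x)"]) simp
  qed
qed

text \<open>\<open>B\<close> is the single-valued solution on the disk without the \<open>k\<close>-th form, and \<open>m\<close> is the end, over
  the small circle, of a transport over the free homotopy from \<open>\<sigma>\<close> to that circle. The block
  diagonal part of the latter transport solves the same equation as \<open>B\<close> and agrees with it at the
  base point, hence everywhere.\<close>
lemma loop_around_pole:
  assumes k: "k \<in> {1,2,3}" and third: "third_kind_form A (w k)" and S: "S \<in> form_poles A (w k)"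
    and bd: "bounds_punctured_disk A \<sigma> V S"
    and reg: "closure V - {S} \<subseteq> regular" and only: "\<And>i. i \<in> {1,2,3} \<Longrightarrow> i \<noteq> k \<Longrightarrow> S \<notin> form_poles A (w i)"
    and \<gamma>: "path \<gamma>" "pathstart \<gamma> = pathstart \<sigma>" "pathfinish \<gamma> = S" "path_image \<gamma> \<subseteq> closure V"
  obtains B m c \<rho> where
    "\<rho> > 0" "c \<in> A" "S \<in> fst c"
    "transports {0..1} (chart_inv c \<circ> circlepath (snd c S) \<rho>) m"
    "continuous_on {0..1} (chart_inv c \<circ> circlepath (snd c S) \<rho>)"
    "holonomy \<sigma> = m 1 * uinv (m 0)"
    "flat_connection.transports A (w(k := \<lambda>_ _. 0)) (cball (snd c S) \<rho>) (chart_inv c) (\<lambda>z. B (chart_inv c z))"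
    "cball (snd c S) \<rho> \<subseteq> snd c ` fst c"
    "\<forall>z \<in> cball (snd c S) \<rho> - {snd c S}. chart_inv c z \<in> regular"
    "\<forall>t\<in>{0..1}. erase k (m t) = B (chart_inv c (circlepath (snd c S) \<rho> t))"
    "flat_connection.holonomy A (w(k := \<lambda>_ _. 0)) \<gamma> = B S"
proof -
  interpret erased: flat_connection A "w(k := \<lambda>_ _. 0)"
    by (rule flat_connection_erase[OF k])
  \<comment> \<open>The zero form has no poles, so erasing the \<open>k\<close>-th form also makes \<open>S\<close> regular.\<close>
  have reg': "closure V \<subseteq> erased.regular"
  proof
    fix x assume x: "x \<in> closure V"
    have "x \<notin> form_poles A (w i)" if "i \<in> {1,2,3}" "i \<noteq> k" for i
      using only[OF that] reg x that(1) unfolding regular_def by blast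
    then show "x \<in> erased.regular"
      unfolding erased.regular_def by (simp add: zero_form_poles)
  qed
  obtain h h' where hom: "homeomorphism (cball (0::complex) 1) (closure V) h h'" and "h 0 = S"
    using bd unfolding bounds_punctured_disk_def by blast
  obtain c \<rho> where c: "c \<in> A" "\<rho> > 0" "S \<in> fst c" "cball (snd c S) \<rho> \<subseteq> snd c ` (fst c \<inter> insert S V)"
    and loops: "homotopic_loops (closure V - {S}) \<sigma> (chart_inv c \<circ> circlepath (snd c S) \<rho>)"
    using bd unfolding bounds_punctured_disk_def by blast
  let ?\<kappa> = "chart_inv c \<circ> circlepath (snd c S) \<rho>"
  have SV: "S \<in> closure V"
    using \<gamma>(3,4) pathfinish_in_path_image by blast
  have \<sigma>: "path \<sigma>" "pathfinish \<sigma> = pathstart \<sigma>"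
    using loops homotopic_loops_imp_path homotopic_loops_imp_loop by blast+
  have start: "pathstart \<sigma> \<in> closure V"
    using \<gamma>(2,4) pathstart_in_path_image[of \<gamma>] by auto
  obtain B where B: "erased.transports (closure V) (\<lambda>x. x) B" "B (pathstart \<sigma>) = 1"
    by (rule erased.transports_exists_disk[OF hom reg' start])
  obtain K :: "real \<times> real \<Rightarrow> 'a" where K: "continuous_on ({0..1} \<times> {0..1}) K"
    "K \<in> ({0..1} \<times> {0..1}) \<rightarrow> closure V - {S}"
    and K': "\<forall>t\<in>{0..1}. K (0, t) = \<sigma> t" "\<forall>t\<in>{0..1}. K (1, t) = ?\<kappa> t"
      "\<forall>s\<in>{0..1}. pathfinish (K \<circ> Pair s) = pathstart (K \<circ> Pair s)"
    using loops unfolding homotopic_loops by blast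
  have Kim: "K ` ({0..1} \<times> {0..1}) \<subseteq> closure V - {S}"
    using K(2) by blast
  with reg have "K ` ({0..1} \<times> {0..1}) \<subseteq> regular"
    by blast
  then obtain g where g: "transports ({0..1} \<times> {0..1}) K g"
    using transports_exists_square[OF K(1)] by blast
  define f where "f z = uinv (g (0,0)) * g z" for z
  have f: "transports ({0..1} \<times> {0..1}) K f"
    unfolding f_def by (rule transports_mult_left[OF g])
  have f0: "f (0,0) = 1"
    by (simp add: f_def)
  have fB: "erase k (f z) = B (K z)" if "z \<in> {0..1} \<times> {0..1}" for z
  proof (rule erased.transports_agree[OF _ transports_erase[OF f k] _ K(1) _ _ that])
    show "erased.transports ({0..1} \<times> {0..1}) K (\<lambda>z. B (K z))"
      by (rule erased.transports_compose[OF B(1) K(1)]) (use Kim in auto)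
    show "connected ({0..1::real} \<times> {0..1::real})"
      by (intro convex_connected convex_Times) auto
    show "(0::real, 0::real) \<in> {0..1} \<times> {0..1}"
      by simp
    show "erase k (f (0,0)) = B (K (0,0))"
      using K'(1) B(2) by (simp add: f0 erase_one pathstart_def)
  qed
  define m where "m t = f (1, t)" for t
  have "transports {0..1} \<sigma> (\<lambda>t. f (0, t))"
    by (rule transports_compose[OF f, of _ "\<lambda>t. (0, t)"]) (use K'(1) in \<open>auto intro!: continuous_intros\<close>)
  from holonomy_eq[OF \<sigma>(1) this] have "holonomy \<sigma> = f (0, 1) * uinv (f (0, 0))"
    by (simp add: f0)
  also have "\<dots> = m 1 * uinv (m 0)"
    unfolding m_def
    by (rule free_homotopy_monodromy[OF K(1) _ f])
      (use K'(3) in \<open>auto simp: pathstart_def pathfinish_def\<close>)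
  finally have hol: "holonomy \<sigma> = m 1 * uinv (m 0)" .
  have disk: "cball (snd c S) \<rho> \<subseteq> snd c ` fst c"
    using c(4) by blast
  have in_V: "chart_inv c z \<in> insert S V" "chart_inv c z = S \<Longrightarrow> z = snd c S"
    if z: "z \<in> cball (snd c S) \<rho>" for z
  proof -
    obtain x where "x \<in> fst c" "x \<in> insert S V" "z = snd c x"
      using c(4) z by blast
    then show "chart_inv c z \<in> insert S V" "chart_inv c z = S \<Longrightarrow> z = snd c S"
      using c(1) by auto
  qed
  have inv_closure: "chart_inv c ` cball (snd c S) \<rho> \<subseteq> closure V"
    using in_V(1) SV closure_subset[of V] by blast
  show thesis
  proof (rule that[OF c(2,1,3) _ _ hol _ disk])
    show "transports {0..1} ?\<kappa> m"
      unfolding m_def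
      by (rule transports_compose[OF f, of _ "\<lambda>t. (1, t)"]) (use K'(2) in \<open>auto intro!: continuous_intros\<close>)
    show "continuous_on {0..1} ?\<kappa>"
      using homotopic_loops_imp_path[OF loops] by (simp add: path_def)
    show "erased.transports (cball (snd c S) \<rho>) (chart_inv c) (\<lambda>z. B (chart_inv c z))"
      by (rule erased.transports_compose[OF B(1) continuous_on_subset[OF continuous_on_chart_inv[OF c(1)] disk] inv_closure])
        auto
    show "\<forall>z \<in> cball (snd c S) \<rho> - {snd c S}. chart_inv c z \<in> regular"
    proof
      fix z assume "z \<in> cball (snd c S) \<rho> - {snd c S}"
      then show "chart_inv c z \<in> regular"
        using in_V[of z] reg closure_subset[of V] by blast
    qed
    show "\<forall>t\<in>{0..1}. erase k (m t) = B (chart_inv c (circlepath (snd c S) \<rho> t))"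
    proof
      fix t :: real assume "t \<in> {0..1}"
      then show "erase k (m t) = B (chart_inv c (circlepath (snd c S) \<rho> t))"
        using fB[of "(1, t)"] K'(2) by (simp add: m_def)
    qed
    have "erased.transports {0..1} \<gamma> (\<lambda>t. B (\<gamma> t))"
      by (rule erased.transports_compose[OF B(1)]) (use \<gamma> in \<open>auto simp: path_def path_image_def\<close>)
    from erased.holonomy_eq[OF \<gamma>(1) this] show "erased.holonomy \<gamma> = B S"
      using \<gamma>(2,3) B(2) by (simp add: pathstart_def pathfinish_def)
  qed
qed

text \<open>The entries \<open>(1, 4)\<close> are \<open>r\<close> times those of \<open>b E\<^sub>k b\<inverse>\<close>, where \<open>E\<^sub>k\<close> is the elementary matrix at
  \<open>(k, k + 1)\<close>. They are found as the increment over the circle of the entry \<open>(1, 4)\<close> of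
  \<open>G = m B\<inverse>\<close>, with the entries of the block diagonal matrix \<open>B\<close> expressed by the equal entries of
  \<open>m\<close>; this is \<open>X\<close> in the first two cases and \<open>e14 m\<close> in the third. Its derivative is the \<open>k\<close>-th
  form times a function that is holomorphic on the whole disk, puncture included.\<close>
lemma holonomy_around_pole:
  assumes k: "k \<in> {1,2,3}" and third: "third_kind_form A (w k)" and S: "S \<in> form_poles A (w k)"
    and bd: "bounds_punctured_disk A \<sigma> V S"
    and reg: "closure V - {S} \<subseteq> regular" and only: "\<And>i. i \<in> {1,2,3} \<Longrightarrow> i \<noteq> k \<Longrightarrow> S \<notin> form_poles A (w i)"
    and \<gamma>: "path \<gamma>" "pathstart \<gamma> = pathstart \<sigma>" "pathfinish \<gamma> = S" "path_image \<gamma> \<subseteq> closure V"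
  defines "r \<equiv> form_Res A S (w k)" and "b \<equiv> flat_connection.holonomy A (w(k := \<lambda>_ _. 0)) \<gamma>"
  shows
    "k = 1 \<Longrightarrow> e12 (holonomy \<sigma>) = r \<and> e23 (holonomy \<sigma>) = 0 \<and> e34 (holonomy \<sigma>) = 0 \<and>
      e24 (holonomy \<sigma>) = 0 \<and> e14 (holonomy \<sigma>) = r * (e23 b * e34 b - e24 b)"
    "k = 2 \<Longrightarrow> e23 (holonomy \<sigma>) = r \<and> e12 (holonomy \<sigma>) = 0 \<and> e34 (holonomy \<sigma>) = 0 \<and>
      e14 (holonomy \<sigma>) = r * (- e12 b * e34 b)"
    "k = 3 \<Longrightarrow> e34 (holonomy \<sigma>) = r \<and> e12 (holonomy \<sigma>) = 0 \<and> e23 (holonomy \<sigma>) = 0 \<and>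
      e13 (holonomy \<sigma>) = 0 \<and> e14 (holonomy \<sigma>) = r * e13 b"
proof -
  interpret erased: flat_connection A "w(k := \<lambda>_ _. 0)"
    by (rule flat_connection_erase[OF k])
  obtain B m c \<rho> where
    c: "\<rho> > 0" "c \<in> A" "S \<in> fst c"
    and m: "transports {0..1} (chart_inv c \<circ> circlepath (snd c S) \<rho>) m"
    and cont: "continuous_on {0..1} (chart_inv c \<circ> circlepath (snd c S) \<rho>)"
    and hol: "holonomy \<sigma> = m 1 * uinv (m 0)"
    and B: "erased.transports (cball (snd c S) \<rho>) (chart_inv c) (\<lambda>z. B (chart_inv c z))"
    and disk: "cball (snd c S) \<rho> \<subseteq> snd c ` fst c"
    and off: "\<forall>z \<in> cball (snd c S) \<rho> - {snd c S}. chart_inv c z \<in> regular"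
    and mB: "\<forall>t\<in>{0..1}. erase k (m t) = B (chart_inv c (circlepath (snd c S) \<rho> t))"
    and \<gamma>B: "erased.holonomy \<gamma> = B S"
    by (rule loop_around_pole[OF k third S bd reg only \<gamma>])
  define \<zeta> where "\<zeta> = circlepath (snd c S) \<rho>"
  define b' where "b' z = B (chart_inv c z)" for z
  define v where "v t = vector_derivative \<zeta> (at t within {0..1})" for t
  have \<zeta>: "\<zeta> t \<in> cball (snd c S) \<rho>" if "t \<in> {0..1}" for t
  proof -
    have "\<zeta> t \<in> path_image \<zeta>"
      using that by (simp add: path_image_def)
    then show ?thesis
      using c(1) sphere_cball by (auto simp: \<zeta>_def path_image_circlepath)
  qed
  have coord: "snd c (chart_inv c (\<zeta> t)) = \<zeta> t" "chart_inv c (\<zeta> t) \<in> fst c" if "t \<in> {0..1}" for t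
    using \<zeta>[OF that] disk c(2) by auto
  have b: "b = b' (snd c S)"
    using \<gamma>B c by (simp add: b_def b'_def)
  have mb: "erase k (m t) = b' (\<zeta> t)" if "t \<in> {0..1}" for t
    using bspec[OF mB that] by (simp add: b'_def \<zeta>_def)
  have n_cont: "continuous_on (cball (snd c S) \<rho>) (\<lambda>z. e (b' z))"
    and n_hol: "(\<lambda>z. e (b' z)) holomorphic_on ball (snd c S) \<rho>" if e: "e \<in> {e12, e23, e34, e13, e24, e14}" for e
  proof -
    show "continuous_on (cball (snd c S) \<rho>) (\<lambda>z. e (b' z))"
      unfolding b'_def
      by (rule erased.transports_continuous[OF B continuous_on_subset[OF continuous_on_chart_inv[OF c(2)] disk] e])
    show "(\<lambda>z. e (b' z)) holomorphic_on ball (snd c S) \<rho>"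
      unfolding b'_def
      by (rule erased.transports_holomorphic[OF erased.transports_subset[OF B ball_subset_cball] c(2) open_ball _ e])
        (use disk ball_subset_cball in blast)
  qed
  have velocity: "((snd c \<circ> (chart_inv c \<circ> \<zeta>)) has_vector_derivative v t) (at t within {0..1})"
    if t: "t \<in> {0..1}" for t
  proof -
    have "(\<zeta> has_vector_derivative v t) (at t within {0..1})"
      using has_vector_derivative_circlepath[of "snd c S" \<rho> t "{0..1}"] t
      by (simp add: \<zeta>_def v_def vector_derivative_circlepath01)
    then show ?thesis
      by (rule has_vector_derivative_transform[OF t, rotated]) (use coord in simp)
  qed
  have D: 
    "((\<lambda>t. e12 (m t)) has_vector_derivative w 1 c (\<zeta> t) * v t) (at t within {0..1})"
    "((\<lambda>t. e23 (m t)) has_vector_derivative w 2 c (\<zeta> t) * v t) (at t within {0..1})"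
    "((\<lambda>t. e34 (m t)) has_vector_derivative w 3 c (\<zeta> t) * v t) (at t within {0..1})"
    "((\<lambda>t. e13 (m t)) has_vector_derivative e12 (m t) * w 2 c (\<zeta> t) * v t) (at t within {0..1})"
    "((\<lambda>t. e24 (m t)) has_vector_derivative e23 (m t) * w 3 c (\<zeta> t) * v t) (at t within {0..1})"
    "((\<lambda>t. e14 (m t)) has_vector_derivative e13 (m t) * w 3 c (\<zeta> t) * v t) (at t within {0..1})"
    if t: "t \<in> {0..1}" for t
    using transports_has_derivative[OF m cont t c(2), folded \<zeta>_def, OF _ velocity[OF t]] coord[OF t]
    by simp_all
  have circle: "X 1 - X 0 = r * n (snd c S)"
    if "continuous_on (cball (snd c S) \<rho>) n" "n holomorphic_on ball (snd c S) \<rho>"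
      and X: "\<And>t. t \<in> {0..1} \<Longrightarrow> (X has_vector_derivative w k c (\<zeta> t) * n (\<zeta> t) * v t) (at t within {0..1})"
    for X n
    unfolding r_def
  proof (rule integral_along_small_circle[OF third S c(2,3,1) disk _ that(1,2)])
    show "chart_inv c z \<notin> form_poles A (w k)" if "z \<in> cball (snd c S) \<rho> - {snd c S}" for z
      using bspec[OF off that] k unfolding regular_def by blast
    show "(X has_vector_derivative w k c (circlepath (snd c S) \<rho> t) * n (circlepath (snd c S) \<rho> t) *
        vector_derivative (circlepath (snd c S) \<rho>) (at t within {0..1})) (at t within {0..1})"
      if "t \<in> {0..1}" for t
      using X[OF that] by (simp add: \<zeta>_def v_def)
  qed
  have circle_1: "X 1 - X 0 = r"
    if "\<And>t. t \<in> {0..1} \<Longrightarrow> (X has_vector_derivative w k c (\<zeta> t) * v t) (at t within {0..1})" for X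
    using circle[of "\<lambda>_. 1" X] that by simp
  have ends: "erase k (m 1) = erase k (m 0)"
    using mb[of 0] mb[of 1] by (simp add: \<zeta>_def circlepath)
  show "e12 (holonomy \<sigma>) = r \<and> e23 (holonomy \<sigma>) = 0 \<and> e34 (holonomy \<sigma>) = 0 \<and>
      e24 (holonomy \<sigma>) = 0 \<and> e14 (holonomy \<sigma>) = r * (e23 b * e34 b - e24 b)" if "k = 1"
  proof -
    define X where "X t = e14 (m t) - e13 (m t) * e34 (m t) + e12 (m t) * (e23 (m t) * e34 (m t) - e24 (m t))" for t
    have entries: "e23 (b' (\<zeta> t)) = e23 (m t)" "e34 (b' (\<zeta> t)) = e34 (m t)" "e24 (b' (\<zeta> t)) = e24 (m t)"
      if "t \<in> {0..1}" for t
      using mb[OF that] \<open>k = 1\<close> by (simp_all add: erase_def flip: mb[OF that])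
    have "X 1 - X 0 = r * (\<lambda>z. e23 (b' z) * e34 (b' z) - e24 (b' z)) (snd c S)"
    proof (rule circle)
      fix t :: real assume t: "t \<in> {0..1}"
      show "(X has_vector_derivative w k c (\<zeta> t) * (e23 (b' (\<zeta> t)) * e34 (b' (\<zeta> t)) - e24 (b' (\<zeta> t))) * v t) (at t within {0..1})"
        unfolding X_def entries[OF t] \<open>k = 1\<close>
        by (rule derivative_eq_intros D[OF t] HOL.refl)+ (simp add: algebra_simps)
    qed (intro continuous_intros holomorphic_intros n_cont n_hol; simp)+
    moreover have "e12 (m 1) - e12 (m 0) = r"
      using circle_1[of "\<lambda>t. e12 (m t)"] D(1) \<open>k = 1\<close> by simp
    moreover have "e23 (m 1) = e23 (m 0)" "e34 (m 1) = e34 (m 0)" "e24 (m 1) = e24 (m 0)"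
      using ends \<open>k = 1\<close> by (simp_all add: erase_def)
    ultimately show ?thesis
      unfolding hol b by (simp add: X_def algebra_simps)
  qed
  show "e23 (holonomy \<sigma>) = r \<and> e12 (holonomy \<sigma>) = 0 \<and> e34 (holonomy \<sigma>) = 0 \<and>
      e14 (holonomy \<sigma>) = r * (- e12 b * e34 b)" if "k = 2"
  proof -
    define X where "X t = e14 (m t) - e13 (m t) * e34 (m t)" for t
    have entries: "e12 (b' (\<zeta> t)) = e12 (m t)" "e34 (b' (\<zeta> t)) = e34 (m t)"
      if "t \<in> {0..1}" for t
      using mb[OF that] \<open>k = 2\<close> by (simp_all add: erase_def flip: mb[OF that])
    have "X 1 - X 0 = r * (\<lambda>z. - e12 (b' z) * e34 (b' z)) (snd c S)"
    proof (rule circle)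
      fix t :: real assume t: "t \<in> {0..1}"
      show "(X has_vector_derivative w k c (\<zeta> t) * (- e12 (b' (\<zeta> t)) * e34 (b' (\<zeta> t))) * v t) (at t within {0..1})"
        unfolding X_def entries[OF t] \<open>k = 2\<close>
        by (rule derivative_eq_intros D[OF t] HOL.refl)+ (simp add: algebra_simps)
    qed (intro continuous_intros holomorphic_intros n_cont n_hol; simp)+
    moreover have "e23 (m 1) - e23 (m 0) = r"
      using circle_1[of "\<lambda>t. e23 (m t)"] D(2) \<open>k = 2\<close> by simp
    moreover have "e12 (m 1) = e12 (m 0)" "e34 (m 1) = e34 (m 0)"
      using ends \<open>k = 2\<close> by (simp_all add: erase_def)
    ultimately show ?thesis
      unfolding hol b by (simp add: X_def algebra_simps)
  qed
  show "e34 (holonomy \<sigma>) = r \<and> e12 (holonomy \<sigma>) = 0 \<and> e23 (holonomy \<sigma>) = 0 \<and>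
      e13 (holonomy \<sigma>) = 0 \<and> e14 (holonomy \<sigma>) = r * e13 b" if "k = 3"
  proof -
    have entries: "e13 (b' (\<zeta> t)) = e13 (m t)"
      if "t \<in> {0..1}" for t
      using mb[OF that] \<open>k = 3\<close> by (simp_all add: erase_def flip: mb[OF that])
    have "e14 (m 1) - e14 (m 0) = r * (\<lambda>z. e13 (b' z)) (snd c S)"
    proof (rule circle[of _ "\<lambda>t. e14 (m t)"])
      fix t :: real assume t: "t \<in> {0..1}"
      show "((\<lambda>t. e14 (m t)) has_vector_derivative w k c (\<zeta> t) * e13 (b' (\<zeta> t)) * v t) (at t within {0..1})"
        using D(6)[OF t] \<open>k = 3\<close> by (simp add: entries[OF t] mult_ac)
    qed (intro n_cont n_hol; simp)+
    moreover have "e34 (m 1) - e34 (m 0) = r"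
      using circle_1[of "\<lambda>t. e34 (m t)"] D(3) \<open>k = 3\<close> by simp
    moreover have "e12 (m 1) = e12 (m 0)" "e23 (m 1) = e23 (m 0)" "e13 (m 1) = e13 (m 0)"
      using ends \<open>k = 3\<close> by (simp_all add: erase_def)
    ultimately show ?thesis
      unfolding hol b by (simp add: algebra_simps)
  qed
qed

end

section \<open>The relation in the fundamental group\<close>

context flat_connection
begin

lemma holonomy_word_path:
  assumes Y: "Y \<subseteq> regular" "b \<in> Y" and loops: "\<And>x. x \<in> fst ` set ws \<Longrightarrow> loop_in Y b (loop x)"
  shows "loop_in Y b (word_path b loop ws) \<and> holonomy (word_path b loop ws) =
    prod_list (map (\<lambda>l. if snd l then holonomy (loop (fst l)) else uinv (holonomy (loop (fst l)))) ws)"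
  using loops
proof (induction ws)
  case Nil
  have "path (\<lambda>_::real. b)" "path_image (\<lambda>_::real. b) = {b}"
    by (auto simp: path_def path_image_def)
  then show ?case
    using holonomy_const[of b] Y by (auto simp: loop_in_def pathstart_def pathfinish_def)
next
  case (Cons l ws)
  let ?p = "if snd l then loop (fst l) else reversepath (loop (fst l))"
  have l: "path (loop (fst l))" "path_image (loop (fst l)) \<subseteq> Y"
    "pathstart (loop (fst l)) = b" "pathfinish (loop (fst l)) = b"
    using Cons.prems[of "fst l"] by (simp_all add: loop_in_def)
  have p: "path ?p" "path_image ?p \<subseteq> Y" "pathstart ?p = b" "pathfinish ?p = b"
    using l by auto
  have hol: "holonomy ?p = (if snd l then holonomy (loop (fst l)) else uinv (holonomy (loop (fst l))))"
    using holonomy_reversepath[OF l(1)] l(2) Y(1) by auto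
  have IH: "loop_in Y b (word_path b loop ws)" "holonomy (word_path b loop ws) =
    prod_list (map (\<lambda>l. if snd l then holonomy (loop (fst l)) else uinv (holonomy (loop (fst l)))) ws)"
    using Cons.IH Cons.prems by auto
  have q: "path (word_path b loop ws)" "path_image (word_path b loop ws) \<subseteq> Y"
    "pathstart (word_path b loop ws) = b" "pathfinish (word_path b loop ws) = b"
    using IH(1) by (simp_all add: loop_in_def)
  have "loop_in Y b (?p +++ word_path b loop ws)"
    unfolding loop_in_def using p q by (simp add: path_image_join)
  moreover have "holonomy (?p +++ word_path b loop ws) = holonomy ?p * holonomy (word_path b loop ws)"
    by (rule holonomy_join) (use p q Y(1) in auto)
  ultimately show ?case
    using hol IH(2) by simp
qed

text \<open>Reversing a path inverts its holonomy, so the entries of \<open>b\<inverse>\<close> in \<open>holonomy_around_pole\<close> are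
  integrals along the reversed path.\<close>
lemma pole_contribution:
  assumes k: "k \<in> {1,2,3}" and third: "third_kind_form A (w k)" and S: "S \<in> form_poles A (w k)"
    and bd: "bounds_punctured_disk A \<sigma> V S"
    and reg: "closure V - {S} \<subseteq> regular" and only: "\<And>i. i \<in> {1,2,3} \<Longrightarrow> i \<noteq> k \<Longrightarrow> S \<notin> form_poles A (w i)"
    and \<gamma>: "piecewise_smooth_path A \<gamma>" "pathstart \<gamma> = pathstart \<sigma>" "pathfinish \<gamma> = S" "path_image \<gamma> \<subseteq> closure V"
  shows
    "k = 1 \<Longrightarrow> e23 (holonomy \<sigma>) = 0 \<and> e34 (holonomy \<sigma>) = 0 \<and> e24 (holonomy \<sigma>) = 0 \<and>
      e14 (holonomy \<sigma>) = form_Res A S (w 1) * iter_integral A (reversepath \<gamma>) [w 2, w 3]"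
    "k = 2 \<Longrightarrow> e12 (holonomy \<sigma>) = 0 \<and> e34 (holonomy \<sigma>) = 0 \<and>
      e14 (holonomy \<sigma>) = form_Res A S (w 2) * iter_integral A (reversepath \<gamma>) [w 1] * iter_integral A \<gamma> [w 3]"
    "k = 3 \<Longrightarrow> e12 (holonomy \<sigma>) = 0 \<and> e23 (holonomy \<sigma>) = 0 \<and> e13 (holonomy \<sigma>) = 0 \<and>
      e14 (holonomy \<sigma>) = form_Res A S (w 3) * iter_integral A \<gamma> [w 1, w 2]"
proof -
  interpret erased: flat_connection A "w(k := \<lambda>_ _. 0)"
    by (rule flat_connection_erase[OF k])
  have path: "path \<gamma>"
    using \<gamma>(1) by (simp add: piecewise_smooth_path_def)
  have "x \<in> erased.regular" if "x \<in> closure V" for x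
  proof -
    have "x \<notin> form_poles A (w i)" if "i \<in> {1,2,3}" "i \<noteq> k" for i
      using only[OF that] reg \<open>x \<in> closure V\<close> that(1) unfolding regular_def by blast
    then show ?thesis
      unfolding erased.regular_def by (simp add: zero_form_poles)
  qed
  then have im: "path_image \<gamma> \<subseteq> erased.regular"
    using \<gamma>(4) by blast
  have rev: "erased.holonomy (reversepath \<gamma>) = uinv (erased.holonomy \<gamma>)"
    by (rule erased.holonomy_reversepath[OF path im])
  note forward = erased.holonomy_entries[OF \<gamma>(1) im]
  have "path_image (reversepath \<gamma>) \<subseteq> erased.regular"
    using im by simp
  note backward = erased.holonomy_entries[OF piecewise_smooth_reversepath[OF \<gamma>(1)] this, unfolded rev]
  note around = holonomy_around_pole[OF k third S bd reg only path \<gamma>(2-4)]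
  show "k = 1 \<Longrightarrow> e23 (holonomy \<sigma>) = 0 \<and> e34 (holonomy \<sigma>) = 0 \<and> e24 (holonomy \<sigma>) = 0 \<and>
      e14 (holonomy \<sigma>) = form_Res A S (w 1) * iter_integral A (reversepath \<gamma>) [w 2, w 3]"
    using around(1) backward(5) by simp
  show "k = 2 \<Longrightarrow> e12 (holonomy \<sigma>) = 0 \<and> e34 (holonomy \<sigma>) = 0 \<and>
      e14 (holonomy \<sigma>) = form_Res A S (w 2) * iter_integral A (reversepath \<gamma>) [w 1] * iter_integral A \<gamma> [w 3]"
    using around(2) backward(1)[symmetric] forward(3)[symmetric] by simp
  show "k = 3 \<Longrightarrow> e12 (holonomy \<sigma>) = 0 \<and> e23 (holonomy \<sigma>) = 0 \<and> e13 (holonomy \<sigma>) = 0 \<and>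
      e14 (holonomy \<sigma>) = form_Res A S (w 3) * iter_integral A \<gamma> [w 1, w 2]"
    using around(3) forward(4) by simp
qed

end

lemma sum_list_upt_Suc: "sum_list (map f [1..<Suc n]) = sum f {1..n}"
  by (simp only: interv_sum_list_conv_sum_set_nat set_upt atLeastLessThanSuc_atLeastAtMost)

theorem theorem3p3:
  fixes A :: "'a::t2_space chart set"
    and \<omega>\<^sub>1 \<omega>\<^sub>2 \<omega>\<^sub>3 :: "'a form"
    and g p q r :: nat
    and P Q R :: "nat \<Rightarrow> 'a"
    and P\<^sub>0 :: 'a
    and \<sigma> \<gamma> :: "'a \<Rightarrow> real \<Rightarrow> 'a"
    and V :: "'a \<Rightarrow> 'a set"
    and \<alpha> \<beta> :: "nat \<Rightarrow> real \<Rightarrow> 'a"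
    and poles Y :: "'a set"
    and pole_list :: "'a list"
  defines "poles \<equiv> form_poles A \<omega>\<^sub>1 \<union> form_poles A \<omega>\<^sub>2 \<union> form_poles A \<omega>\<^sub>3"
    and "Y \<equiv> UNIV - poles"
    and "pole_list \<equiv> map P [1..<Suc p] @ map Q [1..<Suc q] @ map R [1..<Suc r]"
  assumes "compact_riemann_surface A" and "has_genus A g"
    and "third_kind_form A \<omega>\<^sub>1" and "third_kind_form A \<omega>\<^sub>2" and "third_kind_form A \<omega>\<^sub>3"
    and "form_poles A \<omega>\<^sub>1 \<inter> form_poles A \<omega>\<^sub>2 = {}"
    and "form_poles A \<omega>\<^sub>1 \<inter> form_poles A \<omega>\<^sub>3 = {}"
    and "form_poles A \<omega>\<^sub>2 \<inter> form_poles A \<omega>\<^sub>3 = {}"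
    and "bij_betw P {1..p} (form_poles A \<omega>\<^sub>1)"
    and "bij_betw Q {1..q} (form_poles A \<omega>\<^sub>2)"
    and "bij_betw R {1..r} (form_poles A \<omega>\<^sub>3)"
    and "P\<^sub>0 \<in> Y"
    and "\<And>S. S \<in> poles \<Longrightarrow> loop_in Y P\<^sub>0 (\<sigma> S) \<and> simple_path (\<sigma> S)"
    and "\<And>S. S \<in> poles \<Longrightarrow> bounds_punctured_disk A (\<sigma> S) (V S) S"
    and "\<And>S. S \<in> poles \<Longrightarrow> closure (V S) \<inter> poles = {S}"
    and "\<And>S T. S \<in> poles \<Longrightarrow> T \<in> poles \<Longrightarrow> S \<noteq> T \<Longrightarrow>
           path_image (\<sigma> S) \<inter> path_image (\<sigma> T) = {P\<^sub>0}"
    and "leave_counterclockwise A P\<^sub>0 (map \<sigma> pole_list)"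
    and "\<And>l. l \<in> {1..g} \<Longrightarrow> loop_in Y P\<^sub>0 (\<alpha> l) \<and> piecewise_smooth_path A (\<alpha> l)"
    and "\<And>l. l \<in> {1..g} \<Longrightarrow> loop_in Y P\<^sub>0 (\<beta> l) \<and> piecewise_smooth_path A (\<beta> l)"
    and "presents_fundamental_group Y P\<^sub>0
           (Sigma_gen ` poles \<union> Alpha_gen ` {1..g} \<union> Beta_gen ` {1..g})
           (generator_loop \<sigma> \<alpha> \<beta>)
           (surface_relator pole_list g)"
    and "\<And>S. S \<in> poles \<Longrightarrow> piecewise_smooth_path A (\<gamma> S) \<and>
           pathstart (\<gamma> S) = P\<^sub>0 \<and> pathfinish (\<gamma> S) = S \<and> path_image (\<gamma> S) \<subseteq> closure (V S)"
  shows
    "(\<Sum>i=1..p. form_Res A (P i) \<omega>\<^sub>1 * iter_integral A (reversepath (\<gamma> (P i))) [\<omega>\<^sub>2, \<omega>\<^sub>3])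
     + (\<Sum>j=1..q. form_Res A (Q j) \<omega>\<^sub>2 *
          iter_integral A (reversepath (\<gamma> (Q j))) [\<omega>\<^sub>1] * iter_integral A (\<gamma> (Q j)) [\<omega>\<^sub>3])
     + (\<Sum>k=1..r. form_Res A (R k) \<omega>\<^sub>3 * iter_integral A (\<gamma> (R k)) [\<omega>\<^sub>1, \<omega>\<^sub>2])
     + (\<Sum>l=1..g.
          iter_integral A (\<alpha> l) [\<omega>\<^sub>1, \<omega>\<^sub>2] * iter_integral A (\<beta> l) [\<omega>\<^sub>3]
        - iter_integral A (\<beta> l) [\<omega>\<^sub>1, \<omega>\<^sub>2] * iter_integral A (\<alpha> l) [\<omega>\<^sub>3]
        + iter_integral A (\<alpha> l) [\<omega>\<^sub>3, \<omega>\<^sub>2] * iter_integral A (\<beta> l) [\<omega>\<^sub>1]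
        - iter_integral A (\<beta> l) [\<omega>\<^sub>3, \<omega>\<^sub>2] * iter_integral A (\<alpha> l) [\<omega>\<^sub>1]
        - iter_integral A (\<alpha> l) [\<omega>\<^sub>1] * iter_integral A (\<beta> l) [\<omega>\<^sub>2] * iter_integral A (\<alpha> l) [\<omega>\<^sub>3]
        + iter_integral A (\<beta> l) [\<omega>\<^sub>1] * iter_integral A (\<alpha> l) [\<omega>\<^sub>2] * iter_integral A (\<beta> l) [\<omega>\<^sub>3])
     = 0"
proof -
  note pole_disj = assms(9-11) and bij = assms(12-14) and base = assms(15) and sigma = assms(16)
    and disk = assms(17) and closure_poles = assms(18) and alpha = assms(21) and beta = assms(22)
    and presents = assms(23) and gamma = assms(24)
  define w where "w i = (if i = 1 then \<omega>\<^sub>1 else if i = 2 then \<omega>\<^sub>2 else \<omega>\<^sub>3)" for i :: nat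
  have w: "w 1 = \<omega>\<^sub>1" "w 2 = \<omega>\<^sub>2" "w 3 = \<omega>\<^sub>3"
    by (simp_all add: w_def)
  have third: "third_kind_form A (w i)" for i
    using assms(6-8) by (simp add: w_def)
  interpret surface A
    by unfold_locales (use assms(4) in \<open>simp add: compact_riemann_surface_def\<close>)
  interpret flat_connection A w
    by unfold_locales (use third in \<open>simp add: third_kind_form_def\<close>)
  have regular: "regular = Y"
    unfolding regular_def Y_def poles_def by (auto simp: w_def)
  have poles_w: "poles = form_poles A (w 1) \<union> form_poles A (w 2) \<union> form_poles A (w 3)"
    unfolding poles_def w by (rule HOL.refl)
  have contribution: 
    "k = 1 \<Longrightarrow> e23 (holonomy (\<sigma> S)) = 0 \<and> e34 (holonomy (\<sigma> S)) = 0 \<and> e24 (holonomy (\<sigma> S)) = 0 \<and>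
      e14 (holonomy (\<sigma> S)) = form_Res A S \<omega>\<^sub>1 * iter_integral A (reversepath (\<gamma> S)) [\<omega>\<^sub>2, \<omega>\<^sub>3]"
    "k = 2 \<Longrightarrow> e12 (holonomy (\<sigma> S)) = 0 \<and> e34 (holonomy (\<sigma> S)) = 0 \<and>
      e14 (holonomy (\<sigma> S)) = form_Res A S \<omega>\<^sub>2 * iter_integral A (reversepath (\<gamma> S)) [\<omega>\<^sub>1] * iter_integral A (\<gamma> S) [\<omega>\<^sub>3]"
    "k = 3 \<Longrightarrow> e12 (holonomy (\<sigma> S)) = 0 \<and> e23 (holonomy (\<sigma> S)) = 0 \<and> e13 (holonomy (\<sigma> S)) = 0 \<and>
      e14 (holonomy (\<sigma> S)) = form_Res A S \<omega>\<^sub>3 * iter_integral A (\<gamma> S) [\<omega>\<^sub>1, \<omega>\<^sub>2]"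
    if k: "k \<in> {1,2,3}" and S: "S \<in> form_poles A (w k)" for k S
  proof -
    have "S \<in> poles"
      using k S poles_w by auto
    note here = sigma[OF this] disk[OF this] closure_poles[OF this] gamma[OF this]
    have "closure (V S) - {S} \<subseteq> regular"
      using here(3) unfolding regular Y_def by blast
    moreover have "S \<notin> form_poles A (w i)" if "i \<in> {1,2,3}" "i \<noteq> k" for i
      using pole_disj k S that by (auto simp: w_def)
    moreover have "pathstart (\<gamma> S) = pathstart (\<sigma> S)"
      using here(1,4) by (simp add: loop_in_def)
    ultimately show "k = 1 \<Longrightarrow> e23 (holonomy (\<sigma> S)) = 0 \<and> e34 (holonomy (\<sigma> S)) = 0 \<and> e24 (holonomy (\<sigma> S)) = 0 \<and>
      e14 (holonomy (\<sigma> S)) = form_Res A S \<omega>\<^sub>1 * iter_integral A (reversepath (\<gamma> S)) [\<omega>\<^sub>2, \<omega>\<^sub>3]"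
      "k = 2 \<Longrightarrow> e12 (holonomy (\<sigma> S)) = 0 \<and> e34 (holonomy (\<sigma> S)) = 0 \<and>
      e14 (holonomy (\<sigma> S)) = form_Res A S \<omega>\<^sub>2 * iter_integral A (reversepath (\<gamma> S)) [\<omega>\<^sub>1] * iter_integral A (\<gamma> S) [\<omega>\<^sub>3]"
      "k = 3 \<Longrightarrow> e12 (holonomy (\<sigma> S)) = 0 \<and> e23 (holonomy (\<sigma> S)) = 0 \<and> e13 (holonomy (\<sigma> S)) = 0 \<and>
      e14 (holonomy (\<sigma> S)) = form_Res A S \<omega>\<^sub>3 * iter_integral A (\<gamma> S) [\<omega>\<^sub>1, \<omega>\<^sub>2]"
      using pole_contribution[OF k third S here(2), of "\<gamma> S", unfolded w] here(4) by blast+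
  qed
  let ?r = "surface_relator pole_list g" and ?loop = "generator_loop \<sigma> \<alpha> \<beta>"
  let ?G = "Sigma_gen ` poles \<union> Alpha_gen ` {1..g} \<union> Beta_gen ` {1..g}"
  have set_poles: "set pole_list = poles"
    using bij unfolding pole_list_def poles_def
    by (simp add: bij_betw_def atLeastLessThanSuc_atLeastAtMost Un_assoc del: upt_Suc)
  have word: "?r \<in> lists (?G \<times> UNIV)"
    unfolding surface_relator_def using set_poles
    by (auto simp: commutator_word_def atLeastLessThanSuc_atLeastAtMost simp del: upt_Suc)
  moreover have "word_eq ?r ?r []"
    using word_eq.relator[of ?r "[]" "[]"] by simp
  ultimately have "homotopic_paths Y (word_path P\<^sub>0 ?loop ?r) (\<lambda>_. P\<^sub>0)"
    using presents unfolding presents_fundamental_group_def by blast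
  then have "holonomy (word_path P\<^sub>0 ?loop ?r) = 1"
    using holonomy_homotopic[of Y] holonomy_const[of P\<^sub>0] base regular by simp
  moreover have "loop_in Y P\<^sub>0 (?loop x)" if "x \<in> fst ` set ?r" for x
  proof -
    have "x \<in> ?G"
      using that word by auto
    then show ?thesis
      using presents unfolding presents_fundamental_group_def by blast
  qed
  note holonomy_word_path[of Y P\<^sub>0 ?r ?loop, OF _ base this]
  ultimately have rel: "prod_list (map (\<lambda>l. if snd l then holonomy (?loop (fst l))
      else uinv (holonomy (?loop (fst l)))) ?r) = 1"
    using regular by simp
  define K where "K l = holonomy (\<alpha> l) * (holonomy (\<beta> l) * (uinv (holonomy (\<alpha> l)) * uinv (holonomy (\<beta> l))))" for l
  have commutators: "prod_list (map (\<lambda>l. if snd l then holonomy (?loop (fst l))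
      else uinv (holonomy (?loop (fst l)))) (concat (map (\<lambda>l. commutator_word (Alpha_gen l) (Beta_gen l)) ls)))
    = prod_list (map K ls)" for ls
    by (induction ls) (simp_all add: commutator_word_def K_def mult.assoc)
  define Ps where "Ps = map (\<lambda>i. holonomy (\<sigma> (P i))) [1..<Suc p]"
  define Qs where "Qs = map (\<lambda>i. holonomy (\<sigma> (Q i))) [1..<Suc q]"
  define Rs where "Rs = map (\<lambda>i. holonomy (\<sigma> (R i))) [1..<Suc r]"
  define Ks where "Ks = map K [1..<Suc g]"
  have PP: "P i \<in> form_poles A (w 1)" if "i \<in> {1..p}" for i
    using bij(1) that by (auto simp: bij_betw_def w_def)
  have QQ: "Q i \<in> form_poles A (w 2)" if "i \<in> {1..q}" for i
    using bij(2) that by (auto simp: bij_betw_def w_def)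
  have RR: "R i \<in> form_poles A (w 3)" if "i \<in> {1..r}" for i
    using bij(3) that by (auto simp: bij_betw_def w_def)
  have "prod_list Ps * prod_list Qs * prod_list Rs * prod_list Ks = 1"
    using rel unfolding surface_relator_def pole_list_def Ps_def Qs_def Rs_def Ks_def
    by (simp add: commutators o_def mult.assoc del: upt_Suc)
  then have "sum_list (map e14 Ps) + sum_list (map e14 Qs) + sum_list (map e14 Rs) + sum_list (map e14 Ks) = 0"
  proof (rule e14_surface_relation)
    show "e23 M = 0 \<and> e34 M = 0 \<and> e24 M = 0" if "M \<in> set Ps" for M
      using that contribution(1)[of 1] PP by (auto simp: Ps_def simp del: upt_Suc)
    show "e12 M = 0 \<and> e34 M = 0" if "M \<in> set Qs" for M
      using that contribution(2)[of 2] QQ by (auto simp: Qs_def simp del: upt_Suc)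
    show "e12 M = 0 \<and> e23 M = 0 \<and> e13 M = 0" if "M \<in> set Rs" for M
      using that contribution(3)[of 3] RR by (auto simp: Rs_def simp del: upt_Suc)
    show "e12 M = 0 \<and> e23 M = 0 \<and> e34 M = 0" if "M \<in> set Ks" for M
      using that by (auto simp: Ks_def K_def simp del: upt_Suc)
  qed
  moreover have "sum_list (map e14 Ps) =
      (\<Sum>i=1..p. form_Res A (P i) \<omega>\<^sub>1 * iter_integral A (reversepath (\<gamma> (P i))) [\<omega>\<^sub>2, \<omega>\<^sub>3])"
    unfolding Ps_def map_map o_def sum_list_upt_Suc
    using contribution(1)[of 1] PP by (intro sum.cong) auto
  moreover have "sum_list (map e14 Qs) =
      (\<Sum>j=1..q. form_Res A (Q j) \<omega>\<^sub>2 * iter_integral A (reversepath (\<gamma> (Q j))) [\<omega>\<^sub>1] * iter_integral A (\<gamma> (Q j)) [\<omega>\<^sub>3])"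
    unfolding Qs_def map_map o_def sum_list_upt_Suc
    using contribution(2)[of 2] QQ by (intro sum.cong) auto
  moreover have "sum_list (map e14 Rs) =
      (\<Sum>k=1..r. form_Res A (R k) \<omega>\<^sub>3 * iter_integral A (\<gamma> (R k)) [\<omega>\<^sub>1, \<omega>\<^sub>2])"
    unfolding Rs_def map_map o_def sum_list_upt_Suc
    using contribution(3)[of 3] RR by (intro sum.cong) auto
  moreover have "sum_list (map e14 Ks) = (\<Sum>l=1..g.
          iter_integral A (\<alpha> l) [\<omega>\<^sub>1, \<omega>\<^sub>2] * iter_integral A (\<beta> l) [\<omega>\<^sub>3]
        - iter_integral A (\<beta> l) [\<omega>\<^sub>1, \<omega>\<^sub>2] * iter_integral A (\<alpha> l) [\<omega>\<^sub>3]
        + iter_integral A (\<alpha> l) [\<omega>\<^sub>3, \<omega>\<^sub>2] * iter_integral A (\<beta> l) [\<omega>\<^sub>1]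
        - iter_integral A (\<beta> l) [\<omega>\<^sub>3, \<omega>\<^sub>2] * iter_integral A (\<alpha> l) [\<omega>\<^sub>1]
        - iter_integral A (\<alpha> l) [\<omega>\<^sub>1] * iter_integral A (\<beta> l) [\<omega>\<^sub>2] * iter_integral A (\<alpha> l) [\<omega>\<^sub>3]
        + iter_integral A (\<beta> l) [\<omega>\<^sub>1] * iter_integral A (\<alpha> l) [\<omega>\<^sub>2] * iter_integral A (\<beta> l) [\<omega>\<^sub>3])"
    unfolding Ks_def map_map o_def sum_list_upt_Suc
  proof (rule sum.cong[OF HOL.refl])
    fix l assume l: "l \<in> {1..g}"
    have im: "path_image (\<alpha> l) \<subseteq> regular" "path_image (\<beta> l) \<subseteq> regular"
      using alpha[OF l] beta[OF l] by (auto simp: loop_in_def regular)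
    note a = holonomy_entries[OF _ im(1), unfolded w] and b = holonomy_entries[OF _ im(2), unfolded w]
    show "e14 (K l) =
          iter_integral A (\<alpha> l) [\<omega>\<^sub>1, \<omega>\<^sub>2] * iter_integral A (\<beta> l) [\<omega>\<^sub>3]
        - iter_integral A (\<beta> l) [\<omega>\<^sub>1, \<omega>\<^sub>2] * iter_integral A (\<alpha> l) [\<omega>\<^sub>3]
        + iter_integral A (\<alpha> l) [\<omega>\<^sub>3, \<omega>\<^sub>2] * iter_integral A (\<beta> l) [\<omega>\<^sub>1]
        - iter_integral A (\<beta> l) [\<omega>\<^sub>3, \<omega>\<^sub>2] * iter_integral A (\<alpha> l) [\<omega>\<^sub>1]
        - iter_integral A (\<alpha> l) [\<omega>\<^sub>1] * iter_integral A (\<beta> l) [\<omega>\<^sub>2] * iter_integral A (\<alpha> l) [\<omega>\<^sub>3]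
        + iter_integral A (\<beta> l) [\<omega>\<^sub>1] * iter_integral A (\<alpha> l) [\<omega>\<^sub>2] * iter_integral A (\<beta> l) [\<omega>\<^sub>3]"
      unfolding K_def e14_commutator using a b alpha[OF l] beta[OF l] by metis
  qed
  ultimately show ?thesis
    by simp
qed

end
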